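(* Let $R$ be an Artin algebra and let $(M_n)_{n \in \mathbb{N}}$ be a family of pairwise non-isomorphic finitely generated, indecomposable $R$-modules. Then the direct product $\prod_{n \in \mathbb{N}} M_n$ is not a direct sum of finitely generated submodules.
   Context: Rings are associative with identity; modules are unital left modules. An Artin algebra is a ring whose center is a commutative artinian ring and which is finitely generated as a module over its center. *)

theory Defs
  imports "HOL-Algebra.Algebra"
begin

section \<open>Left modules over a not necessarily commutative ring\<close>

text \<open>
  The locale \<open>module\<close> of HOL-Algebra requires the scalars to be commutative. The axioms below
  are the same ones over an arbitrary ring. The record type of modules and the locale
  \<open>submodule\<close>, which does not mention commutativity, are those of the library. As there, the
  multiplicative fields of a module record carry no information.
\<close>

locale left_module = R?: ring R + M?: abelian_group M
  for R :: "('r, 'c) ring_scheme" (structure) and M :: "('r, 'm, 'd) module_scheme" (structure) +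
  assumes smult_closed [simp, intro]:
      "\<lbrakk>a \<in> carrier R; x \<in> carrier M\<rbrakk> \<Longrightarrow> a \<odot>\<^bsub>M\<^esub> x \<in> carrier M"
    and smult_l_distr:
      "\<lbrakk>a \<in> carrier R; b \<in> carrier R; x \<in> carrier M\<rbrakk> \<Longrightarrow>
        (a \<oplus>\<^bsub>R\<^esub> b) \<odot>\<^bsub>M\<^esub> x = a \<odot>\<^bsub>M\<^esub> x \<oplus>\<^bsub>M\<^esub> b \<odot>\<^bsub>M\<^esub> x"
    and smult_r_distr:
      "\<lbrakk>a \<in> carrier R; x \<in> carrier M; y \<in> carrier M\<rbrakk> \<Longrightarrow>
        a \<odot>\<^bsub>M\<^esub> (x \<oplus>\<^bsub>M\<^esub> y) = a \<odot>\<^bsub>M\<^esub> x \<oplus>\<^bsub>M\<^esub> a \<odot>\<^bsub>M\<^esub> y"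
    and smult_assoc1:
      "\<lbrakk>a \<in> carrier R; b \<in> carrier R; x \<in> carrier M\<rbrakk> \<Longrightarrow>
        (a \<otimes>\<^bsub>R\<^esub> b) \<odot>\<^bsub>M\<^esub> x = a \<odot>\<^bsub>M\<^esub> (b \<odot>\<^bsub>M\<^esub> x)"
    and smult_one [simp]: "x \<in> carrier M \<Longrightarrow> \<one>\<^bsub>R\<^esub> \<odot>\<^bsub>M\<^esub> x = x"

lemma module_iff_left_module: "module R M \<longleftrightarrow> cring R \<and> left_module R M"
  by (auto simp: module_def module_axioms_def left_module_def left_module_axioms_def
      dest: cring.axioms(1))

definition left_module_hom ::
    "('r, 'c) ring_scheme \<Rightarrow> ('r, 'm, 'd) module_scheme \<Rightarrow> ('r, 'n, 'e) module_scheme \<Rightarrow> ('m \<Rightarrow> 'n) set"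
  where "left_module_hom R M N =
    {f \<in> carrier M \<rightarrow> carrier N.
      (\<forall>x \<in> carrier M. \<forall>y \<in> carrier M. f (x \<oplus>\<^bsub>M\<^esub> y) = f x \<oplus>\<^bsub>N\<^esub> f y) \<and>
      (\<forall>a \<in> carrier R. \<forall>x \<in> carrier M. f (a \<odot>\<^bsub>M\<^esub> x) = a \<odot>\<^bsub>N\<^esub> f x)}"

definition left_module_isomorphic ::
    "('r, 'c) ring_scheme \<Rightarrow> ('r, 'm, 'd) module_scheme \<Rightarrow> ('r, 'n, 'e) module_scheme \<Rightarrow> bool"
  where "left_module_isomorphic R M N \<longleftrightarrow>
    (\<exists>f \<in> left_module_hom R M N. bij_betw f (carrier M) (carrier N))"

definition submodule_generated ::
    "('r, 'c) ring_scheme \<Rightarrow> ('r, 'm, 'd) module_scheme \<Rightarrow> 'm set \<Rightarrow> 'm set"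
  where "submodule_generated R M A = \<Inter>{N. submodule N R M \<and> A \<subseteq> N}"

definition finitely_generated_module ::
    "('r, 'c) ring_scheme \<Rightarrow> ('r, 'm, 'd) module_scheme \<Rightarrow> bool"
  where "finitely_generated_module R M \<longleftrightarrow>
    (\<exists>A. finite A \<and> A \<subseteq> carrier M \<and> submodule_generated R M A = carrier M)"

definition indecomposable_module ::
    "('r, 'c) ring_scheme \<Rightarrow> ('r, 'm, 'd) module_scheme \<Rightarrow> bool"
  where "indecomposable_module R M \<longleftrightarrow>
    carrier M \<noteq> {\<zero>\<^bsub>M\<^esub>} \<and>
    (\<forall>A B. submodule A R M \<longrightarrow> submodule B R M \<longrightarrow>
      A \<inter> B = {\<zero>\<^bsub>M\<^esub>} \<longrightarrow> A <+>\<^bsub>M\<^esub> B = carrier M \<longrightarrow> A = {\<zero>\<^bsub>M\<^esub>} \<or> B = {\<zero>\<^bsub>M\<^esub>})"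

text \<open>
  Internal direct sum of a family of submodules: every element is, in exactly one way, a sum
  of a finitely supported family of components. The index set may be infinite, hence the sum
  is taken over the support.
\<close>

definition is_direct_sum_of_submodules ::
    "('r, 'c) ring_scheme \<Rightarrow> ('r, 'm, 'd) module_scheme \<Rightarrow> 'i set \<Rightarrow> ('i \<Rightarrow> 'm set) \<Rightarrow> bool"
  where "is_direct_sum_of_submodules R M I N \<longleftrightarrow>
    (\<forall>i \<in> I. submodule (N i) R M) \<and>
    (\<forall>x \<in> carrier M. \<exists>!f. f \<in> (\<Pi>\<^sub>E i \<in> I. N i) \<and> finite {i \<in> I. f i \<noteq> \<zero>\<^bsub>M\<^esub>} \<and>
      x = (\<Oplus>\<^bsub>M\<^esub> i \<in> {i \<in> I. f i \<noteq> \<zero>\<^bsub>M\<^esub>}. f i))"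

definition product_module ::
    "'i set \<Rightarrow> ('i \<Rightarrow> ('r, 'm, 'd) module_scheme) \<Rightarrow> ('r, 'i \<Rightarrow> 'm) module"
  where "product_module I M =
    \<lparr>carrier = (\<Pi>\<^sub>E i \<in> I. carrier (M i)),
     monoid.mult = (\<lambda>x y. \<lambda>i \<in> I. x i \<otimes>\<^bsub>M i\<^esub> y i),
     monoid.one = (\<lambda>i \<in> I. \<one>\<^bsub>M i\<^esub>),
     ring.zero = (\<lambda>i \<in> I. \<zero>\<^bsub>M i\<^esub>),
     ring.add = (\<lambda>x y. \<lambda>i \<in> I. x i \<oplus>\<^bsub>M i\<^esub> y i),
     module.smult = (\<lambda>a x. \<lambda>i \<in> I. a \<odot>\<^bsub>M i\<^esub> x i)\<rparr>"

lemma left_module_product_module: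
  assumes "ring R" and M: "\<And>i. i \<in> I \<Longrightarrow> left_module R (M i)"
  shows "left_module R (product_module I M)"
proof -
  have ab: "abelian_group (M i)" if "i \<in> I" for i
    using M[OF that] by (simp add: left_module_def)
  then have am: "abelian_monoid (M i)" if "i \<in> I" for i
    using that by (simp add: abelian_group.axioms(1))
  have "abelian_group (product_module I M)"
  proof (rule abelian_groupI)
    fix x assume x: "x \<in> carrier (product_module I M)"
    show "\<exists>y \<in> carrier (product_module I M).
        y \<oplus>\<^bsub>product_module I M\<^esub> x = \<zero>\<^bsub>product_module I M\<^esub>"
      using x ab
      by (intro bexI[of _ "\<lambda>i \<in> I. \<ominus>\<^bsub>M i\<^esub> x i"])
        (auto simp: product_module_def PiE_iff abelian_group.l_neg abelian_group.a_inv_closed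
          intro!: restrict_ext)
  next
    fix x assume "x \<in> carrier (product_module I M)"
    then show "\<zero>\<^bsub>product_module I M\<^esub> \<oplus>\<^bsub>product_module I M\<^esub> x = x"
      using am abelian_monoid.l_zero
      by (fastforce simp: product_module_def PiE_iff extensional_def fun_eq_iff)
  qed (use am in
      \<open>auto simp: product_module_def PiE_iff abelian_monoid.a_assoc
        abelian_monoid.a_closed abelian_monoid.zero_closed intro!: restrict_ext
        intro: abelian_monoid.a_comm\<close>)
  moreover have "left_module_axioms R (product_module I M)"
    by (rule left_module_axioms.intro)
      (auto simp: product_module_def PiE_iff extensional_def fun_eq_iff
        M[THEN left_module.smult_closed] M[THEN left_module.smult_l_distr]
        M[THEN left_module.smult_r_distr] M[THEN left_module.smult_assoc1]
        M[THEN left_module.smult_one])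
  ultimately show ?thesis
    using assms(1) by (simp add: left_module_def)
qed


section \<open>Artin algebras\<close>

definition ring_center :: "('r, 'c) ring_scheme \<Rightarrow> 'r set"
  where "ring_center R = {z \<in> carrier R. \<forall>x \<in> carrier R. z \<otimes>\<^bsub>R\<^esub> x = x \<otimes>\<^bsub>R\<^esub> z}"

text \<open>The ring \<open>R\<close> acting on itself from the left; used below with scalars restricted to the center.\<close>

definition regular_module :: "('r, 'c) ring_scheme \<Rightarrow> ('r, 'r) module"
  where "regular_module R =
    \<lparr>carrier = carrier R, monoid.mult = monoid.mult R,
     monoid.one = monoid.one R, ring.zero = ring.zero R, ring.add = ring.add R,
     module.smult = monoid.mult R\<rparr>"

lemma (in ring) subcring_ring_center: "subcring (ring_center R) R"
proof (intro subcring.intro subringI subcring_axioms.intro)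
  fix z assume z: "z \<in> ring_center R"
  then show "\<ominus> z \<in> ring_center R"
    by (auto simp: ring_center_def l_minus r_minus)
next
  fix z w assume zw: "z \<in> ring_center R" "w \<in> ring_center R"
  then have c: "z \<in> carrier R" "w \<in> carrier R" by (auto simp: ring_center_def)
  have "(z \<otimes> w) \<otimes> x = x \<otimes> (z \<otimes> w)" if x: "x \<in> carrier R" for x
  proof -
    have comm: "z \<otimes> x = x \<otimes> z" "w \<otimes> x = x \<otimes> w"
      using zw x unfolding ring_center_def by blast+
    have "(z \<otimes> w) \<otimes> x = z \<otimes> (x \<otimes> w)"
      by (simp only: m_assoc[OF c x] comm(2))
    also have "\<dots> = (x \<otimes> z) \<otimes> w"
      by (simp only: m_assoc[OF c(1) x c(2), symmetric] comm(1))
    also have "\<dots> = x \<otimes> (z \<otimes> w)"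
      by (rule m_assoc[OF x c])
    finally show ?thesis .
  qed
  then show "z \<otimes> w \<in> ring_center R" using c by (simp add: ring_center_def)
next
  fix z w assume zw: "z \<in> ring_center R" "w \<in> ring_center R"
  then show "z \<oplus> w \<in> ring_center R"
    unfolding ring_center_def by (simp add: l_distr r_distr)
  show "z \<otimes> w = w \<otimes> z"
    using zw unfolding ring_center_def by blast
qed (simp_all add: ring_center_def subset_eq)

lemma (in ring) module_regular_module_center:
  "module (R\<lparr>carrier := ring_center R\<rparr>) (regular_module R)"
proof -
  have c: "z \<in> carrier R" if "z \<in> ring_center R" for z
    using that by (simp add: ring_center_def)
  show ?thesis
  proof (rule moduleI)
    show "cring (R\<lparr>carrier := ring_center R\<rparr>)"
      using subcring_ring_center subcring_iff[of "ring_center R"] by (auto simp: ring_center_def)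
    show "abelian_group (regular_module R)"
    proof (rule abelian_groupI)
      fix x assume "x \<in> carrier (regular_module R)"
      then show "\<exists>y \<in> carrier (regular_module R).
          y \<oplus>\<^bsub>regular_module R\<^esub> x = \<zero>\<^bsub>regular_module R\<^esub>"
        by (intro bexI[of _ "\<ominus> x"]) (simp_all add: regular_module_def l_neg)
    qed (simp_all add: regular_module_def a_assoc, simp add: a_comm)
  qed (simp_all add: regular_module_def c l_distr r_distr m_assoc)
qed

locale artinian_cring = cring +
  assumes descending_chain_condition:
    "\<lbrakk>\<And>n :: nat. ideal (J n) R; \<And>n. J (Suc n) \<subseteq> J n\<rbrakk> \<Longrightarrow> \<exists>k. \<forall>n \<ge> k. J n = J k"

locale artin_algebra = ring +
  assumes center_artinian: "artinian_cring (R\<lparr>carrier := ring_center R\<rparr>)"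
    and finitely_generated_over_center:
      "finitely_generated_module (R\<lparr>carrier := ring_center R\<rparr>) (regular_module R)"

end

theory Submission
  imports Defs
begin

text \<open>
  Let \<open>k\<close> be the center of \<open>R\<close> and let \<open>P\<close> be the product of the modules \<open>M n\<close>. Suppose that \<open>P\<close>
  is the direct sum of finitely generated submodules \<open>N i\<close>. Each \<open>M n\<close> is finitely generated and
  thus has nonzero components in only finitely many of the \<open>N i\<close>. Finitely generated modules are
  artinian over \<open>k\<close>; so, if every nonzero \<open>N i\<close> were met by some \<open>M n\<close>, then \<open>P\<close> would be the
  union of a sequence of artinian submodules, which a diagonal argument excludes
  (\<open>product_not_union_of_artinian\<close>). Hence some \<open>N i\<close> is nonzero and is met by no \<open>M n\<close>. It has
  an indecomposable direct summand \<open>V\<close> (\<open>indecomposable_summand_exists\<close>), and the projection \<open>g\<close>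
  of \<open>P\<close> onto \<open>V\<close> vanishes on every \<open>M n\<close>.

  This is impossible, because maps starting at \<open>V\<close> are controlled by one system of linear
  equations with finitely many unknowns (\<open>isolating_system\<close>): there are \<open>x j\<close> in \<open>V\<close> and finitely
  many columns \<open>c\<close> over \<open>R\<close> such that the equations \<open>x j = \<Sum>c. c j \<cdot> m c\<close> have no solution \<open>m\<close> in
  \<open>V\<close>, although for each homomorphism \<open>h\<close> from \<open>V\<close> to \<open>P\<close> that is not a split monomorphism the
  equations \<open>h (x j) = \<Sum>c. c j \<cdot> m c\<close> are solvable in \<open>P\<close>. The system plays the part of a left
  almost split map starting at \<open>V\<close>. If the \<open>n\<close>-th coordinate map \<open>V \<rightarrow> M n\<close> is a split
  monomorphism, then \<open>V\<close> and \<open>M n\<close> are isomorphic, which happens for at most one \<open>n\<close>. For the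
  other \<open>n\<close> the equations are solvable in \<open>M n\<close>. Since the system is the same for all \<open>n\<close>, these
  solutions are the coordinates of one solution in \<open>P\<close>, and \<open>g\<close>, which does not see the
  exceptional coordinate, maps it to a solution in \<open>V\<close>: a contradiction
  (\<open>no_summand_vanishing_on_components\<close>).

  If \<open>k\<close> is a field, the isolating system is found with linear forms. Choose a linear form on
  \<open>V\<^sup>q\<close> that vanishes on the images of a generating tuple under all non-bijective endomorphisms
  of \<open>V\<close>, but not on the tuple itself, and such that for no nonzero \<open>z\<close> in \<open>V\<close> it vanishes on
  \<open>c \<cdot> z\<close> for all \<open>c\<close> in \<open>R\<^sup>q\<close>; the columns \<open>c\<close> generate the right module of all \<open>c\<close> in \<open>R\<^sup>q\<close>
  such that the form vanishes on \<open>c \<cdot> V\<close>. For an artinian \<open>k\<close> the forms should take values in the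
  injective hull of the residue field. No such hull is constructed here. Instead, a form is
  replaced by a \<open>k\<close>-submodule \<open>K\<close> that is maximal among the submodules which do not contain a
  given vector (\<open>maximal_avoiding\<close>): the factor module modulo \<open>K\<close> is an essential extension of a
  simple module, and such factor modules can be enlarged when two of them have to be compared.
  The part of duality that is needed, namely that every linear form on a space of forms on \<open>V\<close> is
  the evaluation at an element of \<open>V\<close>, holds in this setting (\<open>linear_form_is_evaluation\<close>). It
  provides the map that splits \<open>h\<close> when the equations are not solvable (\<open>splitting\<close>). That the
  non-bijective endomorphisms are closed under addition is Fitting's lemma (\<open>fitting_lemma\<close>,
  \<open>radical_End_add\<close>).
\<close>

section \<open>Submodules and homomorphisms\<close>

context left_module
begin

lemma smult_zero_left [simp]: "x \<in> carrier M \<Longrightarrow> \<zero>\<^bsub>R\<^esub> \<odot>\<^bsub>M\<^esub> x = \<zero>\<^bsub>M\<^esub>"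
  using smult_l_distr[of "\<zero>\<^bsub>R\<^esub>" "\<zero>\<^bsub>R\<^esub>" x] by simp

lemma smult_zero_right [simp]: "a \<in> carrier R \<Longrightarrow> a \<odot>\<^bsub>M\<^esub> \<zero>\<^bsub>M\<^esub> = \<zero>\<^bsub>M\<^esub>"
  using smult_r_distr[of a "\<zero>\<^bsub>M\<^esub>" "\<zero>\<^bsub>M\<^esub>"] by simp

lemma smult_minus_one: "x \<in> carrier M \<Longrightarrow> (\<ominus>\<^bsub>R\<^esub> \<one>\<^bsub>R\<^esub>) \<odot>\<^bsub>M\<^esub> x = \<ominus>\<^bsub>M\<^esub> x"
  using smult_l_distr[of "\<ominus>\<^bsub>R\<^esub> \<one>\<^bsub>R\<^esub>" "\<one>\<^bsub>R\<^esub>" x]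
  by (intro M.minus_equality[symmetric]) (simp_all add: R.l_neg)

lemma smult_minus_right: "a \<in> carrier R \<Longrightarrow> x \<in> carrier M \<Longrightarrow> a \<odot>\<^bsub>M\<^esub> (\<ominus>\<^bsub>M\<^esub> x) = \<ominus>\<^bsub>M\<^esub> (a \<odot>\<^bsub>M\<^esub> x)"
  using smult_r_distr[of a "\<ominus>\<^bsub>M\<^esub> x" x]
  by (intro M.minus_equality[symmetric]) (simp_all add: M.l_neg)

lemma smult_diff: "a \<in> carrier R \<Longrightarrow> x \<in> carrier M \<Longrightarrow> y \<in> carrier M \<Longrightarrow>
    a \<odot>\<^bsub>M\<^esub> (x \<ominus>\<^bsub>M\<^esub> y) = a \<odot>\<^bsub>M\<^esub> x \<ominus>\<^bsub>M\<^esub> a \<odot>\<^bsub>M\<^esub> y"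
  by (simp add: M.minus_eq smult_r_distr smult_minus_right)

lemma submoduleI:
  assumes "H \<subseteq> carrier M" "\<zero>\<^bsub>M\<^esub> \<in> H" "\<And>x y. x \<in> H \<Longrightarrow> y \<in> H \<Longrightarrow> x \<oplus>\<^bsub>M\<^esub> y \<in> H"
    and smult: "\<And>a x. a \<in> carrier R \<Longrightarrow> x \<in> H \<Longrightarrow> a \<odot>\<^bsub>M\<^esub> x \<in> H"
  shows "submodule H R M"
proof (intro submodule.intro subgroup.intro submodule_axioms.intro)
  fix x assume x: "x \<in> H"
  then have "\<ominus>\<^bsub>M\<^esub> x \<in> H"
    using smult[OF _ x, of "\<ominus>\<^bsub>R\<^esub> \<one>\<^bsub>R\<^esub>"] assms(1) smult_minus_one by (auto simp: subset_iff)
  then show "inv\<^bsub>add_monoid M\<^esub> x \<in> H" by (simp add: a_inv_def)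
qed (use assms in auto)

lemma submoduleD:
  assumes "submodule H R M"
  shows "H \<subseteq> carrier M" "\<zero>\<^bsub>M\<^esub> \<in> H" "x \<in> H \<Longrightarrow> y \<in> H \<Longrightarrow> x \<oplus>\<^bsub>M\<^esub> y \<in> H"
    "a \<in> carrier R \<Longrightarrow> x \<in> H \<Longrightarrow> a \<odot>\<^bsub>M\<^esub> x \<in> H" "x \<in> H \<Longrightarrow> \<ominus>\<^bsub>M\<^esub> x \<in> H"
    "x \<in> H \<Longrightarrow> y \<in> H \<Longrightarrow> x \<ominus>\<^bsub>M\<^esub> y \<in> H" "x \<in> H \<Longrightarrow> x \<in> carrier M"
proof -
  have sub: "subgroup H (add_monoid M)" and ax: "submodule_axioms H R M"
    using assms by (simp_all add: submodule_def)
  show 1: "H \<subseteq> carrier M" using subgroup.subset[OF sub] by simp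
  show 2: "\<zero>\<^bsub>M\<^esub> \<in> H" using subgroup.one_closed[OF sub] by simp
  show 3: "x \<in> H \<Longrightarrow> y \<in> H \<Longrightarrow> x \<oplus>\<^bsub>M\<^esub> y \<in> H" for x y
    using subgroup.m_closed[OF sub, of x y] by simp
  show "a \<in> carrier R \<Longrightarrow> x \<in> H \<Longrightarrow> a \<odot>\<^bsub>M\<^esub> x \<in> H"
    using ax by (simp add: submodule_axioms_def)
  show 4: "x \<in> H \<Longrightarrow> \<ominus>\<^bsub>M\<^esub> x \<in> H" for x
    using subgroup.m_inv_closed[OF sub, of x] by (simp add: a_inv_def)
  show "x \<in> H \<Longrightarrow> y \<in> H \<Longrightarrow> x \<ominus>\<^bsub>M\<^esub> y \<in> H"
    unfolding M.minus_eq by (intro 3 4)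
  show "x \<in> H \<Longrightarrow> x \<in> carrier M" using 1 by blast
qed

lemmas group_normalise = M.minus_eq M.a_assoc M.a_comm M.a_lcomm M.a_closed M.a_inv_closed
  M.r_neg1 M.r_neg2 M.r_neg M.l_neg M.minus_add M.minus_minus M.l_zero M.r_zero
  M.zero_closed

lemma add_minus_cancel: "x \<in> carrier M \<Longrightarrow> y \<in> carrier M \<Longrightarrow> (x \<ominus>\<^bsub>M\<^esub> y) \<oplus>\<^bsub>M\<^esub> y = x"
  by (simp only: group_normalise)

lemma minus_add_cancel: "x \<in> carrier M \<Longrightarrow> y \<in> carrier M \<Longrightarrow> (x \<oplus>\<^bsub>M\<^esub> y) \<ominus>\<^bsub>M\<^esub> y = x"
  by (simp only: group_normalise)

lemma minus_self [simp]: "x \<in> carrier M \<Longrightarrow> x \<ominus>\<^bsub>M\<^esub> x = \<zero>\<^bsub>M\<^esub>"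
  by (simp only: group_normalise)

lemma minus_zero_right [simp]: "x \<in> carrier M \<Longrightarrow> x \<ominus>\<^bsub>M\<^esub> \<zero>\<^bsub>M\<^esub> = x"
  using add_minus_cancel[of x "\<zero>\<^bsub>M\<^esub>"] by simp

lemma minus_eq_zeroD: "x \<in> carrier M \<Longrightarrow> y \<in> carrier M \<Longrightarrow> x \<ominus>\<^bsub>M\<^esub> y = \<zero>\<^bsub>M\<^esub> \<Longrightarrow> x = y"
  by (metis M.l_zero add_minus_cancel)

lemma zero_in_carrier: "\<zero>\<^bsub>M\<^esub> \<in> carrier M"
  and zero_add_zero: "\<zero>\<^bsub>M\<^esub> \<oplus>\<^bsub>M\<^esub> \<zero>\<^bsub>M\<^esub> = \<zero>\<^bsub>M\<^esub>"
  by simp_all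

lemma submodule_add_cancel_left:
  assumes H: "submodule H R M" and x: "x \<in> carrier M" and y: "y \<in> H" and xy: "x \<oplus>\<^bsub>M\<^esub> y \<in> H"
  shows "x \<in> H"
  using submoduleD(6)[OF H xy y] minus_add_cancel[OF x submoduleD(7)[OF H y]] by simp

lemma submodule_minus_trans:
  assumes H: "submodule H R M" and c: "x \<in> carrier M" "y \<in> carrier M" "z \<in> carrier M"
    and xy: "x \<ominus>\<^bsub>M\<^esub> y \<in> H" and yz: "y \<ominus>\<^bsub>M\<^esub> z \<in> H"
  shows "x \<ominus>\<^bsub>M\<^esub> z \<in> H"
proof -
  have "x \<ominus>\<^bsub>M\<^esub> z = (x \<ominus>\<^bsub>M\<^esub> y) \<oplus>\<^bsub>M\<^esub> (y \<ominus>\<^bsub>M\<^esub> z)"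
    using c by (simp only: group_normalise)
  then show ?thesis using submoduleD(3)[OF H xy yz] by simp
qed

lemma submodule_minus_commute:
  assumes H: "submodule H R M" and c: "x \<in> carrier M" "y \<in> carrier M" and xy: "x \<ominus>\<^bsub>M\<^esub> y \<in> H"
  shows "y \<ominus>\<^bsub>M\<^esub> x \<in> H"
proof -
  have "y \<ominus>\<^bsub>M\<^esub> x = \<ominus>\<^bsub>M\<^esub> (x \<ominus>\<^bsub>M\<^esub> y)"
    using c by (simp only: group_normalise)
  then show ?thesis using submoduleD(5)[OF H xy] by simp
qed

lemma submodule_minus_add:
  assumes H: "submodule H R M" and c: "x \<in> carrier M" "y \<in> carrier M" "x' \<in> carrier M" "y' \<in> carrier M"
    and 1: "x \<ominus>\<^bsub>M\<^esub> y \<in> H" and 2: "x' \<ominus>\<^bsub>M\<^esub> y' \<in> H"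
  shows "(x \<oplus>\<^bsub>M\<^esub> x') \<ominus>\<^bsub>M\<^esub> (y \<oplus>\<^bsub>M\<^esub> y') \<in> H"
proof -
  have "(x \<oplus>\<^bsub>M\<^esub> x') \<ominus>\<^bsub>M\<^esub> (y \<oplus>\<^bsub>M\<^esub> y') = (x \<ominus>\<^bsub>M\<^esub> y) \<oplus>\<^bsub>M\<^esub> (x' \<ominus>\<^bsub>M\<^esub> y')"
    using c by (simp only: group_normalise)
  then show ?thesis using submoduleD(3)[OF H 1 2] by simp
qed

lemma submodule_minus_iff:
  assumes H: "submodule H R M" and c: "x \<in> carrier M" "y \<in> carrier M" and xy: "x \<ominus>\<^bsub>M\<^esub> y \<in> H"
  shows "x \<in> H \<longleftrightarrow> y \<in> H"
  by (metis H add_minus_cancel c submoduleD(3) submodule_minus_commute xy)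

lemma submodule_zero: "submodule {\<zero>\<^bsub>M\<^esub>} R M"
  by (rule submoduleI) auto

lemma submodule_carrier: "submodule (carrier M) R M"
  by (rule submoduleI) auto

lemma submodule_Int: "submodule H R M \<Longrightarrow> submodule K R M \<Longrightarrow> submodule (H \<inter> K) R M"
  by (rule submoduleI) (auto dest: submoduleD)

lemma submodule_Inter:
  assumes "\<And>H. H \<in> S \<Longrightarrow> submodule H R M" "S \<noteq> {}"
  shows "submodule (\<Inter>S) R M"
proof (rule submoduleI)
  show "\<Inter>S \<subseteq> carrier M" using submoduleD(1)[OF assms(1)] assms(2) by blast
  show "\<zero>\<^bsub>M\<^esub> \<in> \<Inter>S" using submoduleD(2)[OF assms(1)] by blast
  show "x \<oplus>\<^bsub>M\<^esub> y \<in> \<Inter>S" if "x \<in> \<Inter>S" "y \<in> \<Inter>S" for x y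
    using submoduleD(3)[OF assms(1)] that by blast
  show "a \<odot>\<^bsub>M\<^esub> x \<in> \<Inter>S" if "a \<in> carrier R" "x \<in> \<Inter>S" for a x
    using submoduleD(4)[OF assms(1)] that by blast
qed

lemma submodule_Union_chain:
  assumes "\<And>H. H \<in> S \<Longrightarrow> submodule H R M" "S \<noteq> {}" and chain: "\<And>H K. H \<in> S \<Longrightarrow> K \<in> S \<Longrightarrow> H \<subseteq> K \<or> K \<subseteq> H"
  shows "submodule (\<Union>S) R M"
proof (rule submoduleI)
  show "\<Union>S \<subseteq> carrier M" using submoduleD(1)[OF assms(1)] assms(2) by blast
  show "\<zero>\<^bsub>M\<^esub> \<in> \<Union>S" using submoduleD(2)[OF assms(1)] assms(2) by blast
next
  fix x y assume "x \<in> \<Union>S" "y \<in> \<Union>S"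
  then obtain H K where "H \<in> S" "K \<in> S" "x \<in> H" "y \<in> K" by blast
  then show "x \<oplus>\<^bsub>M\<^esub> y \<in> \<Union>S"
    using chain[of H K] submoduleD(3)[OF assms(1)[of H], of x y] submoduleD(3)[OF assms(1)[of K], of x y]
    by blast
next
  fix a x assume "a \<in> carrier R" "x \<in> \<Union>S"
  then show "a \<odot>\<^bsub>M\<^esub> x \<in> \<Union>S" using submoduleD(4)[OF assms(1)] by blast
qed

lemma submodule_generated_is_submodule:
  assumes "A \<subseteq> carrier M"
  shows "submodule (submodule_generated R M A) R M"
  unfolding submodule_generated_def
  by (rule submodule_Inter) (use assms submodule_carrier in auto)

lemma submodule_generated_minimal:
  "submodule H R M \<Longrightarrow> A \<subseteq> H \<Longrightarrow> submodule_generated R M A \<subseteq> H"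
  unfolding submodule_generated_def by blast

lemma subset_submodule_generated: "A \<subseteq> submodule_generated R M A"
  unfolding submodule_generated_def by blast

lemma set_add_iff: "x \<in> H <+>\<^bsub>M\<^esub> K \<longleftrightarrow> (\<exists>h\<in>H. \<exists>k\<in>K. x = h \<oplus>\<^bsub>M\<^esub> k)"
  by (auto simp: set_add_def set_mult_def)

lemma submodule_set_add:
  assumes H: "submodule H R M" and K: "submodule K R M"
  shows "submodule (H <+>\<^bsub>M\<^esub> K) R M"
proof (rule submoduleI)
  show "H <+>\<^bsub>M\<^esub> K \<subseteq> carrier M"
    using submoduleD(1)[OF H] submoduleD(1)[OF K] by (auto simp: set_add_iff subset_iff)
  show "\<zero>\<^bsub>M\<^esub> \<in> H <+>\<^bsub>M\<^esub> K"
    unfolding set_add_iff using submoduleD(2)[OF H] submoduleD(2)[OF K] by force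
next
  fix x y assume "x \<in> H <+>\<^bsub>M\<^esub> K" "y \<in> H <+>\<^bsub>M\<^esub> K"
  then obtain h k h' k' where *: "h \<in> H" "k \<in> K" "h' \<in> H" "k' \<in> K" "x = h \<oplus>\<^bsub>M\<^esub> k" "y = h' \<oplus>\<^bsub>M\<^esub> k'"
    unfolding set_add_iff by blast
  then have c: "h \<in> carrier M" "k \<in> carrier M" "h' \<in> carrier M" "k' \<in> carrier M"
    using submoduleD(7)[OF H] submoduleD(7)[OF K] by auto
  have "x \<oplus>\<^bsub>M\<^esub> y = (h \<oplus>\<^bsub>M\<^esub> h') \<oplus>\<^bsub>M\<^esub> (k \<oplus>\<^bsub>M\<^esub> k')"
    unfolding * using c by (simp only: group_normalise)
  then show "x \<oplus>\<^bsub>M\<^esub> y \<in> H <+>\<^bsub>M\<^esub> K"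
    unfolding set_add_iff using submoduleD(3)[OF H *(1,3)] submoduleD(3)[OF K *(2,4)] by blast
next
  fix a x assume a: "a \<in> carrier R" and "x \<in> H <+>\<^bsub>M\<^esub> K"
  then obtain h k where *: "h \<in> H" "k \<in> K" "x = h \<oplus>\<^bsub>M\<^esub> k"
    unfolding set_add_iff by blast
  then have "a \<odot>\<^bsub>M\<^esub> x = a \<odot>\<^bsub>M\<^esub> h \<oplus>\<^bsub>M\<^esub> a \<odot>\<^bsub>M\<^esub> k"
    using a smult_r_distr submoduleD(7)[OF H] submoduleD(7)[OF K] by simp
  then show "a \<odot>\<^bsub>M\<^esub> x \<in> H <+>\<^bsub>M\<^esub> K"
    unfolding set_add_iff using submoduleD(4)[OF H a *(1)] submoduleD(4)[OF K a *(2)] by blast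
qed

lemma subset_set_add_left: "submodule H R M \<Longrightarrow> submodule K R M \<Longrightarrow> H \<subseteq> H <+>\<^bsub>M\<^esub> K"
  unfolding set_add_iff subset_iff by (metis M.r_zero submoduleD(2,7))

lemma subset_set_add_right: "submodule H R M \<Longrightarrow> submodule K R M \<Longrightarrow> K \<subseteq> H <+>\<^bsub>M\<^esub> K"
  unfolding set_add_iff subset_iff by (metis M.l_zero submoduleD(2,7))

lemma left_module_submodule:
  assumes H: "submodule H R M"
  shows "left_module R (M\<lparr>carrier := H\<rparr>)"
proof -
  note D = submoduleD[OF H]
  have "abelian_group (M\<lparr>carrier := H\<rparr>)"
  proof (rule abelian_groupI)
    fix x assume x: "x \<in> carrier (M\<lparr>carrier := H\<rparr>)"
    then show "\<exists>y\<in>carrier (M\<lparr>carrier := H\<rparr>). y \<oplus>\<^bsub>M\<lparr>carrier := H\<rparr>\<^esub> x = \<zero>\<^bsub>M\<lparr>carrier := H\<rparr>\<^esub>"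
      using D(5,7) M.l_neg by (intro bexI[of _ "\<ominus>\<^bsub>M\<^esub> x"]) auto
  qed (use D in \<open>auto simp: M.a_assoc intro: M.a_comm\<close>)
  moreover have "left_module_axioms R (M\<lparr>carrier := H\<rparr>)"
    by (rule left_module_axioms.intro)
      (use D(4,7) smult_l_distr smult_r_distr smult_assoc1 in auto)
  ultimately show ?thesis using R.ring_axioms by (simp add: left_module_def)
qed

lemma submodule_of_submodule:
  assumes H: "submodule H R M"
  shows "submodule K R (M\<lparr>carrier := H\<rparr>) \<longleftrightarrow> submodule K R M \<and> K \<subseteq> H"
proof -
  interpret H: left_module R "M\<lparr>carrier := H\<rparr>" by (rule left_module_submodule[OF H])
  show ?thesis
  proof
    assume K: "submodule K R (M\<lparr>carrier := H\<rparr>)"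
    note D = H.submoduleD[OF K]
    have "submodule K R M"
      by (rule submoduleI) (use D submoduleD(1)[OF H] in auto)
    then show "submodule K R M \<and> K \<subseteq> H" using D(1) by simp
  next
    assume K: "submodule K R M \<and> K \<subseteq> H"
    show "submodule K R (M\<lparr>carrier := H\<rparr>)"
      by (rule H.submoduleI) (use K submoduleD in auto)
  qed
qed

lemma submodule_minus_smult:
  assumes H: "submodule H R M" and a: "a \<in> carrier R" and c: "x \<in> carrier M" "y \<in> carrier M"
    and xy: "x \<ominus>\<^bsub>M\<^esub> y \<in> H"
  shows "a \<odot>\<^bsub>M\<^esub> x \<ominus>\<^bsub>M\<^esub> a \<odot>\<^bsub>M\<^esub> y \<in> H"
  using submoduleD(4)[OF H a xy] smult_diff[OF a c] by simp

lemma submodule_finsum: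
  assumes H: "submodule H R M" and "finite I" "\<And>i. i \<in> I \<Longrightarrow> u i \<in> H"
  shows "(\<Oplus>\<^bsub>M\<^esub>i\<in>I. u i) \<in> H"
  using assms(2,3)
proof (induction I rule: finite_induct)
  case empty show ?case unfolding M.finsum_empty by (rule submoduleD(2)[OF H])
next
  case (insert i I)
  have c: "u \<in> I \<rightarrow> carrier M" "u i \<in> carrier M" using insert.prems submoduleD(7)[OF H] by blast+
  have "(\<Oplus>\<^bsub>M\<^esub>i\<in>I. u i) \<in> H" using insert.IH insert.prems by blast
  then show ?case
    unfolding M.finsum_insert[OF insert.hyps c] using submoduleD(3)[OF H] insert.prems by blast
qed

lemma finsum_smult_distrib:
  assumes "finite I" "u \<in> I \<rightarrow> carrier M" "a \<in> carrier R"
  shows "a \<odot>\<^bsub>M\<^esub> (\<Oplus>\<^bsub>M\<^esub>i\<in>I. u i) = (\<Oplus>\<^bsub>M\<^esub>i\<in>I. a \<odot>\<^bsub>M\<^esub> u i)"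
  using assms(1,2)
proof (induction I rule: finite_induct)
  case empty show ?case unfolding M.finsum_empty by (rule smult_zero_right[OF assms(3)])
next
  case (insert i I)
  have c: "u \<in> I \<rightarrow> carrier M" "u i \<in> carrier M" using insert.prems by blast+
  have ac: "(\<lambda>i. a \<odot>\<^bsub>M\<^esub> u i) \<in> I \<rightarrow> carrier M" "a \<odot>\<^bsub>M\<^esub> u i \<in> carrier M"
    using c smult_closed[OF assms(3)] by blast+
  show ?case
    unfolding M.finsum_insert[OF insert.hyps c] M.finsum_insert[OF insert.hyps ac]
      smult_r_distr[OF assms(3) c(2) M.finsum_closed[OF c(1)]] insert.IH[OF c(1)] ..
qed

lemma finsum_extend_support:
  assumes T: "finite T" "A \<subseteq> T" and u: "u \<in> T \<rightarrow> carrier M" and 0: "\<And>i. i \<in> T \<Longrightarrow> i \<notin> A \<Longrightarrow> u i = \<zero>\<^bsub>M\<^esub>"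
  shows "(\<Oplus>\<^bsub>M\<^esub>i\<in>A. u i) = (\<Oplus>\<^bsub>M\<^esub>i\<in>T. u i)"
  by (rule M.add.finprod_mono_neutral_cong_left[OF T]) (use u 0 in auto)

end

lemma left_module_homI:
  assumes "\<And>x. x \<in> carrier M \<Longrightarrow> f x \<in> carrier N"
    and "\<And>x y. x \<in> carrier M \<Longrightarrow> y \<in> carrier M \<Longrightarrow> f (x \<oplus>\<^bsub>M\<^esub> y) = f x \<oplus>\<^bsub>N\<^esub> f y"
    and "\<And>a x. a \<in> carrier R \<Longrightarrow> x \<in> carrier M \<Longrightarrow> f (a \<odot>\<^bsub>M\<^esub> x) = a \<odot>\<^bsub>N\<^esub> f x"
  shows "f \<in> left_module_hom R M N"
  using assms by (auto simp: left_module_hom_def)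

lemma left_module_homD:
  assumes "f \<in> left_module_hom R M N"
  shows "x \<in> carrier M \<Longrightarrow> f x \<in> carrier N"
    and "x \<in> carrier M \<Longrightarrow> y \<in> carrier M \<Longrightarrow> f (x \<oplus>\<^bsub>M\<^esub> y) = f x \<oplus>\<^bsub>N\<^esub> f y"
    and "a \<in> carrier R \<Longrightarrow> x \<in> carrier M \<Longrightarrow> f (a \<odot>\<^bsub>M\<^esub> x) = a \<odot>\<^bsub>N\<^esub> f x"
  using assms by (auto simp: left_module_hom_def)

lemma left_module_hom_comp:
  assumes f: "f \<in> left_module_hom R L M" and g: "g \<in> left_module_hom R M N"
  shows "(\<lambda>x. g (f x)) \<in> left_module_hom R L N"
  using left_module_homD[OF f] left_module_homD[OF g] by (intro left_module_homI) auto

locale left_module_map = M: left_module R M + N: left_module R N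
  for R :: "('r, 'c) ring_scheme" and M :: "('r, 'm, 'd) module_scheme" and N :: "('r, 'n, 'e) module_scheme" +
  fixes f assumes hom: "f \<in> left_module_hom R M N"
begin

lemmas homD = left_module_homD[OF hom]

lemma hom_zero: "f \<zero>\<^bsub>M\<^esub> = \<zero>\<^bsub>N\<^esub>"
  using homD(3)[of "\<zero>\<^bsub>R\<^esub>" "\<zero>\<^bsub>M\<^esub>"] homD(1)[of "\<zero>\<^bsub>M\<^esub>"] by simp

lemma hom_minus: "x \<in> carrier M \<Longrightarrow> f (\<ominus>\<^bsub>M\<^esub> x) = \<ominus>\<^bsub>N\<^esub> f x"
  using homD(3)[of "\<ominus>\<^bsub>R\<^esub> \<one>\<^bsub>R\<^esub>" x] homD(1)[of x] by (simp add: M.smult_minus_one N.smult_minus_one)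

lemma hom_diff: "x \<in> carrier M \<Longrightarrow> y \<in> carrier M \<Longrightarrow> f (x \<ominus>\<^bsub>M\<^esub> y) = f x \<ominus>\<^bsub>N\<^esub> f y"
  by (simp add: M.minus_eq N.minus_eq homD hom_minus)

lemma submodule_preimage:
  assumes "submodule H R N" and G: "submodule G R M"
  shows "submodule {x \<in> G. f x \<in> H} R M"
  by (rule M.submoduleI)
    (use N.submoduleD[OF assms(1)] M.submoduleD[OF G] homD hom_zero in \<open>auto simp: subset_iff\<close>)

lemma submodule_image:
  assumes G: "submodule G R M"
  shows "submodule (f ` G) R N"
proof (rule N.submoduleI)
  show "f ` G \<subseteq> carrier N" using M.submoduleD(7)[OF G] homD(1) by auto
  show "\<zero>\<^bsub>N\<^esub> \<in> f ` G" using hom_zero M.submoduleD(2)[OF G] by (metis imageI)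
next
  fix x y assume "x \<in> f ` G" "y \<in> f ` G"
  then show "x \<oplus>\<^bsub>N\<^esub> y \<in> f ` G"
    using M.submoduleD(3,7)[OF G] homD(2) by (smt (verit) image_iff)
next
  fix a x assume "a \<in> carrier R" "x \<in> f ` G"
  then show "a \<odot>\<^bsub>N\<^esub> x \<in> f ` G"
    using M.submoduleD(4,7)[OF G] homD(3) by (smt (verit) image_iff)
qed

lemma hom_finsum:
  assumes "finite I" "\<And>i. i \<in> I \<Longrightarrow> u i \<in> carrier M"
  shows "f (\<Oplus>\<^bsub>M\<^esub>i\<in>I. u i) = (\<Oplus>\<^bsub>N\<^esub>i\<in>I. f (u i))"
  using assms
proof (induction I rule: finite_induct)
  case empty show ?case unfolding M.finsum_empty N.finsum_empty by (rule hom_zero)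
next
  case (insert i I)
  have u: "u \<in> I \<rightarrow> carrier M" "u i \<in> carrier M" using insert.prems by blast+
  have fu: "(\<lambda>i. f (u i)) \<in> I \<rightarrow> carrier N" "f (u i) \<in> carrier N"
    using insert.prems homD(1) by blast+
  have IH: "f (\<Oplus>\<^bsub>M\<^esub>i\<in>I. u i) = (\<Oplus>\<^bsub>N\<^esub>i\<in>I. f (u i))"
    using insert.IH insert.prems by blast
  have "f (\<Oplus>\<^bsub>M\<^esub>i\<in>insert i I. u i) = f (u i \<oplus>\<^bsub>M\<^esub> (\<Oplus>\<^bsub>M\<^esub>i\<in>I. u i))"
    unfolding M.finsum_insert[OF insert.hyps u] ..
  also have "\<dots> = f (u i) \<oplus>\<^bsub>N\<^esub> (\<Oplus>\<^bsub>N\<^esub>i\<in>I. f (u i))"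
    unfolding IH[symmetric] by (rule homD(2)[OF u(2) M.finsum_closed[OF u(1)]])
  also have "\<dots> = (\<Oplus>\<^bsub>N\<^esub>i\<in>insert i I. f (u i))"
    by (rule N.finsum_insert[OF insert.hyps fu, symmetric])
  finally show ?case .
qed

end

lemma left_module_mapI:
  "left_module R M \<Longrightarrow> left_module R N \<Longrightarrow> f \<in> left_module_hom R M N \<Longrightarrow> left_module_map R M N f"
  by (simp add: left_module_map_def left_module_map_axioms_def)

lemma left_module_hom_minus:
  assumes "left_module k M" "left_module k N" "cring k"
    and f: "f \<in> left_module_hom k M N" and g: "g \<in> left_module_hom k M N"
  shows "(\<lambda>x. f x \<ominus>\<^bsub>N\<^esub> g x) \<in> left_module_hom k M N"
proof (rule left_module_homI)
  interpret M: left_module k M by fact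
  interpret N: left_module k N by fact
  note fD = left_module_homD[OF f] and gD = left_module_homD[OF g]
  fix x assume x: "x \<in> carrier M"
  show "f x \<ominus>\<^bsub>N\<^esub> g x \<in> carrier N" by (rule N.M.minus_closed[OF fD(1)[OF x] gD(1)[OF x]])
  show "f (a \<odot>\<^bsub>M\<^esub> x) \<ominus>\<^bsub>N\<^esub> g (a \<odot>\<^bsub>M\<^esub> x) = a \<odot>\<^bsub>N\<^esub> (f x \<ominus>\<^bsub>N\<^esub> g x)" if a: "a \<in> carrier k" for a
    unfolding fD(3)[OF a x] gD(3)[OF a x] by (rule N.smult_diff[OF a fD(1)[OF x] gD(1)[OF x], symmetric])
  fix y assume y: "y \<in> carrier M"
  show "f (x \<oplus>\<^bsub>M\<^esub> y) \<ominus>\<^bsub>N\<^esub> g (x \<oplus>\<^bsub>M\<^esub> y) = f x \<ominus>\<^bsub>N\<^esub> g x \<oplus>\<^bsub>N\<^esub> (f y \<ominus>\<^bsub>N\<^esub> g y)"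
    unfolding fD(2)[OF x y] gD(2)[OF x y]
    using fD(1)[OF x] gD(1)[OF x] fD(1)[OF y] gD(1)[OF y] by (simp only: N.group_normalise)
qed

section \<open>Artinian submodules and submodules maximal without a vector\<close>

text \<open>
  The descending chain condition for the submodules inside \<open>D\<close>, in the form of the minimum
  condition. Referring to an ambient module makes it applicable to \<open>D\<close> as a mere set.
\<close>

definition artinian_in ::
    "('r, 'c) ring_scheme \<Rightarrow> ('r, 'm, 'd) module_scheme \<Rightarrow> 'm set \<Rightarrow> bool"
  where "artinian_in R M D \<longleftrightarrow>
    (\<forall>S. S \<noteq> {} \<longrightarrow> (\<forall>E\<in>S. submodule E R M \<and> E \<subseteq> D) \<longrightarrow>
      (\<exists>E\<in>S. \<forall>E'\<in>S. E' \<subseteq> E \<longrightarrow> E' = E))"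

lemma artinian_in_minimal:
  assumes "artinian_in R M D" "P E0" "\<And>E. P E \<Longrightarrow> submodule E R M \<and> E \<subseteq> D"
  obtains E where "P E" "\<And>E'. P E' \<Longrightarrow> E' \<subseteq> E \<Longrightarrow> E' = E"
proof -
  have "{E. P E} \<noteq> {}" "\<forall>E\<in>{E. P E}. submodule E R M \<and> E \<subseteq> D" using assms(2,3) by auto
  with assms(1)[unfolded artinian_in_def, THEN spec, of "{E. P E}"]
  have "\<exists>E\<in>{E. P E}. \<forall>E'\<in>{E. P E}. E' \<subseteq> E \<longrightarrow> E' = E" by (elim impE)
  then show thesis using that by auto
qed

lemma artinian_in_subset: "artinian_in R M D \<Longrightarrow> D' \<subseteq> D \<Longrightarrow> artinian_in R M D'"
  unfolding artinian_in_def by (meson subset_trans)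

lemma artinian_in_chain:
  assumes art: "artinian_in R M D" and E: "\<And>n :: nat. submodule (E n) R M" "\<And>n. E n \<subseteq> D"
    and anti: "\<And>n. E (Suc n) \<subseteq> E n"
  shows "\<exists>n. \<forall>m\<ge>n. E m = E n"
proof -
  obtain F where F: "F \<in> range E" "\<And>F'. F' \<in> range E \<Longrightarrow> F' \<subseteq> F \<Longrightarrow> F' = F"
  proof (rule artinian_in_minimal[OF art, of "\<lambda>F. F \<in> range E" "E 0"])
    show "submodule F R M \<and> F \<subseteq> D" if "F \<in> range E" for F using that E by blast
  qed blast+
  then obtain n where n: "F = E n" by blast
  have "E m \<subseteq> E n" if "m \<ge> n" for m
    using that anti lift_Suc_antimono_le[of E] by blast
  then have "\<forall>m\<ge>n. E m = E n" using F(2)[OF rangeI] unfolding n by simp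
  then show ?thesis ..
qed

text \<open>
  Extensions of artinian modules are artinian. Among submodules that are contained in a fixed
  one, a submodule \<open>E\<close> of \<open>U + f(M)\<close> is determined by the preimage of \<open>E + U\<close> under \<open>f\<close> and by
  the intersection of \<open>E\<close> with \<open>U\<close>. So one minimizes the preimage first and the intersection
  second.
\<close>

lemma (in left_module_map) artinian_in_set_add_image:
  assumes U: "submodule U R N" and artU: "artinian_in R N U" and artM: "artinian_in R M (carrier M)"
  shows "artinian_in R N (U <+>\<^bsub>N\<^esub> f ` carrier M)"
  unfolding artinian_in_def
proof (intro allI impI)
  fix S :: "'n set set"
  assume ne: "S \<noteq> {}" and S: "\<forall>E\<in>S. submodule E R N \<and> E \<subseteq> U <+>\<^bsub>N\<^esub> f ` carrier M"
  have Ssub: "submodule E R N" if "E \<in> S" for E using S that by blast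
  \<comment> \<open>The preimage of \<open>E + U\<close>, which is the first quantity to be minimized.\<close>
  define \<rho> where "\<rho> E = {v \<in> carrier M. f v \<in> E <+>\<^bsub>N\<^esub> U}" for E
  have \<rho>_sub: "submodule (\<rho> E) R M" if "E \<in> S" for E
    unfolding \<rho>_def by (intro submodule_preimage N.submodule_set_add Ssub that U M.submodule_carrier)
  have \<rho>_mono: "E' \<subseteq> E \<Longrightarrow> \<rho> E' \<subseteq> \<rho> E" for E E'
    unfolding \<rho>_def N.set_add_iff by blast
  obtain E0 where E0: "E0 \<in> S" using ne by blast
  obtain G where "\<exists>E\<in>S. G = \<rho> E" and Gmin: "\<And>G'. \<exists>E\<in>S. G' = \<rho> E \<Longrightarrow> G' \<subseteq> G \<Longrightarrow> G' = G"
  proof (rule artinian_in_minimal[OF artM, of "\<lambda>G. \<exists>E\<in>S. G = \<rho> E" "\<rho> E0"])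
    show "\<exists>E\<in>S. \<rho> E0 = \<rho> E" using E0 by blast
    show "submodule G R M \<and> G \<subseteq> carrier M" if "\<exists>E\<in>S. G = \<rho> E" for G
      using that \<rho>_sub M.submoduleD(1) by blast
  qed blast
  then obtain E1 where E1: "E1 \<in> S" "G = \<rho> E1" by blast
  let ?P = "\<lambda>H. \<exists>E\<in>S. \<rho> E = G \<and> H = E \<inter> U"
  obtain H where "?P H" and Hmin: "\<And>H'. ?P H' \<Longrightarrow> H' \<subseteq> H \<Longrightarrow> H' = H"
  proof (rule artinian_in_minimal[OF artU, of ?P "E1 \<inter> U"])
    show "?P (E1 \<inter> U)" using E1 by blast
    show "submodule H R N \<and> H \<subseteq> U" if "?P H" for H
      using that N.submodule_Int[OF Ssub U] by blast
  qed blast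
  then obtain E where E: "E \<in> S" "\<rho> E = G" "H = E \<inter> U" by blast
  have "E' = E" if E': "E' \<in> S" "E' \<subseteq> E" for E'
  proof
    have \<rho>E': "\<rho> E' = G" using Gmin[of "\<rho> E'"] \<rho>_mono[OF E'(2)] E E' by blast
    then have int: "E' \<inter> U = E \<inter> U" using Hmin[of "E' \<inter> U"] E E' by blast
    show "E \<subseteq> E'"
    proof
      fix x assume x: "x \<in> E"
      then obtain u v where uv: "u \<in> U" "v \<in> carrier M" "x = u \<oplus>\<^bsub>N\<^esub> f v"
        using S E(1) N.set_add_iff[of x U "f ` carrier M"] by blast
      have c: "u \<in> carrier N" "x \<in> carrier N" "f v \<in> carrier N"
        using N.submoduleD(7)[OF U] N.submoduleD(7)[OF Ssub[OF E(1)]] x uv homD(1) by blast+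
      have "x = f v \<oplus>\<^bsub>N\<^esub> u" unfolding uv(3) by (rule N.M.a_comm[OF c(1,3)])
      then have "f v = x \<oplus>\<^bsub>N\<^esub> (\<ominus>\<^bsub>N\<^esub> u)" using N.minus_add_cancel[OF c(3,1)] by (simp only: N.M.minus_eq)
      then have "f v \<in> E <+>\<^bsub>N\<^esub> U"
        unfolding N.set_add_iff using x N.submoduleD(5)[OF U uv(1)] by blast
      then have "v \<in> \<rho> E'" using uv(2) \<rho>E' E(2) unfolding \<rho>_def by blast
      then obtain y w where yw: "y \<in> E'" "w \<in> U" "f v = y \<oplus>\<^bsub>N\<^esub> w"
        unfolding \<rho>_def N.set_add_iff by blast
      have cy: "y \<in> carrier N" "w \<in> carrier N"
        using N.submoduleD(7)[OF U yw(2)] N.submoduleD(7)[OF Ssub[OF E'(1)] yw(1)] by blast+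
      have eq: "x \<ominus>\<^bsub>N\<^esub> y = u \<oplus>\<^bsub>N\<^esub> w" using c cy unfolding uv(3) yw(3) by (simp only: N.group_normalise)
      have "x \<ominus>\<^bsub>N\<^esub> y \<in> E" using N.submoduleD(6)[OF Ssub[OF E(1)] x] yw(1) E'(2) by blast
      moreover have "x \<ominus>\<^bsub>N\<^esub> y \<in> U" unfolding eq by (rule N.submoduleD(3)[OF U uv(1) yw(2)])
      ultimately have "x \<ominus>\<^bsub>N\<^esub> y \<in> E'" using int by blast
      then have "(x \<ominus>\<^bsub>N\<^esub> y) \<oplus>\<^bsub>N\<^esub> y \<in> E'" using N.submoduleD(3)[OF Ssub[OF E'(1)]] yw(1) by blast
      then show "x \<in> E'" using N.add_minus_cancel[OF c(2) cy(1)] by simp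
    qed
  qed (use E' in blast)
  then show "\<exists>E\<in>S. \<forall>E'\<in>S. E' \<subseteq> E \<longrightarrow> E' = E" using E(1) by blast
qed

lemma (in left_module) artinian_in_zero: "artinian_in R M {\<zero>\<^bsub>M\<^esub>}"
  unfolding artinian_in_def
proof (intro allI impI)
  fix S assume "S \<noteq> {}" and S: "\<forall>E\<in>S. submodule E R M \<and> E \<subseteq> {\<zero>\<^bsub>M\<^esub>}"
  have "E = {\<zero>\<^bsub>M\<^esub>}" if "E \<in> S" for E using S submoduleD(2) that by blast
  then show "\<exists>E\<in>S. \<forall>E'\<in>S. E' \<subseteq> E \<longrightarrow> E' = E" using \<open>S \<noteq> {}\<close> by blast
qed

lemma (in ring) left_module_regular_module: "left_module R (regular_module R)"
proof -
  have "abelian_group (regular_module R)"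
  proof (rule abelian_groupI)
    fix x assume "x \<in> carrier (regular_module R)"
    then show "\<exists>y \<in> carrier (regular_module R).
        y \<oplus>\<^bsub>regular_module R\<^esub> x = \<zero>\<^bsub>regular_module R\<^esub>"
      by (intro bexI[of _ "\<ominus> x"]) (simp_all add: regular_module_def l_neg)
  qed (simp_all add: regular_module_def a_assoc, simp add: a_comm)
  moreover have "left_module_axioms R (regular_module R)"
    by (rule left_module_axioms.intro) (simp_all add: regular_module_def l_distr r_distr m_assoc)
  ultimately show ?thesis using ring_axioms by (simp add: left_module_def)
qed

lemma (in cring) ideal_of_submodule_regular_module:
  assumes E: "submodule E R (regular_module R)"
  shows "ideal E R"
proof (rule idealI)
  interpret reg: left_module R "regular_module R" by (rule left_module_regular_module)
  have "subgroup E (add_monoid (regular_module R))" using E by (simp add: submodule_def)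
  then show "subgroup E (add_monoid R)"
    unfolding subgroup_def m_inv_def by (simp add: regular_module_def)
  show "x \<otimes> a \<in> E" if "a \<in> E" "x \<in> carrier R" for a x
    using reg.submoduleD(4)[OF E that(2,1)] by (simp add: regular_module_def)
  then show "a \<otimes> x \<in> E" if "a \<in> E" "x \<in> carrier R" for a x
    using that reg.submoduleD(7)[OF E that(1)] m_comm[of a x] by (simp add: regular_module_def)
qed (rule ring_axioms)

lemma (in artinian_cring) artinian_in_regular_module:
  "artinian_in R (regular_module R) (carrier R)"
proof (rule ccontr)
  interpret reg: left_module R "regular_module R" by (rule left_module_regular_module)
  assume "\<not> ?thesis"
  then obtain S where S: "S \<noteq> {}" "\<forall>E\<in>S. submodule E R (regular_module R) \<and> E \<subseteq> carrier R"
    and not_min: "\<not> (\<exists>E\<in>S. \<forall>E'\<in>S. E' \<subseteq> E \<longrightarrow> E' = E)"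
    unfolding artinian_in_def not_all not_imp by (elim exE conjE)
  have no_min: "\<exists>E'\<in>S. E' \<subseteq> E \<and> E' \<noteq> E" if "E \<in> S" for E
    using not_min that by simp
  obtain J where J: "\<And>n. J n \<in> S" "\<And>n :: nat. J (Suc n) \<subseteq> J n \<and> J (Suc n) \<noteq> J n"
    using dependent_nat_choice[of "\<lambda>_ E. E \<in> S" "\<lambda>_ E E'. E' \<subseteq> E \<and> E' \<noteq> E"] S(1) no_min
    by blast
  have "\<exists>n. \<forall>m\<ge>n. J m = J n"
  proof (rule descending_chain_condition)
    show "ideal (J n) R" for n using ideal_of_submodule_regular_module J(1) S(2) by simp
    show "J (Suc n) \<subseteq> J n" for n using J(2) by simp
  qed
  then obtain n where n: "\<forall>m\<ge>n. J m = J n" ..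
  have "J (Suc n) = J n" by (rule n[rule_format]) simp
  then show False using J(2)[of n] by blast
qed

text \<open>
  The submodule \<open>U\<close> is a finite sum of images of the regular module. Two rings act: \<open>U\<close> has to be
  closed under \<open>R\<close>, while chains of \<open>k\<close>-submodules are considered. The cases of interest are that
  \<open>k\<close> is the center of \<open>R\<close> and that \<open>k\<close> and \<open>R\<close> coincide.
\<close>

lemma artinian_in_finitely_generated:
  fixes R :: "('r, 'c) ring_scheme" and k :: "('r, 'e) ring_scheme"
    and M :: "('r, 'm, 'd) module_scheme"
  assumes M: "left_module R M" "left_module k M"
    and reg: "left_module k (regular_module R)" "artinian_in k (regular_module R) (carrier R)"
    and hom: "\<And>x. x \<in> carrier M \<Longrightarrow> (\<lambda>r. r \<odot>\<^bsub>M\<^esub> x) \<in> left_module_hom k (regular_module R) M"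
    and A: "finite A" "A \<subseteq> carrier M"
  shows "\<exists>U. submodule U R M \<and> submodule U k M \<and> A \<subseteq> U \<and> artinian_in k M U"
  using A
proof (induction A rule: finite_induct)
  case empty
  interpret M: left_module R M by fact
  interpret Mk: left_module k M by fact
  show ?case
    using M.submodule_zero Mk.submodule_zero Mk.artinian_in_zero by blast
next
  case (insert z A)
  interpret M: left_module R M by fact
  interpret Mk: left_module k M by fact
  have z: "z \<in> carrier M" using insert.prems by simp
  interpret rz: left_module_map k "regular_module R" M "\<lambda>r. r \<odot>\<^bsub>M\<^esub> z"
    using reg(1) M(2) hom[OF z] by (simp add: left_module_mapI)
  interpret rR: left_module_map R "regular_module R" M "\<lambda>r. r \<odot>\<^bsub>M\<^esub> z"
  proof (intro left_module_mapI left_module_homI)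
    show "left_module R (regular_module R)" by (rule M.R.left_module_regular_module)
  qed (use z M in \<open>auto simp: regular_module_def M.smult_l_distr M.smult_assoc1\<close>)
  obtain U where U: "submodule U R M" "submodule U k M" "A \<subseteq> U" "artinian_in k M U"
    using insert by auto
  let ?V = "U <+>\<^bsub>M\<^esub> (\<lambda>r. r \<odot>\<^bsub>M\<^esub> z) ` carrier (regular_module R)"
  have sub1: "submodule ((\<lambda>r. r \<odot>\<^bsub>M\<^esub> z) ` carrier (regular_module R)) R M"
    by (rule rR.submodule_image[OF rR.M.submodule_carrier])
  have sub2: "submodule ((\<lambda>r. r \<odot>\<^bsub>M\<^esub> z) ` carrier (regular_module R)) k M"
    by (rule rz.submodule_image[OF rz.M.submodule_carrier])
  have "\<one>\<^bsub>R\<^esub> \<odot>\<^bsub>M\<^esub> z \<in> (\<lambda>r. r \<odot>\<^bsub>M\<^esub> z) ` carrier (regular_module R)"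
    by (rule imageI) (simp add: regular_module_def)
  then have "z \<in> ?V" using M.subset_set_add_right[OF U(1) sub1] z by auto
  moreover have "A \<subseteq> ?V" using M.subset_set_add_left[OF U(1) sub1] U(3) by blast
  moreover have "artinian_in k M ?V"
    by (rule rz.artinian_in_set_add_image[OF U(2,4)]) (use reg(2) in \<open>simp add: regular_module_def\<close>)
  ultimately show ?case
    using M.submodule_set_add[OF U(1) sub1] Mk.submodule_set_add[OF U(2) sub2] by blast
qed

text \<open>
  The image of \<open>v\<close> lies in every nonzero submodule of the factor module modulo \<open>K\<close>, which is
  therefore an essential extension of a simple module. Residue classes modulo \<open>K\<close> serve as the
  values of linear forms.
\<close>

definition maximal_avoiding ::
    "('r, 'c) ring_scheme \<Rightarrow> ('r, 'm, 'd) module_scheme \<Rightarrow> 'm set \<Rightarrow> 'm \<Rightarrow> bool"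
  where "maximal_avoiding R M K v \<longleftrightarrow> submodule K R M \<and> v \<in> carrier M \<and> v \<notin> K \<and>
    (\<forall>u \<in> carrier M. u \<notin> K \<longrightarrow> (\<exists>c \<in> K. \<exists>a \<in> carrier R. v = c \<oplus>\<^bsub>M\<^esub> a \<odot>\<^bsub>M\<^esub> u))"

context left_module
begin

lemma submodule_multiples:
  assumes "x \<in> carrier M"
  shows "submodule ((\<lambda>a. a \<odot>\<^bsub>M\<^esub> x) ` carrier R) R M"
proof (rule submoduleI)
  show "\<zero>\<^bsub>M\<^esub> \<in> (\<lambda>a. a \<odot>\<^bsub>M\<^esub> x) ` carrier R"
    by (rule image_eqI[of _ _ "\<zero>\<^bsub>R\<^esub>"]) (use assms in simp_all)
next
  fix y z assume "y \<in> (\<lambda>a. a \<odot>\<^bsub>M\<^esub> x) ` carrier R" "z \<in> (\<lambda>a. a \<odot>\<^bsub>M\<^esub> x) ` carrier R"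
  then obtain a b where "a \<in> carrier R" "b \<in> carrier R" "y = a \<odot>\<^bsub>M\<^esub> x" "z = b \<odot>\<^bsub>M\<^esub> x" by blast
  then show "y \<oplus>\<^bsub>M\<^esub> z \<in> (\<lambda>a. a \<odot>\<^bsub>M\<^esub> x) ` carrier R"
    by (intro image_eqI[of _ _ "a \<oplus>\<^bsub>R\<^esub> b"]) (use assms smult_l_distr in simp_all)
next
  fix c y assume c: "c \<in> carrier R" and "y \<in> (\<lambda>a. a \<odot>\<^bsub>M\<^esub> x) ` carrier R"
  then obtain a where "a \<in> carrier R" "y = a \<odot>\<^bsub>M\<^esub> x" by blast
  with c show "c \<odot>\<^bsub>M\<^esub> y \<in> (\<lambda>a. a \<odot>\<^bsub>M\<^esub> x) ` carrier R"
    by (intro image_eqI[of _ _ "c \<otimes>\<^bsub>R\<^esub> a"]) (use assms smult_assoc1 in simp_all)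
qed (use assms in auto)

lemma maximal_avoiding_exists:
  assumes U: "submodule U R M" and v: "v \<in> carrier M" "v \<notin> U"
  shows "\<exists>K. U \<subseteq> K \<and> maximal_avoiding R M K v"
proof -
  let ?S = "{K. submodule K R M \<and> U \<subseteq> K \<and> v \<notin> K}"
  have "\<exists>K\<in>?S. \<forall>H\<in>?S. K \<subseteq> H \<longrightarrow> H = K"
  proof (rule subset_Zorn_nonempty)
    show "?S \<noteq> {}" using U v by blast
    fix C assume C: "C \<noteq> {}" "subset.chain ?S C"
    then have CS: "C \<subseteq> ?S" and chain: "\<And>H K. H \<in> C \<Longrightarrow> K \<in> C \<Longrightarrow> H \<subseteq> K \<or> K \<subseteq> H"
      unfolding subset.chain_def by blast+
    have "submodule (\<Union>C) R M"
      by (rule submodule_Union_chain[OF _ C(1) chain]) (use CS in blast)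
    then show "\<Union>C \<in> ?S" using CS C(1) by blast
  qed
  then obtain K where "K \<in> ?S" and Kmax: "\<forall>H\<in>?S. K \<subseteq> H \<longrightarrow> H = K" by (elim bexE)
  then have K: "submodule K R M" "U \<subseteq> K" "v \<notin> K" by simp_all
  have max: "H = K" if "submodule H R M" "U \<subseteq> H" "v \<notin> H" "K \<subseteq> H" for H
    using Kmax that by simp
  have "\<exists>c\<in>K. \<exists>a\<in>carrier R. v = c \<oplus>\<^bsub>M\<^esub> a \<odot>\<^bsub>M\<^esub> u" if u: "u \<in> carrier M" "u \<notin> K" for u
  proof -
    let ?H = "K <+>\<^bsub>M\<^esub> (\<lambda>a. a \<odot>\<^bsub>M\<^esub> u) ` carrier R"
    note H = submodule_set_add[OF K(1) submodule_multiples[OF u(1)]]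
    have sub: "K \<subseteq> ?H" by (rule subset_set_add_left[OF K(1) submodule_multiples[OF u(1)]])
    have "\<one>\<^bsub>R\<^esub> \<odot>\<^bsub>M\<^esub> u \<in> (\<lambda>a. a \<odot>\<^bsub>M\<^esub> u) ` carrier R" by (rule imageI) simp
    then have "u \<in> ?H" using subset_set_add_right[OF K(1) submodule_multiples[OF u(1)]] u(1) by auto
    then have "?H \<noteq> K" using u(2) by blast
    then have "v \<in> ?H" using max[OF H] sub K(2) by blast
    then show ?thesis unfolding set_add_iff by blast
  qed
  then have "maximal_avoiding R M K v" unfolding maximal_avoiding_def using K v by blast
  then show ?thesis using K(2) by blast
qed

text \<open>
  Inside \<open>S\<close>, the submodule \<open>K\<close> is still maximal without \<open>v\<close>: for \<open>u\<close> in \<open>S\<close> but not in \<open>K\<close> there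
  is an equation \<open>v = c + a \<cdot> u\<close> with \<open>c\<close> in \<open>K\<close>, and then \<open>c\<close> lies in \<open>S\<close> too. So, when \<open>K\<close> is
  replaced by a submodule that is larger within \<open>S\<close> and still avoids \<open>v\<close>, nothing changes on \<open>S\<close>.
\<close>

lemma maximal_avoiding_restrict:
  assumes K: "maximal_avoiding R M K v" and L: "submodule L R M" "v \<notin> L"
    and S: "submodule S R M" "v \<in> S" and KS: "K \<inter> S \<subseteq> L"
  shows "L \<inter> S \<subseteq> K"
proof
  fix u assume u: "u \<in> L \<inter> S"
  show "u \<in> K"
  proof (rule ccontr)
    assume "u \<notin> K"
    then obtain c a where ca: "c \<in> K" "a \<in> carrier R" "v = c \<oplus>\<^bsub>M\<^esub> a \<odot>\<^bsub>M\<^esub> u"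
      using K u submoduleD(7)[OF S(1)] unfolding maximal_avoiding_def by blast
    have cK: "c \<in> carrier M" using K ca(1) submoduleD(7) unfolding maximal_avoiding_def by blast
    have "a \<odot>\<^bsub>M\<^esub> u \<in> S" "a \<odot>\<^bsub>M\<^esub> u \<in> L"
      using submoduleD(4)[OF S(1) ca(2)] submoduleD(4)[OF L(1) ca(2)] u by blast+
    moreover then have "c \<in> S"
      using submodule_add_cancel_left[OF S(1) cK] S(2) ca(3) by simp
    ultimately have "v \<in> L" using ca(1,3) KS submoduleD(3)[OF L(1), of c "a \<odot>\<^bsub>M\<^esub> u"] by blast
    then show False using L(2) by blast
  qed
qed

end

section \<open>Linear forms modulo a submodule maximal without a vector\<close>

text \<open>
  The last axiom says that the residue ring is a field.
\<close>

locale artinian_cring_maximal_ideal = artinian_cring k for k :: "('r, 'c) ring_scheme" (structure) +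
  fixes \<mm> :: "'r set"
  assumes ideal_\<mm>: "ideal \<mm> k" and one_notin_\<mm>: "\<one> \<notin> \<mm>"
    and inverse_mod_\<mm>: "\<lbrakk>a \<in> carrier k; a \<notin> \<mm>\<rbrakk> \<Longrightarrow> \<exists>d\<in>carrier k. \<exists>b\<in>\<mm>. d \<otimes> a = \<one> \<oplus> b"
begin

lemma \<mm>_carrier: "a \<in> \<mm> \<Longrightarrow> a \<in> carrier k"
  using additive_subgroup.a_Hcarr[OF ideal.axioms(1)[OF ideal_\<mm>]] by simp

lemma one_minus_notin_\<mm>: "a \<in> \<mm> \<Longrightarrow> \<one> \<ominus> a \<in> carrier k \<and> \<one> \<ominus> a \<notin> \<mm>"
proof -
  assume a: "a \<in> \<mm>"
  have c: "\<one> \<ominus> a \<in> carrier k" using \<mm>_carrier[OF a] by simp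
  have "\<one> \<in> \<mm>" if "\<one> \<ominus> a \<in> \<mm>"
  proof -
    have "(\<one> \<ominus> a) \<oplus> a \<in> \<mm>"
      by (rule additive_subgroup.a_closed[OF ideal.axioms(1)[OF ideal_\<mm>] that a])
    then show ?thesis using \<mm>_carrier[OF a] by (simp add: minus_eq a_assoc l_neg)
  qed
  then show ?thesis using c one_notin_\<mm> by blast
qed

lemma scaling_hom:
  assumes "left_module k W" and a: "a \<in> carrier k"
  shows "left_module_map k W W (\<lambda>x. a \<odot>\<^bsub>W\<^esub> x)"
proof -
  interpret W: left_module k W by fact
  have "(\<lambda>x. a \<odot>\<^bsub>W\<^esub> x) \<in> left_module_hom k W W"
  proof (rule left_module_homI)
    fix b x assume b: "b \<in> carrier k" and x: "x \<in> carrier W"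
    show "a \<odot>\<^bsub>W\<^esub> (b \<odot>\<^bsub>W\<^esub> x) = b \<odot>\<^bsub>W\<^esub> (a \<odot>\<^bsub>W\<^esub> x)"
      using W.smult_assoc1[OF a b x] W.smult_assoc1[OF b a x] m_comm[OF a b] by simp
  qed (use a W.smult_r_distr in auto)
  then show ?thesis using assms(1) by (simp add: left_module_mapI)
qed

text \<open>
  A form of Nakayama's lemma, together with the choice of a hyperplane in the vector space
  \<open>D / \<mm>D\<close> over the residue field. Suppose that \<open>\<mm>D = D\<close>. Among the ideals that do not annihilate
  \<open>D\<close> let \<open>G\<close> be minimal, and let \<open>g\<close> in \<open>G\<close> not annihilate \<open>D\<close>. Then \<open>g\<mm>\<close> does not annihilate
  \<open>D\<close> either, so \<open>g\<mm> = G\<close>. Thus \<open>g = g a\<close> for some \<open>a\<close> in \<open>\<mm>\<close>, and \<open>g D = 0\<close> because \<open>1 - a\<close> acts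
  injectively: a contradiction.
\<close>

lemma hyperplane:
  assumes W: "left_module k W" and D: "submodule D k W" "D \<noteq> {\<zero>\<^bsub>W\<^esub>}"
    and inj: "\<And>a x. \<lbrakk>a \<in> carrier k; a \<notin> \<mm>; x \<in> D; a \<odot>\<^bsub>W\<^esub> x = \<zero>\<^bsub>W\<^esub>\<rbrakk> \<Longrightarrow> x = \<zero>\<^bsub>W\<^esub>"
  obtains H z where "submodule H k W" "H \<subseteq> D" "z \<in> D" "z \<notin> H"
    "\<And>a x. a \<in> \<mm> \<Longrightarrow> x \<in> D \<Longrightarrow> a \<odot>\<^bsub>W\<^esub> x \<in> H"
    "\<And>x. x \<in> D \<Longrightarrow> \<exists>u\<in>H. \<exists>a\<in>carrier k. x = u \<oplus>\<^bsub>W\<^esub> a \<odot>\<^bsub>W\<^esub> z"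
proof -
  interpret W: left_module k W by fact
  interpret reg: left_module k "regular_module k" by (rule left_module_regular_module)
  note DW = W.submoduleD(7)[OF D(1)]
  define T where "T = {a \<odot>\<^bsub>W\<^esub> x | a x. a \<in> \<mm> \<and> x \<in> D}"
  define mD where "mD = submodule_generated k W T"
  have TD: "T \<subseteq> D" unfolding T_def using W.submoduleD(4)[OF D(1) \<mm>_carrier] by blast
  have Tc: "T \<subseteq> carrier W" using TD DW by blast
  have mD: "submodule mD k W" "mD \<subseteq> D" "T \<subseteq> mD"
    unfolding mD_def
    by (rule W.submodule_generated_is_submodule[OF Tc] W.submodule_generated_minimal[OF D(1) TD]
        W.subset_submodule_generated)+
  have "mD \<noteq> D"
  proof
    assume eq: "mD = D"
    \<comment> \<open>The ideals that do not annihilate \<open>D\<close>.\<close>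
    let ?P = "\<lambda>G. submodule G k (regular_module k) \<and> (\<exists>g\<in>G. \<exists>x\<in>D. g \<odot>\<^bsub>W\<^esub> x \<noteq> \<zero>\<^bsub>W\<^esub>)"
    obtain x0 where x0: "x0 \<in> D" "x0 \<noteq> \<zero>\<^bsub>W\<^esub>" using D(2) W.submoduleD(2)[OF D(1)] by blast
    then have "\<one> \<odot>\<^bsub>W\<^esub> x0 \<noteq> \<zero>\<^bsub>W\<^esub>" using DW by simp
    then have "?P (carrier k)"
      using x0(1) reg.submodule_carrier by (auto simp: regular_module_def)
    then obtain G where G: "?P G" and Gmin: "\<And>G'. ?P G' \<Longrightarrow> G' \<subseteq> G \<Longrightarrow> G' = G"
    proof (rule artinian_in_minimal[OF artinian_in_regular_module])
      show "submodule G k (regular_module k) \<and> G \<subseteq> carrier k" if "?P G" for G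
        using that reg.submoduleD(1)[of G] by (simp add: regular_module_def)
    qed blast
    then obtain g d0 where g: "g \<in> G" "d0 \<in> D" "g \<odot>\<^bsub>W\<^esub> d0 \<noteq> \<zero>\<^bsub>W\<^esub>" by blast
    have Gsub: "submodule G k (regular_module k)" using G by blast
    have gc: "g \<in> carrier k" using reg.submoduleD(7)[OF Gsub g(1)] by (simp add: regular_module_def)
    interpret sg: left_module_map k W W "\<lambda>x. g \<odot>\<^bsub>W\<^esub> x" by (rule scaling_hom[OF W gc])
    let ?G' = "(\<lambda>a. g \<otimes> a) ` \<mm>"
    interpret rg: left_module_map k "regular_module k" "regular_module k"
      "\<lambda>x. g \<odot>\<^bsub>regular_module k\<^esub> x" by (rule scaling_hom[OF reg.left_module_axioms gc])
    have "submodule \<mm> k (regular_module k)"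
      by (rule reg.submoduleI)
        (use \<mm>_carrier additive_subgroup.zero_closed[OF ideal.axioms(1)[OF ideal_\<mm>]]
          additive_subgroup.a_closed[OF ideal.axioms(1)[OF ideal_\<mm>]] ideal.I_l_closed[OF ideal_\<mm>]
          in \<open>auto simp: regular_module_def\<close>)
    then have G'sub: "submodule ?G' k (regular_module k)"
      using rg.submodule_image by (simp add: regular_module_def)
    have G'G: "?G' \<subseteq> G"
    proof
      fix y assume "y \<in> ?G'"
      then obtain a where a: "a \<in> \<mm>" "y = g \<otimes> a" by blast
      then have "y = a \<otimes> g" using m_comm[OF gc \<mm>_carrier[OF a(1)]] by simp
      then show "y \<in> G"
        using reg.submoduleD(4)[OF Gsub \<mm>_carrier[OF a(1)] g(1)] by (simp add: regular_module_def)
    qed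
    \<comment> \<open>Otherwise \<open>g\<close> would annihilate \<open>\<mm>D\<close>, that is \<open>D\<close>.\<close>
    have "\<exists>h\<in>?G'. \<exists>x\<in>D. h \<odot>\<^bsub>W\<^esub> x \<noteq> \<zero>\<^bsub>W\<^esub>"
    proof (rule ccontr)
      assume neg: "\<not> ?thesis"
      have ann: "submodule {x \<in> D. g \<odot>\<^bsub>W\<^esub> x \<in> {\<zero>\<^bsub>W\<^esub>}} k W"
        by (rule sg.submodule_preimage[OF W.submodule_zero D(1)])
      have "T \<subseteq> {x \<in> D. g \<odot>\<^bsub>W\<^esub> x \<in> {\<zero>\<^bsub>W\<^esub>}}"
      proof
        fix y assume y: "y \<in> T"
        then obtain a x where ax: "a \<in> \<mm>" "x \<in> D" "y = a \<odot>\<^bsub>W\<^esub> x" unfolding T_def by blast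
        have "g \<odot>\<^bsub>W\<^esub> y = (g \<otimes> a) \<odot>\<^bsub>W\<^esub> x"
          unfolding ax(3) by (rule W.smult_assoc1[OF gc \<mm>_carrier[OF ax(1)] DW[OF ax(2)], symmetric])
        also have "\<dots> = \<zero>\<^bsub>W\<^esub>" using neg ax by blast
        finally show "y \<in> {x \<in> D. g \<odot>\<^bsub>W\<^esub> x \<in> {\<zero>\<^bsub>W\<^esub>}}" using y TD by blast
      qed
      then have "mD \<subseteq> {x \<in> D. g \<odot>\<^bsub>W\<^esub> x \<in> {\<zero>\<^bsub>W\<^esub>}}"
        unfolding mD_def by (rule W.submodule_generated_minimal[OF ann])
      then show False using g(2,3) eq by blast
    qed
    then have "?G' = G" using Gmin[of ?G'] G'sub G'G by blast
    then obtain a where a: "a \<in> \<mm>" "g = g \<otimes> a" using g(1) by blast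
    have "(\<one> \<ominus> a) \<otimes> g = g \<ominus> g \<otimes> a"
      using gc \<mm>_carrier[OF a(1)] unfolding minus_eq
      by (simp add: l_distr l_minus m_comm[of g a])
    also have "\<dots> = \<zero>" using gc a(2) by simp
    finally have 0: "(\<one> \<ominus> a) \<otimes> g = \<zero>" .
    have "(\<one> \<ominus> a) \<odot>\<^bsub>W\<^esub> (g \<odot>\<^bsub>W\<^esub> d0) = \<zero>\<^bsub>W\<^esub>"
      using W.smult_assoc1[of "\<one> \<ominus> a" g d0] one_minus_notin_\<mm>[OF a(1)] gc DW[OF g(2)] 0 by simp
    then have "g \<odot>\<^bsub>W\<^esub> d0 = \<zero>\<^bsub>W\<^esub>"
      using inj one_minus_notin_\<mm>[OF a(1)] W.submoduleD(4)[OF D(1) gc g(2)] by blast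
    then show False using g(3) by blast
  qed
  then obtain z where z: "z \<in> D" "z \<notin> mD" using mD(2) by blast
  obtain K where K: "mD \<subseteq> K" "maximal_avoiding k W K z"
    using W.maximal_avoiding_exists[OF mD(1) DW[OF z(1)] z(2)] by blast
  have Ks: "submodule K k W" "z \<notin> K" using K(2) by (simp_all add: maximal_avoiding_def)
  have mK: "a \<odot>\<^bsub>W\<^esub> x \<in> K" if "a \<in> \<mm>" "x \<in> D" for a x
    using that mD(3) K(1) unfolding T_def by blast
  show thesis
  proof (rule that[of "K \<inter> D" z])
    show "submodule (K \<inter> D) k W" by (rule W.submodule_Int[OF Ks(1) D(1)])
    show "a \<odot>\<^bsub>W\<^esub> x \<in> K \<inter> D" if "a \<in> \<mm>" "x \<in> D" for a x
      using mK[OF that] W.submoduleD(4)[OF D(1) \<mm>_carrier that(2)] that(1) by blast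
    fix x assume x: "x \<in> D"
    show "\<exists>u\<in>K \<inter> D. \<exists>a\<in>carrier k. x = u \<oplus>\<^bsub>W\<^esub> a \<odot>\<^bsub>W\<^esub> z"
    proof (cases "x \<in> K")
      case True
      then show ?thesis using x z DW W.smult_zero_left[of z]
        by (intro bexI[of _ x] bexI[of _ \<zero>]) simp_all
    next
      case False
      then obtain c a where ca: "c \<in> K" "a \<in> carrier k" "z = c \<oplus>\<^bsub>W\<^esub> a \<odot>\<^bsub>W\<^esub> x"
        using K(2) DW[OF x] unfolding maximal_avoiding_def by blast
      have "a \<notin> \<mm>" using ca mK[OF _ x] Ks W.submoduleD(3)[OF Ks(1)] by blast
      then obtain d b where d: "d \<in> carrier k" "b \<in> \<mm>" "d \<otimes> a = \<one> \<oplus> b"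
        using inverse_mod_\<mm>[OF ca(2)] by blast
      have xc: "x \<in> carrier W" by (rule DW[OF x])
      have cc: "c \<in> carrier W" by (rule W.submoduleD(7)[OF Ks(1) ca(1)])
      have bx: "b \<odot>\<^bsub>W\<^esub> x \<in> K" "b \<odot>\<^bsub>W\<^esub> x \<in> carrier W"
        using mK[OF d(2) x] W.submoduleD(7)[OF Ks(1)] by blast+
      have dc: "d \<odot>\<^bsub>W\<^esub> c \<in> K" "d \<odot>\<^bsub>W\<^esub> c \<in> carrier W"
        using W.submoduleD(4)[OF Ks(1) d(1) ca(1)] W.submoduleD(7)[OF Ks(1)] by blast+
      have dz: "d \<odot>\<^bsub>W\<^esub> z \<in> carrier W" "d \<odot>\<^bsub>W\<^esub> z \<in> D"
        using W.submoduleD(4)[OF D(1) d(1) z(1)] DW by blast+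
      have "d \<odot>\<^bsub>W\<^esub> z = d \<odot>\<^bsub>W\<^esub> c \<oplus>\<^bsub>W\<^esub> (x \<oplus>\<^bsub>W\<^esub> b \<odot>\<^bsub>W\<^esub> x)"
        using W.smult_assoc1[OF d(1) ca(2) xc] d xc cc ca(2) \<mm>_carrier[OF d(2)]
        unfolding ca(3) by (simp add: W.smult_r_distr W.smult_l_distr)
      also have "\<dots> = x \<oplus>\<^bsub>W\<^esub> (d \<odot>\<^bsub>W\<^esub> c \<oplus>\<^bsub>W\<^esub> b \<odot>\<^bsub>W\<^esub> x)"
        using dc(2) bx(2) xc by (simp only: W.group_normalise)
      finally have "x \<oplus>\<^bsub>W\<^esub> (d \<odot>\<^bsub>W\<^esub> c \<oplus>\<^bsub>W\<^esub> b \<odot>\<^bsub>W\<^esub> x) = d \<odot>\<^bsub>W\<^esub> z" ..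
      then have xeq: "x = d \<odot>\<^bsub>W\<^esub> z \<ominus>\<^bsub>W\<^esub> (d \<odot>\<^bsub>W\<^esub> c \<oplus>\<^bsub>W\<^esub> b \<odot>\<^bsub>W\<^esub> x)"
        using W.minus_add_cancel[of x "d \<odot>\<^bsub>W\<^esub> c \<oplus>\<^bsub>W\<^esub> b \<odot>\<^bsub>W\<^esub> x"] xc dc bx by simp
      define u where "u = \<ominus>\<^bsub>W\<^esub> (d \<odot>\<^bsub>W\<^esub> c \<oplus>\<^bsub>W\<^esub> b \<odot>\<^bsub>W\<^esub> x)"
      have uK: "u \<in> K" unfolding u_def
        by (rule W.submoduleD(5)[OF Ks(1) W.submoduleD(3)[OF Ks(1) dc(1) bx(1)]])
      have uc: "u \<in> carrier W" by (rule W.submoduleD(7)[OF Ks(1) uK])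
      have xu: "x = u \<oplus>\<^bsub>W\<^esub> d \<odot>\<^bsub>W\<^esub> z"
        using xeq W.M.a_comm[OF uc dz(1)] unfolding u_def W.M.minus_eq by simp
      have "u \<in> D" by (rule W.submodule_add_cancel_left[OF D(1) uc dz(2)]) (use xu x in simp)
      then show ?thesis using uK xu d(1) by blast
    qed
  qed (use z Ks(2) in auto)
qed

text \<open>
  A minimal submodule that is not finitely generated would have a finitely generated hyperplane
  and would be generated by this hyperplane and one more element.
\<close>

lemma noetherian_in:
  assumes W: "left_module k W" and D: "submodule D k W" "artinian_in k W D"
    and inj: "\<And>a x. \<lbrakk>a \<in> carrier k; a \<notin> \<mm>; x \<in> D; a \<odot>\<^bsub>W\<^esub> x = \<zero>\<^bsub>W\<^esub>\<rbrakk> \<Longrightarrow> x = \<zero>\<^bsub>W\<^esub>"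
    and E: "submodule E k W" "E \<subseteq> D"
  shows "\<exists>F. finite F \<and> F \<subseteq> E \<and> submodule_generated k W F = E"
proof (rule ccontr)
  interpret W: left_module k W by fact
  let ?fg = "\<lambda>E. \<exists>F. finite F \<and> F \<subseteq> E \<and> submodule_generated k W F = E"
  assume neg: "\<not> ?fg E"
  let ?P = "\<lambda>E. submodule E k W \<and> E \<subseteq> D \<and> \<not> ?fg E"
  obtain B where B: "?P B" and Bmin: "\<And>B'. ?P B' \<Longrightarrow> B' \<subseteq> B \<Longrightarrow> B' = B"
  proof (rule artinian_in_minimal[OF D(2), of ?P E])
    show "?P E" using E neg by blast
  qed blast+
  have Bs: "submodule B k W" "B \<subseteq> D" and Bn: "\<not> ?fg B" using B by blast+
  have "B \<noteq> {\<zero>\<^bsub>W\<^esub>}"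
  proof
    assume 0: "B = {\<zero>\<^bsub>W\<^esub>}"
    have "submodule_generated k W {} = {\<zero>\<^bsub>W\<^esub>}"
    proof
      show "submodule_generated k W {} \<subseteq> {\<zero>\<^bsub>W\<^esub>}"
        by (rule W.submodule_generated_minimal[OF W.submodule_zero]) simp
      show "{\<zero>\<^bsub>W\<^esub>} \<subseteq> submodule_generated k W {}"
        using W.submoduleD(2)[OF W.submodule_generated_is_submodule[of "{}"]] by simp
    qed
    then show False using Bn 0 by blast
  qed
  then obtain H z where H: "submodule H k W" "H \<subseteq> B" "z \<in> B" "z \<notin> H"
    and span: "\<And>x. x \<in> B \<Longrightarrow> \<exists>u\<in>H. \<exists>a\<in>carrier k. x = u \<oplus>\<^bsub>W\<^esub> a \<odot>\<^bsub>W\<^esub> z"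
  proof (rule hyperplane[OF W Bs(1)])
    show "x = \<zero>\<^bsub>W\<^esub>" if "a \<in> carrier k" "a \<notin> \<mm>" "x \<in> B" "a \<odot>\<^bsub>W\<^esub> x = \<zero>\<^bsub>W\<^esub>" for a x
      using inj that Bs(2) by blast
  qed blast
  have "?fg H"
  proof (rule ccontr)
    assume "\<not> ?fg H"
    then have "H = B" using Bmin[of H] H(1,2) Bs(2) by blast
    then show False using H(3,4) by blast
  qed
  then obtain F where F: "finite F" "F \<subseteq> H" "submodule_generated k W F = H" by blast
  have FB: "insert z F \<subseteq> B" using F(2) H(2,3) by blast
  then have Fc: "insert z F \<subseteq> carrier W" using W.submoduleD(1)[OF Bs(1)] by blast
  note gen = W.submodule_generated_is_submodule[OF Fc]
  have ins: "insert z F \<subseteq> submodule_generated k W (insert z F)" by (rule W.subset_submodule_generated)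
  have "H \<subseteq> submodule_generated k W (insert z F)"
    unfolding F(3)[symmetric] by (rule W.submodule_generated_minimal[OF gen]) (use ins in blast)
  then have "B \<subseteq> submodule_generated k W (insert z F)"
    using span W.submoduleD(3)[OF gen] W.submoduleD(4)[OF gen] ins by blast
  moreover have "submodule_generated k W (insert z F) \<subseteq> B"
    by (rule W.submodule_generated_minimal[OF Bs(1) FB])
  ultimately have "submodule_generated k W (insert z F) = B" by blast
  then show False using Bn FB F(1) by blast
qed

text \<open>
  Modulo \<open>K\<close>, the vectors annihilated by \<open>\<mm>\<close> form a one-dimensional space over the residue field.
\<close>

lemma socle_mod_maximal_avoiding:
  assumes A: "left_module k A" and K: "maximal_avoiding k A K v"
    and mv: "\<And>a. a \<in> \<mm> \<Longrightarrow> a \<odot>\<^bsub>A\<^esub> v \<in> K"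
    and w: "w \<in> carrier A" and mw: "\<And>a. a \<in> \<mm> \<Longrightarrow> a \<odot>\<^bsub>A\<^esub> w \<in> K"
  shows "\<exists>b\<in>carrier k. w \<ominus>\<^bsub>A\<^esub> b \<odot>\<^bsub>A\<^esub> v \<in> K"
proof -
  interpret A: left_module k A by fact
  have vc: "v \<in> carrier A" using K by (simp add: maximal_avoiding_def)
  show ?thesis
  proof (cases "w \<in> K")
    case True
    then show ?thesis using vc w by (intro bexI[of _ \<zero>]) simp_all
  next
    case False
    have Ks: "submodule K k A" "v \<notin> K" using K by (simp_all add: maximal_avoiding_def)
    obtain c a where ca: "c \<in> K" "a \<in> carrier k" "v = c \<oplus>\<^bsub>A\<^esub> a \<odot>\<^bsub>A\<^esub> w"
      using K w False unfolding maximal_avoiding_def by blast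
    have "a \<notin> \<mm>" using ca mw Ks A.submoduleD(3)[OF Ks(1)] by blast
    then obtain d b where d: "d \<in> carrier k" "b \<in> \<mm>" "d \<otimes> a = \<one> \<oplus> b"
      using inverse_mod_\<mm>[OF ca(2)] by blast
    have cc: "c \<in> carrier A" by (rule A.submoduleD(7)[OF Ks(1) ca(1)])
    have bw: "b \<odot>\<^bsub>A\<^esub> w \<in> K" "b \<odot>\<^bsub>A\<^esub> w \<in> carrier A"
      using mw[OF d(2)] A.submoduleD(7)[OF Ks(1)] by blast+
    have dc: "d \<odot>\<^bsub>A\<^esub> c \<in> K" "d \<odot>\<^bsub>A\<^esub> c \<in> carrier A"
      using A.submoduleD(4)[OF Ks(1) d(1) ca(1)] A.submoduleD(7)[OF Ks(1)] by blast+
    have dv: "d \<odot>\<^bsub>A\<^esub> v \<in> carrier A" using d(1) vc by simp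
    have "d \<odot>\<^bsub>A\<^esub> v = d \<odot>\<^bsub>A\<^esub> c \<oplus>\<^bsub>A\<^esub> (w \<oplus>\<^bsub>A\<^esub> b \<odot>\<^bsub>A\<^esub> w)"
      using A.smult_assoc1[OF d(1) ca(2) w] d w cc ca(2) \<mm>_carrier[OF d(2)]
      unfolding ca(3) by (simp add: A.smult_r_distr A.smult_l_distr)
    then have "d \<odot>\<^bsub>A\<^esub> v \<ominus>\<^bsub>A\<^esub> w = (w \<ominus>\<^bsub>A\<^esub> w) \<oplus>\<^bsub>A\<^esub> (d \<odot>\<^bsub>A\<^esub> c \<oplus>\<^bsub>A\<^esub> b \<odot>\<^bsub>A\<^esub> w)"
      using dc(2) bw(2) w by (simp only: A.group_normalise)
    then have "d \<odot>\<^bsub>A\<^esub> v \<ominus>\<^bsub>A\<^esub> w \<in> K"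
      using A.submoduleD(3)[OF Ks(1) dc(1) bw(1)] dc(2) bw(2) w by simp
    then show ?thesis using A.submodule_minus_commute[OF Ks(1) dv w] d(1) by blast
  qed
qed

text \<open>
  Double duality. The elements of \<open>Y\<close> act on \<open>V\<close> as linear forms with values modulo \<open>K\<close>, and by
  the last assumption \<open>\<phi>\<close> is a linear form on the space of these forms. In the family of those
  submodules \<open>V'\<close> of \<open>V\<close> for which some \<open>x\<close> in \<open>V\<close> satisfies \<open>\<phi> y = \<beta> y x\<close> for all \<open>y\<close> that
  vanish on \<open>V'\<close>, choose a minimal one. If it were nonzero, it would have a hyperplane \<open>H\<close> with
  complementary vector \<open>z\<close>. For \<open>y\<close> that vanish on \<open>H\<close>, both \<open>\<phi> y - \<beta> y x\<close> and \<open>\<beta> y z\<close> are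
  annihilated by \<open>\<mm>\<close> and so lie in a one-dimensional space over the residue field; the first
  vanishes where the second does, so it is a multiple of it. Adding the corresponding multiple of
  \<open>z\<close> to \<open>x\<close> shows that \<open>H\<close> belongs to the family as well.
\<close>

lemma linear_form_is_evaluation:
  assumes Y: "left_module k Y" and W: "left_module k W" and A: "left_module k A"
    and V: "submodule V k W" "artinian_in k W V"
    and inj: "\<And>a x. \<lbrakk>a \<in> carrier k; a \<notin> \<mm>; x \<in> V; a \<odot>\<^bsub>W\<^esub> x = \<zero>\<^bsub>W\<^esub>\<rbrakk> \<Longrightarrow> x = \<zero>\<^bsub>W\<^esub>"
    and K: "maximal_avoiding k A K v" and mv: "\<And>a. a \<in> \<mm> \<Longrightarrow> a \<odot>\<^bsub>A\<^esub> v \<in> K"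
    and \<beta>_left: "\<And>x. x \<in> V \<Longrightarrow> (\<lambda>y. \<beta> y x) \<in> left_module_hom k Y A"
    and \<beta>_right: "\<And>y. y \<in> carrier Y \<Longrightarrow> \<beta> y \<in> left_module_hom k (W\<lparr>carrier := V\<rparr>) A"
    and \<phi>: "\<phi> \<in> left_module_hom k Y A"
    and ker: "\<And>y. y \<in> carrier Y \<Longrightarrow> (\<And>x. x \<in> V \<Longrightarrow> \<beta> y x \<in> K) \<Longrightarrow> \<phi> y \<in> K"
  shows "\<exists>x\<in>V. \<forall>y\<in>carrier Y. \<phi> y \<ominus>\<^bsub>A\<^esub> \<beta> y x \<in> K"
proof -
  interpret Y: left_module k Y by fact
  interpret W: left_module k W by fact
  interpret A: left_module k A by fact
  have Ks: "submodule K k A" "v \<notin> K" "v \<in> carrier A" using K by (simp_all add: maximal_avoiding_def)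
  note VW = W.submoduleD(7)[OF V(1)]
  note \<phi>D = left_module_homD[OF \<phi>]
  have \<beta>c: "\<beta> y x \<in> carrier A" if "y \<in> carrier Y" "x \<in> V" for x y
    using left_module_homD(1)[OF \<beta>_left[OF that(2)] that(1)] .
  have \<beta>add: "\<beta> y (x \<oplus>\<^bsub>W\<^esub> x') = \<beta> y x \<oplus>\<^bsub>A\<^esub> \<beta> y x'" if "y \<in> carrier Y" "x \<in> V" "x' \<in> V" for x x' y
    using left_module_homD(2)[OF \<beta>_right[OF that(1)], of x x'] that by simp
  have \<beta>smult: "\<beta> y (a \<odot>\<^bsub>W\<^esub> x) = a \<odot>\<^bsub>A\<^esub> \<beta> y x" if "y \<in> carrier Y" "x \<in> V" "a \<in> carrier k" for a x y
    using left_module_homD(3)[OF \<beta>_right[OF that(1)], of a x] that by simp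
  have \<beta>zero: "\<beta> y \<zero>\<^bsub>W\<^esub> = \<zero>\<^bsub>A\<^esub>" if "y \<in> carrier Y" for y
    using \<beta>smult[OF that W.submoduleD(2)[OF V(1)] zero_closed]
      \<beta>c[OF that W.submoduleD(2)[OF V(1)]] by simp
  have \<beta>zero_left: "\<beta> \<zero>\<^bsub>Y\<^esub> x = \<zero>\<^bsub>A\<^esub>" if "x \<in> V" for x
    using left_module_homD(3)[OF \<beta>_left[OF that] zero_closed Y.M.zero_closed]
      \<beta>c[OF Y.M.zero_closed that] by simp
  let ?P = "\<lambda>V'. (submodule V' k W \<and> V' \<subseteq> V) \<and>
    (\<exists>x\<in>V. \<forall>y\<in>carrier Y. (\<forall>x'\<in>V'. \<beta> y x' \<in> K) \<longrightarrow> \<phi> y \<ominus>\<^bsub>A\<^esub> \<beta> y x \<in> K)"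
  have PV: "?P V"
  proof -
    have "\<phi> y \<ominus>\<^bsub>A\<^esub> \<beta> y \<zero>\<^bsub>W\<^esub> \<in> K" if "y \<in> carrier Y" "\<forall>x'\<in>V. \<beta> y x' \<in> K" for y
      using ker[of y] that \<beta>zero \<phi>D(1) by simp
    then show ?thesis using V(1) W.submoduleD(2)[OF V(1)] by blast
  qed
  obtain V' where V': "?P V'" and Vmin: "\<And>V''. ?P V'' \<Longrightarrow> V'' \<subseteq> V' \<Longrightarrow> V'' = V'"
  proof (rule artinian_in_minimal[OF V(2), of ?P V])
    show "submodule E k W \<and> E \<subseteq> V" if "?P E" for E using that by blast
  qed (rule PV, blast)
  have V's: "submodule V' k W" "V' \<subseteq> V" using V' by blast+
  obtain x where x: "x \<in> V"
    and x_works: "\<And>y. y \<in> carrier Y \<Longrightarrow> \<forall>x'\<in>V'. \<beta> y x' \<in> K \<Longrightarrow> \<phi> y \<ominus>\<^bsub>A\<^esub> \<beta> y x \<in> K"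
    using V' by blast
  show ?thesis
  proof (cases "V' = {\<zero>\<^bsub>W\<^esub>}")
    case True
    then have "\<phi> y \<ominus>\<^bsub>A\<^esub> \<beta> y x \<in> K" if "y \<in> carrier Y" for y
      using x_works[OF that] \<beta>zero[OF that] A.submoduleD(2)[OF Ks(1)] by simp
    then show ?thesis using x by blast
  next
    case False
    obtain H z where H: "submodule H k W" "H \<subseteq> V'" "z \<in> V'" "z \<notin> H"
      and mV': "\<And>a x. a \<in> \<mm> \<Longrightarrow> x \<in> V' \<Longrightarrow> a \<odot>\<^bsub>W\<^esub> x \<in> H"
      and span: "\<And>x. x \<in> V' \<Longrightarrow> \<exists>u\<in>H. \<exists>a\<in>carrier k. x = u \<oplus>\<^bsub>W\<^esub> a \<odot>\<^bsub>W\<^esub> z"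
    proof (rule hyperplane[OF W V's(1) False])
      show "x = \<zero>\<^bsub>W\<^esub>" if "a \<in> carrier k" "a \<notin> \<mm>" "x \<in> V'" "a \<odot>\<^bsub>W\<^esub> x = \<zero>\<^bsub>W\<^esub>" for a x
        using inj that V's(2) by blast
    qed blast
    have zV: "z \<in> V" using H(3) V's(2) by blast
    define \<psi> where "\<psi> y = \<phi> y \<ominus>\<^bsub>A\<^esub> \<beta> y x" for y
    have \<psi>: "\<psi> \<in> left_module_hom k Y A"
      unfolding \<psi>_def by (rule left_module_hom_minus[OF Y A cring_axioms \<phi> \<beta>_left[OF x]])
    interpret \<psi>: left_module_map k Y A \<psi>
      using Y A \<psi> by (simp add: left_module_mapI)
    interpret \<beta>z: left_module_map k Y A "\<lambda>y. \<beta> y z"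
      using Y A \<beta>_left[OF zV] by (simp add: left_module_mapI)
    define Y' where "Y' = {y \<in> carrier Y. \<forall>x'\<in>H. \<beta> y x' \<in> K}"
    have Y'sub: "submodule Y' k Y"
    proof (rule Y.submoduleI)
      show "\<zero>\<^bsub>Y\<^esub> \<in> Y'"
        using \<beta>zero_left H(2) V's(2) A.submoduleD(2)[OF Ks(1)] unfolding Y'_def by auto
      fix y assume y: "y \<in> Y'"
      show "y \<oplus>\<^bsub>Y\<^esub> y' \<in> Y'" if y': "y' \<in> Y'" for y'
      proof -
        have "\<beta> (y \<oplus>\<^bsub>Y\<^esub> y') x' \<in> K" if x': "x' \<in> H" for x'
        proof -
          have "x' \<in> V" using x' H(2) V's(2) by blast
          then have "\<beta> (y \<oplus>\<^bsub>Y\<^esub> y') x' = \<beta> y x' \<oplus>\<^bsub>A\<^esub> \<beta> y' x'"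
            using left_module_homD(2)[OF \<beta>_left, of x' y y'] y y' unfolding Y'_def by simp
          then show ?thesis using A.submoduleD(3)[OF Ks(1)] y y' x' unfolding Y'_def by simp
        qed
        then show ?thesis using y y' unfolding Y'_def by simp
      qed
      show "a \<odot>\<^bsub>Y\<^esub> y \<in> Y'" if a: "a \<in> carrier k" for a
      proof -
        have "\<beta> (a \<odot>\<^bsub>Y\<^esub> y) x' \<in> K" if x': "x' \<in> H" for x'
        proof -
          have "x' \<in> V" using x' H(2) V's(2) by blast
          then have "\<beta> (a \<odot>\<^bsub>Y\<^esub> y) x' = a \<odot>\<^bsub>A\<^esub> \<beta> y x'"
            using left_module_homD(3)[OF \<beta>_left, of x' a y] y a unfolding Y'_def by simp
          then show ?thesis using A.submoduleD(4)[OF Ks(1) a] y x' unfolding Y'_def by simp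
        qed
        then show ?thesis using y a unfolding Y'_def by simp
      qed
    qed (auto simp: Y'_def)
    have Y'c: "y \<in> carrier Y" if "y \<in> Y'" for y using that by (simp add: Y'_def)
    have perp: "\<psi> y \<in> K" if y: "y \<in> Y'" and yz: "\<beta> y z \<in> K" for y
      unfolding \<psi>_def
    proof (rule x_works[OF Y'c[OF y]], intro ballI)
      fix x' assume "x' \<in> V'"
      then obtain u a where u: "u \<in> H" "a \<in> carrier k" "x' = u \<oplus>\<^bsub>W\<^esub> a \<odot>\<^bsub>W\<^esub> z" using span by blast
      have uV: "u \<in> V" "a \<odot>\<^bsub>W\<^esub> z \<in> V"
        using u(1) H(2) V's(2) W.submoduleD(4)[OF V(1) u(2) zV] by blast+
      have "\<beta> y x' = \<beta> y u \<oplus>\<^bsub>A\<^esub> a \<odot>\<^bsub>A\<^esub> \<beta> y z"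
        unfolding u(3) \<beta>add[OF Y'c[OF y] uV] \<beta>smult[OF Y'c[OF y] zV u(2)] ..
      moreover have "\<beta> y u \<in> K" using y u(1) by (simp add: Y'_def)
      ultimately show "\<beta> y x' \<in> K"
        using A.submoduleD(3)[OF Ks(1) _ A.submoduleD(4)[OF Ks(1) u(2) yz]] by simp
    qed
    have m_\<beta>z: "a \<odot>\<^bsub>A\<^esub> \<beta> y z \<in> K" if a: "a \<in> \<mm>" and y: "y \<in> Y'" for a y
      using mV'[OF a H(3)] y unfolding \<beta>smult[OF Y'c[OF y] zV \<mm>_carrier[OF a], symmetric]
      by (simp add: Y'_def)
    have m_\<psi>: "a \<odot>\<^bsub>A\<^esub> \<psi> y \<in> K" if a: "a \<in> \<mm>" and y: "y \<in> Y'" for a y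
    proof -
      have "\<psi> (a \<odot>\<^bsub>Y\<^esub> y) \<in> K"
        by (rule perp[OF Y.submoduleD(4)[OF Y'sub \<mm>_carrier[OF a] y]])
          (simp add: \<beta>z.homD(3)[OF \<mm>_carrier[OF a] Y'c[OF y]] m_\<beta>z[OF a y])
      then show ?thesis by (simp add: \<psi>.homD(3)[OF \<mm>_carrier[OF a] Y'c[OF y]])
    qed
    have "?P H"
    proof (cases "\<forall>y\<in>Y'. \<beta> y z \<in> K")
      case True
      then have "\<psi> y \<in> K" if "y \<in> Y'" for y using perp that by blast
      then have "\<forall>y\<in>carrier Y. (\<forall>x'\<in>H. \<beta> y x' \<in> K) \<longrightarrow> \<phi> y \<ominus>\<^bsub>A\<^esub> \<beta> y x \<in> K"
        unfolding Y'_def \<psi>_def by blast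
      then show ?thesis using H(1,2) V's(2) x by blast
    next
      case False
      then obtain y0 where y0: "y0 \<in> Y'" "\<beta> y0 z \<notin> K" by blast
      note coef = socle_mod_maximal_avoiding[OF A K mv]
      have \<beta>zc: "\<beta> y z \<in> carrier A" if "y \<in> Y'" for y using \<beta>c[OF Y'c[OF that] zV] .
      have \<psi>c: "\<psi> y \<in> carrier A" if "y \<in> Y'" for y using \<psi>.homD(1)[OF Y'c[OF that]] .
      obtain b0 where b0: "b0 \<in> carrier k" "\<beta> y0 z \<ominus>\<^bsub>A\<^esub> b0 \<odot>\<^bsub>A\<^esub> v \<in> K"
        using coef[OF _ \<beta>zc[OF y0(1)]] m_\<beta>z[OF _ y0(1)] by blast
      have b0v: "b0 \<odot>\<^bsub>A\<^esub> v \<in> carrier A" using b0(1) Ks(3) by simp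
      have "b0 \<notin> \<mm>"
        using A.submodule_minus_iff[OF Ks(1) \<beta>zc[OF y0(1)] b0v b0(2)] mv y0(2) by blast
      then obtain d b' where d: "d \<in> carrier k" "b' \<in> \<mm>" "d \<otimes> b0 = \<one> \<oplus> b'"
        using inverse_mod_\<mm>[OF b0(1)] by blast
      \<comment> \<open>Scaled such that \<open>\<beta> y1 z\<close> and \<open>v\<close> agree modulo \<open>K\<close>.\<close>
      define y1 where "y1 = d \<odot>\<^bsub>Y\<^esub> y0"
      have y1: "y1 \<in> Y'" unfolding y1_def by (rule Y.submoduleD(4)[OF Y'sub d(1) y0(1)])
      have y1z: "\<beta> y1 z \<ominus>\<^bsub>A\<^esub> v \<in> K"
      proof -
        have b'v: "b' \<odot>\<^bsub>A\<^esub> v \<in> K" "b' \<odot>\<^bsub>A\<^esub> v \<in> carrier A"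
          using mv[OF d(2)] A.submoduleD(7)[OF Ks(1)] by blast+
        have dv: "d \<odot>\<^bsub>A\<^esub> (b0 \<odot>\<^bsub>A\<^esub> v) \<in> carrier A" using d(1) b0v by simp
        have "d \<odot>\<^bsub>A\<^esub> (b0 \<odot>\<^bsub>A\<^esub> v) = v \<oplus>\<^bsub>A\<^esub> b' \<odot>\<^bsub>A\<^esub> v"
          using A.smult_assoc1[OF d(1) b0(1) Ks(3)] d(3) A.smult_l_distr[OF one_closed \<mm>_carrier[OF d(2)] Ks(3)] Ks(3)
          by simp
        then have "d \<odot>\<^bsub>A\<^esub> (b0 \<odot>\<^bsub>A\<^esub> v) \<ominus>\<^bsub>A\<^esub> v = b' \<odot>\<^bsub>A\<^esub> v"
          using A.minus_add_cancel[OF b'v(2) Ks(3)] A.M.a_comm[OF Ks(3) b'v(2)] by simp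
        then have 1: "d \<odot>\<^bsub>A\<^esub> (b0 \<odot>\<^bsub>A\<^esub> v) \<ominus>\<^bsub>A\<^esub> v \<in> K" using b'v(1) by simp
        have 2: "\<beta> y1 z = d \<odot>\<^bsub>A\<^esub> \<beta> y0 z" unfolding y1_def by (rule \<beta>z.homD(3)[OF d(1) Y'c[OF y0(1)]])
        have 3: "\<beta> y1 z \<ominus>\<^bsub>A\<^esub> d \<odot>\<^bsub>A\<^esub> (b0 \<odot>\<^bsub>A\<^esub> v) \<in> K"
          unfolding 2 by (rule A.submodule_minus_smult[OF Ks(1) d(1) \<beta>zc[OF y0(1)] b0v b0(2)])
        show ?thesis by (rule A.submodule_minus_trans[OF Ks(1) \<beta>zc[OF y1] dv Ks(3) 3 1])
      qed
      obtain a0 where a0: "a0 \<in> carrier k" "\<psi> y1 \<ominus>\<^bsub>A\<^esub> a0 \<odot>\<^bsub>A\<^esub> v \<in> K"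
        using coef[OF _ \<psi>c[OF y1]] m_\<psi>[OF _ y1] by blast
      have a0v: "a0 \<odot>\<^bsub>A\<^esub> v \<in> carrier A" using a0(1) Ks(3) by simp
      define x1 where "x1 = x \<oplus>\<^bsub>W\<^esub> a0 \<odot>\<^bsub>W\<^esub> z"
      have a0z: "a0 \<odot>\<^bsub>W\<^esub> z \<in> V" by (rule W.submoduleD(4)[OF V(1) a0(1) zV])
      have x1: "x1 \<in> V" unfolding x1_def by (rule W.submoduleD(3)[OF V(1) x a0z])
      have "\<phi> y \<ominus>\<^bsub>A\<^esub> \<beta> y x1 \<in> K" if y: "y \<in> Y'" for y
      proof -
        obtain b where b: "b \<in> carrier k" "\<beta> y z \<ominus>\<^bsub>A\<^esub> b \<odot>\<^bsub>A\<^esub> v \<in> K"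
          using coef[OF _ \<beta>zc[OF y]] m_\<beta>z[OF _ y] by blast
        have bv: "b \<odot>\<^bsub>A\<^esub> v \<in> carrier A" using b(1) Ks(3) by simp
        have by1: "b \<odot>\<^bsub>Y\<^esub> y1 \<in> Y'" by (rule Y.submoduleD(4)[OF Y'sub b(1) y1])
        have \<beta>by1: "\<beta> (b \<odot>\<^bsub>Y\<^esub> y1) z = b \<odot>\<^bsub>A\<^esub> \<beta> y1 z" by (rule \<beta>z.homD(3)[OF b(1) Y'c[OF y1]])
        have bv1: "b \<odot>\<^bsub>A\<^esub> v \<ominus>\<^bsub>A\<^esub> \<beta> (b \<odot>\<^bsub>Y\<^esub> y1) z \<in> K"
          unfolding \<beta>by1
          by (rule A.submodule_minus_smult[OF Ks(1) b(1) Ks(3) \<beta>zc[OF y1]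
                A.submodule_minus_commute[OF Ks(1) \<beta>zc[OF y1] Ks(3) y1z]])
        have "\<beta> y z \<ominus>\<^bsub>A\<^esub> \<beta> (b \<odot>\<^bsub>Y\<^esub> y1) z \<in> K"
          by (rule A.submodule_minus_trans[OF Ks(1) \<beta>zc[OF y] bv \<beta>zc[OF by1] b(2) bv1])
        then have "\<psi> (y \<ominus>\<^bsub>Y\<^esub> b \<odot>\<^bsub>Y\<^esub> y1) \<in> K"
          by (intro perp[OF Y.submoduleD(6)[OF Y'sub y by1]])
            (simp only: \<beta>z.hom_diff[OF Y'c[OF y] Y'c[OF by1]])
        then have 1: "\<psi> y \<ominus>\<^bsub>A\<^esub> b \<odot>\<^bsub>A\<^esub> \<psi> y1 \<in> K"
          by (simp only: \<psi>.hom_diff[OF Y'c[OF y] Y'c[OF by1]] \<psi>.homD(3)[OF b(1) Y'c[OF y1]])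
        have 2: "b \<odot>\<^bsub>A\<^esub> \<psi> y1 \<ominus>\<^bsub>A\<^esub> b \<odot>\<^bsub>A\<^esub> (a0 \<odot>\<^bsub>A\<^esub> v) \<in> K"
          by (rule A.submodule_minus_smult[OF Ks(1) b(1) \<psi>c[OF y1] a0v a0(2)])
        have swap: "b \<odot>\<^bsub>A\<^esub> (a0 \<odot>\<^bsub>A\<^esub> v) = a0 \<odot>\<^bsub>A\<^esub> (b \<odot>\<^bsub>A\<^esub> v)"
          using A.smult_assoc1[OF b(1) a0(1) Ks(3)] A.smult_assoc1[OF a0(1) b(1) Ks(3)]
            m_comm[OF b(1) a0(1)] by simp
        have 3: "a0 \<odot>\<^bsub>A\<^esub> (b \<odot>\<^bsub>A\<^esub> v) \<ominus>\<^bsub>A\<^esub> a0 \<odot>\<^bsub>A\<^esub> \<beta> y z \<in> K"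
          by (rule A.submodule_minus_smult[OF Ks(1) a0(1) bv \<beta>zc[OF y]
                A.submodule_minus_commute[OF Ks(1) \<beta>zc[OF y] bv b(2)]])
        have c: "b \<odot>\<^bsub>A\<^esub> \<psi> y1 \<in> carrier A" "a0 \<odot>\<^bsub>A\<^esub> (b \<odot>\<^bsub>A\<^esub> v) \<in> carrier A"
          "a0 \<odot>\<^bsub>A\<^esub> \<beta> y z \<in> carrier A"
          using b(1) a0(1) \<psi>c[OF y1] bv \<beta>zc[OF y] by simp_all
        have "b \<odot>\<^bsub>A\<^esub> \<psi> y1 \<ominus>\<^bsub>A\<^esub> a0 \<odot>\<^bsub>A\<^esub> \<beta> y z \<in> K"
          by (rule A.submodule_minus_trans[OF Ks(1) c 2[unfolded swap] 3])
        then have "\<psi> y \<ominus>\<^bsub>A\<^esub> a0 \<odot>\<^bsub>A\<^esub> \<beta> y z \<in> K"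
          by (rule A.submodule_minus_trans[OF Ks(1) \<psi>c[OF y] c(1,3) 1])
        moreover have "\<phi> y \<ominus>\<^bsub>A\<^esub> \<beta> y x1 = \<psi> y \<ominus>\<^bsub>A\<^esub> a0 \<odot>\<^bsub>A\<^esub> \<beta> y z"
        proof -
          have "\<beta> y x1 = \<beta> y x \<oplus>\<^bsub>A\<^esub> a0 \<odot>\<^bsub>A\<^esub> \<beta> y z"
            unfolding x1_def \<beta>add[OF Y'c[OF y] x a0z] \<beta>smult[OF Y'c[OF y] zV a0(1)] ..
          then show ?thesis unfolding \<psi>_def
            using \<phi>D(1)[OF Y'c[OF y]] \<beta>c[OF Y'c[OF y] x] c(3) by (simp only: A.group_normalise)
        qed
        ultimately show ?thesis by simp
      qed
      then have "\<forall>y\<in>carrier Y. (\<forall>x'\<in>H. \<beta> y x' \<in> K) \<longrightarrow> \<phi> y \<ominus>\<^bsub>A\<^esub> \<beta> y x1 \<in> K"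
        unfolding Y'_def by blast
      then show ?thesis using H(1,2) V's(2) x1 by blast
    qed
    then have "H = V'" using Vmin[of H] H(2) by blast
    then show ?thesis using H(3,4) by blast
  qed
qed

end

section \<open>Finitely generated modules over an Artin algebra\<close>

text \<open>
  The descending sequence of the principal ideals generated by the powers of \<open>a\<close> is stationary.
\<close>

lemma (in artinian_cring) power_regular:
  assumes a: "a \<in> carrier R"
  shows "\<exists>n>(0::nat). \<exists>d\<in>carrier R. a [^] n = a [^] n \<otimes> (a [^] n \<otimes> d)"
proof -
  interpret reg: left_module R "regular_module R" by (rule left_module_regular_module)
  define E where "E n = (\<lambda>b. b \<otimes> a [^] n) ` carrier R" for n :: nat
  have pc: "a [^] n \<in> carrier R" for n :: nat using a by simp
  have "\<exists>n. \<forall>m\<ge>n. E m = E n"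
  proof (rule artinian_in_chain[OF artinian_in_regular_module])
    show "submodule (E n) R (regular_module R)" for n
      using reg.submodule_multiples[of "a [^] n"] pc[of n] by (simp add: regular_module_def E_def)
    show "E n \<subseteq> carrier R" for n unfolding E_def using pc by blast
    show "E (Suc n) \<subseteq> E n" for n
    proof
      fix x assume "x \<in> E (Suc n)"
      then obtain b where b: "b \<in> carrier R" "x = b \<otimes> a [^] Suc n" unfolding E_def by blast
      then have "x = (b \<otimes> a) \<otimes> a [^] n"
        using m_assoc[OF b(1) a pc[of n]] m_comm[OF a pc[of n]] by simp
      then show "x \<in> E n" unfolding E_def using b(1) a by blast
    qed
  qed
  then obtain n where n: "\<forall>m\<ge>n. E m = E n" ..
  define p where "p = a [^] Suc n"
  have pR: "p \<in> carrier R" unfolding p_def by (rule pc)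
  have "E (Suc n) = E n" "E (Suc n + Suc n) = E n" by (rule n[rule_format], simp)+
  moreover have "p \<in> E (Suc n)"
    unfolding E_def p_def by (rule image_eqI[of _ _ \<one>]) (simp_all add: pc a)
  ultimately have "p \<in> E (Suc n + Suc n)" by blast
  then obtain d where d: "d \<in> carrier R" "p = d \<otimes> a [^] (Suc n + Suc n)" unfolding E_def by blast
  have "a [^] (Suc n + Suc n) = p \<otimes> p"
    unfolding p_def by (rule nat_pow_mult[OF a, symmetric])
  then have "p = d \<otimes> (p \<otimes> p)" using d(2) by (simp only:)
  then have "p = p \<otimes> (p \<otimes> d)"
    using m_comm[OF d(1) m_closed[OF pR pR]] m_assoc[OF pR pR d(1)] by (simp only:)
  then show ?thesis using d(1) zero_less_Suc[of n] unfolding p_def by (intro exI[of _ "Suc n"]) blast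
qed

context artin_algebra
begin

abbreviation center_ring ("\<kk>") where "\<kk> \<equiv> R\<lparr>carrier := ring_center R\<rparr>"

lemma center_artinian_cring: "artinian_cring \<kk>"
  by (rule center_artinian)

lemma center_carrier: "a \<in> ring_center R \<Longrightarrow> a \<in> carrier R"
  by (simp add: ring_center_def)

lemma center_comm: "a \<in> ring_center R \<Longrightarrow> r \<in> carrier R \<Longrightarrow> a \<otimes> r = r \<otimes> a"
  by (simp add: ring_center_def)

lemma left_module_center:
  assumes "left_module R M"
  shows "left_module \<kk> M"
proof -
  interpret M: left_module R M by fact
  interpret K: artinian_cring \<kk> by (rule center_artinian)
  have "left_module_axioms \<kk> M"
    by (rule left_module_axioms.intro)
      (use center_carrier M.smult_l_distr M.smult_r_distr M.smult_assoc1 in auto)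
  then show ?thesis using M.M.abelian_group_axioms K.ring_axioms by (simp add: left_module_def)
qed

lemma submodule_center:
  assumes M: "left_module R M" and H: "submodule H R M"
  shows "submodule H \<kk> M"
proof -
  interpret M: left_module R M by fact
  interpret K: left_module \<kk> M by (rule left_module_center[OF M])
  show ?thesis
    by (rule K.submoduleI) (use M.submoduleD[OF H] center_carrier in auto)
qed

lemma left_module_hom_center:
  "f \<in> left_module_hom R M N \<Longrightarrow> f \<in> left_module_hom \<kk> M N"
  unfolding left_module_hom_def using center_carrier by simp

lemma left_module_center_regular: "left_module \<kk> (regular_module R)"
  by (rule left_module_center[OF left_module_regular_module])

lemma multiples_hom:
  assumes "left_module R M" "x \<in> carrier M"
  shows "(\<lambda>r. r \<odot>\<^bsub>M\<^esub> x) \<in> left_module_hom R (regular_module R) M"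
proof -
  interpret M: left_module R M by fact
  show ?thesis
    by (rule left_module_homI) (use assms(2) M.smult_l_distr M.smult_assoc1 in \<open>auto simp: regular_module_def\<close>)
qed

lemma artinian_in_center_regular: "artinian_in \<kk> (regular_module R) (carrier R)"
proof -
  interpret K: artinian_cring \<kk> by (rule center_artinian)
  interpret reg: left_module \<kk> "regular_module R" by (rule left_module_center_regular)
  obtain A where A: "finite A" "A \<subseteq> carrier R"
    "submodule_generated \<kk> (regular_module R) A = carrier R"
    using finitely_generated_over_center
    unfolding finitely_generated_module_def by (auto simp: regular_module_def)
  have hom: "(\<lambda>r. r \<odot>\<^bsub>regular_module R\<^esub> x) \<in> left_module_hom \<kk> (regular_module \<kk>) (regular_module R)"
    if "x \<in> carrier (regular_module R)" for x
    by (rule left_module_homI)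
      (use that center_carrier in \<open>auto simp: regular_module_def l_distr m_assoc\<close>)
  have "\<exists>U. submodule U \<kk> (regular_module R) \<and> submodule U \<kk> (regular_module R) \<and> A \<subseteq> U
      \<and> artinian_in \<kk> (regular_module R) U"
    by (rule artinian_in_finitely_generated[OF left_module_center_regular left_module_center_regular
          K.left_module_regular_module K.artinian_in_regular_module hom A(1)])
      (use A(2) in \<open>simp_all add: regular_module_def\<close>)
  then obtain U where U: "submodule U \<kk> (regular_module R)" "A \<subseteq> U"
    "artinian_in \<kk> (regular_module R) U" by blast
  have "carrier R \<subseteq> U"
    using reg.submodule_generated_minimal[OF U(1,2)] A(3) by simp
  then show ?thesis using artinian_in_subset[OF U(3)] by blast
qed

text \<open>
  Being finitely generated over its artinian center, \<open>R\<close> is artinian over it, and a finitely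
  generated module is a finite sum of images of \<open>R\<close>.
\<close>

lemma artinian_in_finitely_generated_submodule:
  assumes M: "left_module R M" and N: "submodule N R M"
    and fg: "finitely_generated_module R (M\<lparr>carrier := N\<rparr>)"
  shows "artinian_in \<kk> M N"
proof -
  interpret M: left_module R M by fact
  interpret N: left_module R "M\<lparr>carrier := N\<rparr>" by (rule M.left_module_submodule[OF N])
  obtain A where A: "finite A" "A \<subseteq> N" "submodule_generated R (M\<lparr>carrier := N\<rparr>) A = N"
    using fg unfolding finitely_generated_module_def by auto
  have Ac: "A \<subseteq> carrier M" using A(2) M.submoduleD(1)[OF N] by blast
  obtain U where U: "submodule U R M" "A \<subseteq> U" "artinian_in \<kk> M U"
    using artinian_in_finitely_generated[OF M left_module_center[OF M] left_module_center_regular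
        artinian_in_center_regular left_module_hom_center[OF multiples_hom[OF M]] A(1) Ac] by blast
  have "submodule (U \<inter> N) R (M\<lparr>carrier := N\<rparr>)"
    unfolding M.submodule_of_submodule[OF N] using M.submodule_Int[OF U(1) N] by blast
  then have "N \<subseteq> U \<inter> N"
    using N.submodule_generated_minimal[of "U \<inter> N" A] A U(2) by blast
  then show ?thesis using artinian_in_subset[OF U(3)] by blast
qed

end

section \<open>Endomorphisms of an indecomposable artinian submodule\<close>

text \<open>
  The indecomposable module is taken as a submodule of a module \<open>P\<close> that is also the target of
  the homomorphisms to be studied; in the application \<open>P\<close> is the product of the given modules.
\<close>

locale indecomposable_submodule = artin_algebra R + P: left_module R P
  for R :: "('r, 'c) ring_scheme" (structure) and P :: "('r, 'm, 'd) module_scheme" +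
  fixes V :: "'m set"
  assumes V_submodule: "submodule V R P" and V_nonzero: "V \<noteq> {\<zero>\<^bsub>P\<^esub>}"
    and V_artinian: "artinian_in \<kk> P V"
    and V_indecomposable: "\<lbrakk>submodule A R P; submodule B R P; A \<subseteq> V; B \<subseteq> V; A \<inter> B = {\<zero>\<^bsub>P\<^esub>};
      V \<subseteq> A <+>\<^bsub>P\<^esub> B\<rbrakk> \<Longrightarrow> A = {\<zero>\<^bsub>P\<^esub>} \<or> B = {\<zero>\<^bsub>P\<^esub>}"
begin

lemma V_module: "left_module R (P\<lparr>carrier := V\<rparr>)"
  by (rule P.left_module_submodule[OF V_submodule])

lemma P_center: "left_module \<kk> P"
  by (rule left_module_center[OF P.left_module_axioms])

lemma V_center: "submodule V \<kk> P"
  by (rule submodule_center[OF P.left_module_axioms V_submodule])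

lemmas VP = P.submoduleD(7)[OF V_submodule]

lemma exists_nonzero: "\<exists>x\<in>V. x \<noteq> \<zero>\<^bsub>P\<^esub>"
  using V_nonzero P.submoduleD(2)[OF V_submodule] by blast

abbreviation End where "End \<equiv> left_module_hom R (P\<lparr>carrier := V\<rparr>) (P\<lparr>carrier := V\<rparr>)"

lemma EndI:
  assumes "\<And>x. x \<in> V \<Longrightarrow> f x \<in> V"
    and "\<And>x y. x \<in> V \<Longrightarrow> y \<in> V \<Longrightarrow> f (x \<oplus>\<^bsub>P\<^esub> y) = f x \<oplus>\<^bsub>P\<^esub> f y"
    and "\<And>a x. a \<in> carrier R \<Longrightarrow> x \<in> V \<Longrightarrow> f (a \<odot>\<^bsub>P\<^esub> x) = a \<odot>\<^bsub>P\<^esub> f x"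
  shows "f \<in> End"
  by (rule left_module_homI) (use assms in auto)

lemma EndD:
  assumes "f \<in> End"
  shows "x \<in> V \<Longrightarrow> f x \<in> V"
    and "x \<in> V \<Longrightarrow> y \<in> V \<Longrightarrow> f (x \<oplus>\<^bsub>P\<^esub> y) = f x \<oplus>\<^bsub>P\<^esub> f y"
    and "a \<in> carrier R \<Longrightarrow> x \<in> V \<Longrightarrow> f (a \<odot>\<^bsub>P\<^esub> x) = a \<odot>\<^bsub>P\<^esub> f x"
    and "f \<zero>\<^bsub>P\<^esub> = \<zero>\<^bsub>P\<^esub>"
    and "x \<in> V \<Longrightarrow> y \<in> V \<Longrightarrow> f (x \<ominus>\<^bsub>P\<^esub> y) = f x \<ominus>\<^bsub>P\<^esub> f y"
proof -
  show 1: "x \<in> V \<Longrightarrow> f x \<in> V" for x using left_module_homD(1)[OF assms, of x] by simp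
  show 2: "x \<in> V \<Longrightarrow> y \<in> V \<Longrightarrow> f (x \<oplus>\<^bsub>P\<^esub> y) = f x \<oplus>\<^bsub>P\<^esub> f y" for x y
    using left_module_homD(2)[OF assms, of x y] by simp
  show 3: "a \<in> carrier R \<Longrightarrow> x \<in> V \<Longrightarrow> f (a \<odot>\<^bsub>P\<^esub> x) = a \<odot>\<^bsub>P\<^esub> f x" for a x
    using left_module_homD(3)[OF assms, of a x] by simp
  interpret V: left_module R "P\<lparr>carrier := V\<rparr>" by (rule V_module)
  show "f \<zero>\<^bsub>P\<^esub> = \<zero>\<^bsub>P\<^esub>"
    using 3[of "\<zero>" "\<zero>\<^bsub>P\<^esub>"] VP[OF 1[OF P.submoduleD(2)[OF V_submodule]]]
      P.submoduleD(2)[OF V_submodule] by simp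
  show "f (x \<ominus>\<^bsub>P\<^esub> y) = f x \<ominus>\<^bsub>P\<^esub> f y" if "x \<in> V" "y \<in> V"
  proof -
    have d: "x \<ominus>\<^bsub>P\<^esub> y \<in> V" by (rule P.submoduleD(6)[OF V_submodule that])
    have "f x = f (x \<ominus>\<^bsub>P\<^esub> y) \<oplus>\<^bsub>P\<^esub> f y"
      using 2[OF d that(2)] P.add_minus_cancel[OF VP[OF that(1)] VP[OF that(2)]] by simp
    then show ?thesis
      using P.minus_add_cancel[OF VP[OF 1[OF d]] VP[OF 1[OF that(2)]]] by simp
  qed
qed

lemma End_comp: "f \<in> End \<Longrightarrow> g \<in> End \<Longrightarrow> (\<lambda>x. g (f x)) \<in> End"
  by (rule left_module_hom_comp)

lemma End_funpow: "f \<in> End \<Longrightarrow> f ^^ n \<in> End"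
proof (induction n)
  case 0 show ?case unfolding funpow_0[abs_def] by (rule EndI) (simp_all)
next
  case (Suc n)
  then show ?case using End_comp[of "f ^^ n" f] by (simp add: comp_def)
qed

lemma End_center: "a \<in> ring_center R \<Longrightarrow> (\<lambda>x. a \<odot>\<^bsub>P\<^esub> x) \<in> End"
proof (rule EndI)
  assume a: "a \<in> ring_center R"
  note ac = center_carrier[OF a]
  show "a \<odot>\<^bsub>P\<^esub> x \<in> V" if "x \<in> V" for x by (rule P.submoduleD(4)[OF V_submodule ac that])
  show "a \<odot>\<^bsub>P\<^esub> (x \<oplus>\<^bsub>P\<^esub> y) = a \<odot>\<^bsub>P\<^esub> x \<oplus>\<^bsub>P\<^esub> a \<odot>\<^bsub>P\<^esub> y" if "x \<in> V" "y \<in> V" for x y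
    by (rule P.smult_r_distr[OF ac VP[OF that(1)] VP[OF that(2)]])
  show "a \<odot>\<^bsub>P\<^esub> (b \<odot>\<^bsub>P\<^esub> x) = b \<odot>\<^bsub>P\<^esub> (a \<odot>\<^bsub>P\<^esub> x)" if "b \<in> carrier R" "x \<in> V" for b x
    using P.smult_assoc1[OF ac that(1) VP[OF that(2)]] P.smult_assoc1[OF that(1) ac VP[OF that(2)]]
      center_comm[OF a that(1)] by simp
qed

lemma End_pair: "f \<in> End \<Longrightarrow> left_module_map R (P\<lparr>carrier := V\<rparr>) (P\<lparr>carrier := V\<rparr>) f"
  using V_module by (simp add: left_module_mapI)

lemma bij_if_trivial_kernel:
  assumes f: "f \<in> End" and ker: "\<And>x. x \<in> V \<Longrightarrow> f x = \<zero>\<^bsub>P\<^esub> \<Longrightarrow> x = \<zero>\<^bsub>P\<^esub>" and surj: "V \<subseteq> f ` V"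
  shows "bij_betw f V V"
proof -
  have "inj_on f V"
  proof (rule inj_onI)
    fix x y assume xy: "x \<in> V" "y \<in> V" "f x = f y"
    have "f (x \<ominus>\<^bsub>P\<^esub> y) = \<zero>\<^bsub>P\<^esub>"
      unfolding EndD(5)[OF f xy(1,2)] xy(3) using VP[OF EndD(1)[OF f xy(2)]] by simp
    then have "x \<ominus>\<^bsub>P\<^esub> y = \<zero>\<^bsub>P\<^esub>" by (rule ker[OF P.submoduleD(6)[OF V_submodule xy(1,2)]])
    then show "x = y" by (rule P.minus_eq_zeroD[OF VP[OF xy(1)] VP[OF xy(2)]])
  qed
  then show ?thesis unfolding bij_betw_def using surj EndD(1)[OF f] by blast
qed

text \<open>
  The first assumption says that \<open>V\<close> is the sum of the kernel and the image of \<open>t\<close>, the second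
  one that this sum is direct.
\<close>

lemma kernel_image_dichotomy:
  assumes t: "t \<in> End" and im: "\<And>x. x \<in> V \<Longrightarrow> \<exists>y\<in>V. t x = t (t y)"
    and ker: "\<And>x. x \<in> V \<Longrightarrow> t (t x) = \<zero>\<^bsub>P\<^esub> \<Longrightarrow> t x = \<zero>\<^bsub>P\<^esub>"
  shows "(\<forall>x\<in>V. t x = \<zero>\<^bsub>P\<^esub>) \<or> bij_betw t V V"
proof -
  interpret t: left_module_map R "P\<lparr>carrier := V\<rparr>" "P\<lparr>carrier := V\<rparr>" t by (rule End_pair[OF t])
  let ?A = "{x \<in> V. t x \<in> {\<zero>\<^bsub>P\<^esub>}}" and ?B = "t ` V"
  have A: "submodule ?A R P"
    using t.submodule_preimage[OF t.M.submodule_zero t.M.submodule_carrier]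
    unfolding P.submodule_of_submodule[OF V_submodule] by simp
  have B: "submodule ?B R P"
    using t.submodule_image[OF t.M.submodule_carrier]
    unfolding P.submodule_of_submodule[OF V_submodule] by simp
  have BV: "?B \<subseteq> V" using EndD(1)[OF t] by blast
  have "?A \<inter> ?B \<subseteq> {\<zero>\<^bsub>P\<^esub>}" using ker by auto
  then have int: "?A \<inter> ?B = {\<zero>\<^bsub>P\<^esub>}" using P.submoduleD(2)[OF A] P.submoduleD(2)[OF B] by blast
  have "V \<subseteq> ?A <+>\<^bsub>P\<^esub> ?B"
  proof
    fix x assume x: "x \<in> V"
    obtain y where y: "y \<in> V" "t x = t (t y)" using im[OF x] by blast
    have ty: "t y \<in> V" by (rule EndD(1)[OF t y(1)])
    have "t (x \<ominus>\<^bsub>P\<^esub> t y) = \<zero>\<^bsub>P\<^esub>"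
      unfolding EndD(5)[OF t x ty] y(2) using VP[OF EndD(1)[OF t ty]] by simp
    then have "x \<ominus>\<^bsub>P\<^esub> t y \<in> ?A" using P.submoduleD(6)[OF V_submodule x ty] by simp
    moreover have "x = (x \<ominus>\<^bsub>P\<^esub> t y) \<oplus>\<^bsub>P\<^esub> t y"
      using P.add_minus_cancel[OF VP[OF x] VP[OF ty]] by simp
    ultimately show "x \<in> ?A <+>\<^bsub>P\<^esub> ?B" unfolding P.set_add_iff using y(1) by blast
  qed
  then have "?A = {\<zero>\<^bsub>P\<^esub>} \<or> ?B = {\<zero>\<^bsub>P\<^esub>}"
    using V_indecomposable[OF A B _ BV int] by blast
  then show ?thesis
  proof
    assume A0: "?A = {\<zero>\<^bsub>P\<^esub>}"
    have inj: "x = \<zero>\<^bsub>P\<^esub>" if "x \<in> V" "t x = \<zero>\<^bsub>P\<^esub>" for x using A0 that by blast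
    have "V \<subseteq> ?B"
    proof
      fix x assume "x \<in> V"
      then obtain a b where ab: "a \<in> ?A" "b \<in> ?B" "x = a \<oplus>\<^bsub>P\<^esub> b"
        using \<open>V \<subseteq> ?A <+>\<^bsub>P\<^esub> ?B\<close> P.set_add_iff[of x ?A ?B] by blast
      have "a = \<zero>\<^bsub>P\<^esub>" using ab(1) A0 by blast
      moreover have "b \<in> carrier P" using ab(2) BV VP by blast
      ultimately show "x \<in> ?B" using ab(2,3) by simp
    qed
    then have "bij_betw t V V" using bij_if_trivial_kernel[OF t inj] by blast
    then show ?thesis ..
  next
    assume "?B = {\<zero>\<^bsub>P\<^esub>}"
    then show ?thesis by blast
  qed
qed

lemma nilpotent_kernel:
  assumes s: "s \<in> End" and nil: "\<And>x. x \<in> V \<Longrightarrow> (s ^^ n) x = \<zero>\<^bsub>P\<^esub>"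
  shows "\<exists>x\<in>V. x \<noteq> \<zero>\<^bsub>P\<^esub> \<and> s x = \<zero>\<^bsub>P\<^esub>"
proof -
  obtain x where x: "x \<in> V" "x \<noteq> \<zero>\<^bsub>P\<^esub>" using exists_nonzero by blast
  define l where "l = (LEAST l. (s ^^ l) x = \<zero>\<^bsub>P\<^esub>)"
  have l: "(s ^^ l) x = \<zero>\<^bsub>P\<^esub>" unfolding l_def by (rule LeastI[of _ n]) (rule nil[OF x(1)])
  obtain l' where l': "l = Suc l'" using l x(2) by (cases l) auto
  have "(s ^^ l') x \<noteq> \<zero>\<^bsub>P\<^esub>" using not_less_Least[of l' "\<lambda>l. (s ^^ l) x = \<zero>\<^bsub>P\<^esub>"] l' l_def by simp
  moreover have "s ((s ^^ l') x) = \<zero>\<^bsub>P\<^esub>" using l l' by simp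
  ultimately show ?thesis using EndD(1)[OF End_funpow[OF s] x(1)] by blast
qed

text \<open>
  If \<open>p + q\<close> were the identity, then \<open>p\<close> would fix the vectors annihilated by \<open>q\<close>. This is why
  non-bijective endomorphisms are closed under addition; it is applied first to the
  multiplications by central scalars and later to arbitrary endomorphisms.
\<close>

lemma not_sum_of_nilpotents:
  assumes p: "p \<in> End" "\<And>x. x \<in> V \<Longrightarrow> (p ^^ m) x = \<zero>\<^bsub>P\<^esub>"
    and q: "q \<in> End" "\<And>x. x \<in> V \<Longrightarrow> (q ^^ n) x = \<zero>\<^bsub>P\<^esub>"
  shows "\<exists>x\<in>V. p x \<oplus>\<^bsub>P\<^esub> q x \<noteq> x"
proof (rule ccontr)
  assume neg: "\<not> ?thesis"
  obtain x where x: "x \<in> V" "x \<noteq> \<zero>\<^bsub>P\<^esub>" "q x = \<zero>\<^bsub>P\<^esub>" using nilpotent_kernel[OF q] by blast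
  have "p x \<oplus>\<^bsub>P\<^esub> q x = x" using neg x(1) by blast
  then have "p x = x" using x(3) VP[OF EndD(1)[OF p(1) x(1)]] by simp
  then have "(p ^^ m) x = x" by (induction m) simp_all
  then show False using p(2)[OF x(1)] x(2) by simp
qed

text \<open>
  The maximal ideal of the center over which \<open>V\<close> lives. It is introduced before Fitting's lemma,
  because it is used to show that \<open>V\<close> is noetherian.
\<close>

definition noninvertible_scalars ("\<mm>") where
  "\<mm> = {a \<in> ring_center R. \<not> (\<exists>d\<in>ring_center R. \<forall>x\<in>V. d \<odot>\<^bsub>P\<^esub> (a \<odot>\<^bsub>P\<^esub> x) = x)}"

lemma center_mult: "a \<in> ring_center R \<Longrightarrow> b \<in> ring_center R \<Longrightarrow> a \<otimes> b \<in> ring_center R"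
  and center_add: "a \<in> ring_center R \<Longrightarrow> b \<in> ring_center R \<Longrightarrow> a \<oplus> b \<in> ring_center R"
  and center_one: "\<one> \<in> ring_center R" and center_zero: "\<zero> \<in> ring_center R"
proof -
  interpret K: artinian_cring \<kk> by (rule center_artinian_cring)
  show "a \<in> ring_center R \<Longrightarrow> b \<in> ring_center R \<Longrightarrow> a \<otimes> b \<in> ring_center R"
    using K.m_closed[of a b] by simp
  show "a \<in> ring_center R \<Longrightarrow> b \<in> ring_center R \<Longrightarrow> a \<oplus> b \<in> ring_center R"
    using K.add.m_closed[of a b] by simp
  show "\<one> \<in> ring_center R" "\<zero> \<in> ring_center R"
    using K.one_closed K.zero_closed by simp_all
qed

lemma center_smult_assoc:
  "a \<in> ring_center R \<Longrightarrow> b \<in> ring_center R \<Longrightarrow> x \<in> V \<Longrightarrow> (a \<otimes> b) \<odot>\<^bsub>P\<^esub> x = a \<odot>\<^bsub>P\<^esub> (b \<odot>\<^bsub>P\<^esub> x)"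
  by (rule P.smult_assoc1[OF center_carrier center_carrier VP])

lemma center_smult_V: "a \<in> ring_center R \<Longrightarrow> x \<in> V \<Longrightarrow> a \<odot>\<^bsub>P\<^esub> x \<in> V"
  by (rule P.submoduleD(4)[OF V_submodule center_carrier])

text \<open>
  By \<open>power_regular\<close>, some power \<open>p\<close> of \<open>a\<close> satisfies \<open>p = p p d\<close>, so that \<open>V\<close> is the direct sum
  of the kernel and the image of the multiplication by \<open>p\<close>.
\<close>

lemma noninvertible_nilpotent:
  assumes "a \<in> \<mm>"
  shows "\<exists>n. \<forall>x\<in>V. ((\<lambda>x. a \<odot>\<^bsub>P\<^esub> x) ^^ n) x = \<zero>\<^bsub>P\<^esub>"
proof -
  interpret K: artinian_cring \<kk> by (rule center_artinian_cring)
  have a: "a \<in> ring_center R" and no_inv: "\<not> (\<exists>d\<in>ring_center R. \<forall>x\<in>V. d \<odot>\<^bsub>P\<^esub> (a \<odot>\<^bsub>P\<^esub> x) = x)"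
    using assms by (simp_all add: noninvertible_scalars_def)
  have pc: "a [^]\<^bsub>\<kk>\<^esub> n \<in> ring_center R" for n :: nat
    using K.nat_pow_closed[of a n] a by simp
  have pow: "((\<lambda>x. a \<odot>\<^bsub>P\<^esub> x) ^^ n) x = (a [^]\<^bsub>\<kk>\<^esub> n) \<odot>\<^bsub>P\<^esub> x" if x: "x \<in> V" for n :: nat and x
  proof (induction n)
    case 0
    show ?case using VP[OF x] by simp
  next
    case (Suc n)
    have "a [^]\<^bsub>\<kk>\<^esub> Suc n = a \<otimes> a [^]\<^bsub>\<kk>\<^esub> n"
      using center_comm[OF a center_carrier[OF pc[of n]]] by simp
    then show ?case
      using Suc center_smult_assoc[OF a pc[of n] x] by simp
  qed
  obtain n :: nat and d where n: "n > 0" and d: "d \<in> ring_center R"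
    and eq: "a [^]\<^bsub>\<kk>\<^esub> n = a [^]\<^bsub>\<kk>\<^esub> n \<otimes> (a [^]\<^bsub>\<kk>\<^esub> n \<otimes> d)"
    using K.power_regular[of a] a by auto
  define p where "p = a [^]\<^bsub>\<kk>\<^esub> n"
  have p: "p \<in> ring_center R" unfolding p_def by (rule pc)
  have peq: "p \<odot>\<^bsub>P\<^esub> x = p \<odot>\<^bsub>P\<^esub> (p \<odot>\<^bsub>P\<^esub> (d \<odot>\<^bsub>P\<^esub> x))" if x: "x \<in> V" for x
    using center_smult_assoc[OF p center_mult[OF p d] x] center_smult_assoc[OF p d x]
      eq[folded p_def] by simp
  have "(\<forall>x\<in>V. p \<odot>\<^bsub>P\<^esub> x = \<zero>\<^bsub>P\<^esub>) \<or> bij_betw (\<lambda>x. p \<odot>\<^bsub>P\<^esub> x) V V"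
  proof (rule kernel_image_dichotomy[OF End_center[OF p]])
    show "\<exists>y\<in>V. p \<odot>\<^bsub>P\<^esub> x = p \<odot>\<^bsub>P\<^esub> (p \<odot>\<^bsub>P\<^esub> y)" if x: "x \<in> V" for x
      using peq[OF x] center_smult_V[OF d x] by blast
    show "p \<odot>\<^bsub>P\<^esub> x = \<zero>\<^bsub>P\<^esub>" if x: "x \<in> V" and 0: "p \<odot>\<^bsub>P\<^esub> (p \<odot>\<^bsub>P\<^esub> x) = \<zero>\<^bsub>P\<^esub>" for x
    proof -
      have px: "p \<odot>\<^bsub>P\<^esub> x \<in> V" by (rule center_smult_V[OF p x])
      have "p \<odot>\<^bsub>P\<^esub> (p \<odot>\<^bsub>P\<^esub> (d \<odot>\<^bsub>P\<^esub> x)) = d \<odot>\<^bsub>P\<^esub> (p \<odot>\<^bsub>P\<^esub> (p \<odot>\<^bsub>P\<^esub> x))"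
        using EndD(3)[OF End_center[OF p] center_carrier[OF d] x]
          EndD(3)[OF End_center[OF p] center_carrier[OF d] px] by simp
      then show ?thesis using peq[OF x] 0 center_carrier[OF d] by simp
    qed
  qed
  then show ?thesis
  proof
    assume "\<forall>x\<in>V. p \<odot>\<^bsub>P\<^esub> x = \<zero>\<^bsub>P\<^esub>"
    then show ?thesis using pow unfolding p_def by auto
  next
    assume bij: "bij_betw (\<lambda>x. p \<odot>\<^bsub>P\<^esub> x) V V"
    obtain l where l: "n = Suc l" using n by (cases n) auto
    have inv: "(p \<otimes> d) \<odot>\<^bsub>P\<^esub> x = x" if x: "x \<in> V" for x
    proof (rule inj_onD[OF bij_betw_imp_inj_on[OF bij]])
      show "p \<odot>\<^bsub>P\<^esub> ((p \<otimes> d) \<odot>\<^bsub>P\<^esub> x) = p \<odot>\<^bsub>P\<^esub> x"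
        using peq[OF x] center_smult_assoc[OF p d x] by simp
    qed (use x center_smult_V[OF center_mult[OF p d] x] in auto)
    have "d \<otimes> a [^]\<^bsub>\<kk>\<^esub> l \<in> ring_center R" by (rule center_mult[OF d pc])
    moreover have "(d \<otimes> a [^]\<^bsub>\<kk>\<^esub> l) \<odot>\<^bsub>P\<^esub> (a \<odot>\<^bsub>P\<^esub> x) = x" if x: "x \<in> V" for x
    proof -
      have "(d \<otimes> a [^]\<^bsub>\<kk>\<^esub> l) \<otimes> a = d \<otimes> p"
        unfolding p_def l using m_assoc[OF center_carrier[OF d] center_carrier[OF pc] center_carrier[OF a]]
        by simp
      then have "(d \<otimes> a [^]\<^bsub>\<kk>\<^esub> l) \<otimes> a = p \<otimes> d"
        using center_comm[OF d center_carrier[OF p]] by simp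
      then show ?thesis
        using center_smult_assoc[OF center_mult[OF d pc[of l]] a x] inv[OF x] by simp
    qed
    ultimately show ?thesis using no_inv by blast
  qed
qed

lemma invertible_scalar_inj:
  assumes "a \<in> ring_center R" "a \<notin> \<mm>" "x \<in> V" "a \<odot>\<^bsub>P\<^esub> x = \<zero>\<^bsub>P\<^esub>"
  shows "x = \<zero>\<^bsub>P\<^esub>"
proof -
  obtain d where d: "d \<in> ring_center R" "\<forall>x\<in>V. d \<odot>\<^bsub>P\<^esub> (a \<odot>\<^bsub>P\<^esub> x) = x"
    using assms(1,2) by (auto simp: noninvertible_scalars_def)
  then have "d \<odot>\<^bsub>P\<^esub> (a \<odot>\<^bsub>P\<^esub> x) = x" using assms(3) by blast
  then show ?thesis using assms(4) center_carrier[OF d(1)] by simp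
qed

lemma noninvertible_mult:
  assumes a: "a \<in> ring_center R" and b: "b \<in> \<mm>"
  shows "a \<otimes> b \<in> \<mm>"
proof -
  have bc: "b \<in> ring_center R" using b by (simp add: noninvertible_scalars_def)
  have "\<not> (\<forall>x\<in>V. d \<odot>\<^bsub>P\<^esub> ((a \<otimes> b) \<odot>\<^bsub>P\<^esub> x) = x)" if d: "d \<in> ring_center R" for d
  proof
    assume inv: "\<forall>x\<in>V. d \<odot>\<^bsub>P\<^esub> ((a \<otimes> b) \<odot>\<^bsub>P\<^esub> x) = x"
    have "(d \<otimes> a) \<odot>\<^bsub>P\<^esub> (b \<odot>\<^bsub>P\<^esub> x) = x" if x: "x \<in> V" for x
      using bspec[OF inv x] center_smult_assoc[OF a bc x]
        center_smult_assoc[OF d a center_smult_V[OF bc x]] by simp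
    then show False using b center_mult[OF d a] unfolding noninvertible_scalars_def by blast
  qed
  then show ?thesis using center_mult[OF a bc] unfolding noninvertible_scalars_def by blast
qed

lemma noninvertible_if_annihilates:
  assumes "a \<in> ring_center R" "\<And>x. x \<in> V \<Longrightarrow> a \<odot>\<^bsub>P\<^esub> x = \<zero>\<^bsub>P\<^esub>"
  shows "a \<in> \<mm>"
proof -
  obtain x where x: "x \<in> V" "x \<noteq> \<zero>\<^bsub>P\<^esub>" using exists_nonzero by blast
  then have "d \<odot>\<^bsub>P\<^esub> (a \<odot>\<^bsub>P\<^esub> x) \<noteq> x" if "d \<in> ring_center R" for d
    using assms(2)[OF x(1)] center_carrier[OF that] by simp
  then show ?thesis using assms(1) x(1) unfolding noninvertible_scalars_def by blast
qed

lemma artinian_cring_maximal_ideal: "artinian_cring_maximal_ideal \<kk> \<mm>"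
proof -
  interpret K: artinian_cring \<kk> by (rule center_artinian_cring)
  interpret reg: left_module \<kk> "regular_module \<kk>" by (rule K.left_module_regular_module)
  have sub: "\<mm> \<subseteq> ring_center R" by (auto simp: noninvertible_scalars_def)
  have "submodule \<mm> \<kk> (regular_module \<kk>)"
  proof (rule reg.submoduleI)
    show "\<mm> \<subseteq> carrier (regular_module \<kk>)" using sub by (simp add: regular_module_def)
    show "\<zero>\<^bsub>regular_module \<kk>\<^esub> \<in> \<mm>"
      using noninvertible_if_annihilates[OF center_zero] VP by (simp add: regular_module_def)
    show "a \<odot>\<^bsub>regular_module \<kk>\<^esub> b \<in> \<mm>" if "a \<in> carrier \<kk>" "b \<in> \<mm>" for a b
      using noninvertible_mult[of a b] that by (simp add: regular_module_def)
    \<comment> \<open>If \<open>d\<close> inverted \<open>a + b\<close> on \<open>V\<close>, the identity would be the sum of the nilpotent maps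
      \<open>d a\<close> and \<open>d b\<close>.\<close>
    show "a \<oplus>\<^bsub>regular_module \<kk>\<^esub> b \<in> \<mm>" if a: "a \<in> \<mm>" and b: "b \<in> \<mm>" for a b
    proof (rule ccontr)
      have ac: "a \<in> ring_center R" and bc: "b \<in> ring_center R" using a b sub by blast+
      assume "a \<oplus>\<^bsub>regular_module \<kk>\<^esub> b \<notin> \<mm>"
      then have "a \<oplus> b \<notin> \<mm>" by (simp add: regular_module_def)
      then obtain d where d: "d \<in> ring_center R" "\<forall>x\<in>V. d \<odot>\<^bsub>P\<^esub> ((a \<oplus> b) \<odot>\<^bsub>P\<^esub> x) = x"
        using center_add[OF ac bc] unfolding noninvertible_scalars_def by blast
      have da: "d \<otimes> a \<in> \<mm>" and db: "d \<otimes> b \<in> \<mm>"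
        using noninvertible_mult[OF d(1)] a b by blast+
      then have dac: "d \<otimes> a \<in> ring_center R" and dbc: "d \<otimes> b \<in> ring_center R" using sub by blast+
      obtain m n where "\<forall>x\<in>V. ((\<lambda>x. (d \<otimes> a) \<odot>\<^bsub>P\<^esub> x) ^^ m) x = \<zero>\<^bsub>P\<^esub>"
        and "\<forall>x\<in>V. ((\<lambda>x. (d \<otimes> b) \<odot>\<^bsub>P\<^esub> x) ^^ n) x = \<zero>\<^bsub>P\<^esub>"
        using noninvertible_nilpotent[OF da] noninvertible_nilpotent[OF db] by blast
      then obtain x where x: "x \<in> V" "(d \<otimes> a) \<odot>\<^bsub>P\<^esub> x \<oplus>\<^bsub>P\<^esub> (d \<otimes> b) \<odot>\<^bsub>P\<^esub> x \<noteq> x"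
        using not_sum_of_nilpotents[OF End_center[OF dac] _ End_center[OF dbc], of m n] by blast
      have "d \<odot>\<^bsub>P\<^esub> ((a \<oplus> b) \<odot>\<^bsub>P\<^esub> x) = (d \<otimes> (a \<oplus> b)) \<odot>\<^bsub>P\<^esub> x"
        by (rule center_smult_assoc[OF d(1) center_add[OF ac bc] x(1), symmetric])
      also have "d \<otimes> (a \<oplus> b) = d \<otimes> a \<oplus> d \<otimes> b"
        by (rule r_distr[OF center_carrier[OF ac] center_carrier[OF bc] center_carrier[OF d(1)]])
      also have "(d \<otimes> a \<oplus> d \<otimes> b) \<odot>\<^bsub>P\<^esub> x = (d \<otimes> a) \<odot>\<^bsub>P\<^esub> x \<oplus>\<^bsub>P\<^esub> (d \<otimes> b) \<odot>\<^bsub>P\<^esub> x"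
        by (rule P.smult_l_distr[OF center_carrier[OF dac] center_carrier[OF dbc] VP[OF x(1)]])
      finally show False using x d(2) by simp
    qed
  qed
  then have 1: "ideal \<mm> \<kk>" by (rule K.ideal_of_submodule_regular_module)
  have "\<forall>x\<in>V. \<one> \<odot>\<^bsub>P\<^esub> (\<one> \<odot>\<^bsub>P\<^esub> x) = x" using VP by simp
  then have 2: "\<one>\<^bsub>\<kk>\<^esub> \<notin> \<mm>" using center_one unfolding noninvertible_scalars_def by auto
  have 3: "\<exists>d\<in>carrier \<kk>. \<exists>b\<in>\<mm>. d \<otimes>\<^bsub>\<kk>\<^esub> a = \<one>\<^bsub>\<kk>\<^esub> \<oplus>\<^bsub>\<kk>\<^esub> b" if ak: "a \<in> carrier \<kk>" and am: "a \<notin> \<mm>" for a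
  proof -
    have a: "a \<in> ring_center R" using ak by simp
    obtain d where d: "d \<in> ring_center R" "\<forall>x\<in>V. d \<odot>\<^bsub>P\<^esub> (a \<odot>\<^bsub>P\<^esub> x) = x"
      using a am unfolding noninvertible_scalars_def by blast
    have da: "d \<otimes> a \<in> ring_center R" by (rule center_mult[OF d(1) a])
    define b where "b = d \<otimes> a \<oplus> (\<ominus>\<^bsub>\<kk>\<^esub> \<one>)"
    have m1: "\<ominus>\<^bsub>\<kk>\<^esub> \<one> \<in> ring_center R" using K.add.inv_closed[of \<one>] center_one by simp
    have m1': "\<one> \<oplus> (\<ominus>\<^bsub>\<kk>\<^esub> \<one>) = \<zero>" using K.r_neg[of \<one>] center_one by simp
    have bc: "b \<in> ring_center R" unfolding b_def by (rule center_add[OF da m1])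
    have eq: "d \<otimes> a = \<one> \<oplus> b"
    proof -
      have "\<one> \<oplus> b = d \<otimes> a \<oplus> (\<one> \<oplus> (\<ominus>\<^bsub>\<kk>\<^esub> \<one>))"
        unfolding b_def using center_carrier[OF da] center_carrier[OF m1] by (simp only: a_lcomm one_closed)
      then show ?thesis unfolding m1' using center_carrier[OF da] by simp
    qed
    have "b \<odot>\<^bsub>P\<^esub> x = \<zero>\<^bsub>P\<^esub>" if x: "x \<in> V" for x
    proof -
      have bx: "b \<odot>\<^bsub>P\<^esub> x \<in> carrier P" by (rule VP[OF center_smult_V[OF bc x]])
      have "x = (d \<otimes> a) \<odot>\<^bsub>P\<^esub> x" using d(2) x center_smult_assoc[OF d(1) a x] by simp
      also have "\<dots> = x \<oplus>\<^bsub>P\<^esub> b \<odot>\<^bsub>P\<^esub> x"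
        unfolding eq using P.smult_l_distr[OF one_closed center_carrier[OF bc] VP[OF x]] VP[OF x] by simp
      finally have eqx: "x \<oplus>\<^bsub>P\<^esub> b \<odot>\<^bsub>P\<^esub> x = x" ..
      have "b \<odot>\<^bsub>P\<^esub> x = (b \<odot>\<^bsub>P\<^esub> x \<oplus>\<^bsub>P\<^esub> x) \<ominus>\<^bsub>P\<^esub> x"
        by (rule P.minus_add_cancel[OF bx VP[OF x], symmetric])
      also have "b \<odot>\<^bsub>P\<^esub> x \<oplus>\<^bsub>P\<^esub> x = x" using eqx P.M.a_comm[OF bx VP[OF x]] by simp
      finally show ?thesis using P.minus_self[OF VP[OF x]] by simp
    qed
    then have "b \<in> \<mm>" by (rule noninvertible_if_annihilates[OF bc])
    then show ?thesis using d(1) eq by auto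
  qed
  show ?thesis
    unfolding artinian_cring_maximal_ideal_def artinian_cring_maximal_ideal_axioms_def
    using center_artinian_cring 1 2 3 by blast
qed

lemma noninvertible_center: "a \<in> \<mm> \<Longrightarrow> a \<in> ring_center R"
  by (simp add: noninvertible_scalars_def)

lemma V_noetherian:
  assumes "submodule E \<kk> P" "E \<subseteq> V"
  shows "\<exists>F. finite F \<and> F \<subseteq> E \<and> submodule_generated \<kk> P F = E"
  by (rule artinian_cring_maximal_ideal.noetherian_in[OF artinian_cring_maximal_ideal P_center V_center V_artinian])
    (use assms invertible_scalar_inj in simp_all)

text \<open>
  The images of the powers of \<open>s\<close> become stationary because \<open>V\<close> is artinian, their kernels
  because the union of the kernels is finitely generated.
\<close>

lemma fitting_lemma:
  assumes s: "s \<in> End"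
  shows "(\<exists>n. \<forall>x\<in>V. (s ^^ n) x = \<zero>\<^bsub>P\<^esub>) \<or> bij_betw s V V"
proof -
  interpret Pk: left_module \<kk> P by (rule P_center)
  note sn = End_funpow[OF s]
  define I where "I n = (s ^^ n) ` V" for n
  define N where "N n = {x \<in> V. (s ^^ n) x \<in> {\<zero>\<^bsub>P\<^esub>}}" for n
  have pair: "left_module_map R (P\<lparr>carrier := V\<rparr>) (P\<lparr>carrier := V\<rparr>) (s ^^ n)" for n
    by (rule End_pair[OF sn])
  interpret Vm: left_module R "P\<lparr>carrier := V\<rparr>" by (rule V_module)
  have I: "submodule (I n) \<kk> P" for n
    using left_module_map.submodule_image[OF pair[of n] Vm.submodule_carrier]
    unfolding P.submodule_of_submodule[OF V_submodule] I_def
    using submodule_center[OF P.left_module_axioms] by simp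
  have N: "submodule (N n) \<kk> P" for n
    using left_module_map.submodule_preimage[OF pair[of n] Vm.submodule_zero Vm.submodule_carrier]
    unfolding P.submodule_of_submodule[OF V_submodule] N_def
    using submodule_center[OF P.left_module_axioms] by simp
  have N_mono: "N n \<subseteq> N (n + m)" for n m
    unfolding N_def using EndD(4)[OF sn[of m]] by (auto simp: add.commute[of n m] funpow_add)
  have "\<exists>n. \<forall>m\<ge>n. I m = I n"
  proof (rule artinian_in_chain[OF V_artinian I])
    show "I n \<subseteq> V" for n unfolding I_def using EndD(1)[OF sn] by blast
    show "I (Suc n) \<subseteq> I n" for n
      unfolding I_def using EndD(1)[OF s] by (auto simp: funpow_swap1 simp del: funpow.simps intro!: imageI)
        (metis funpow_swap1 funpow.simps(2) comp_apply image_eqI)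
  qed
  then obtain i where i: "\<forall>m\<ge>i. I m = I i" ..
  have "submodule (\<Union>n. N n) \<kk> P"
  proof (rule Pk.submodule_Union_chain)
    show "submodule H \<kk> P" if "H \<in> range N" for H using that N by blast
    show "H \<subseteq> K \<or> K \<subseteq> H" if HK: "H \<in> range N" "K \<in> range N" for H K
    proof -
      obtain m n where mn: "H = N m" "K = N n" using HK by blast
      show ?thesis
        using N_mono[of m "n - m"] N_mono[of n "m - n"] unfolding mn by (cases "m \<le> n") simp_all
    qed
  qed simp
  then obtain F where F: "finite F" "F \<subseteq> (\<Union>n. N n)" "submodule_generated \<kk> P F = (\<Union>n. N n)"
    using V_noetherian[of "\<Union>n. N n"] unfolding N_def by auto
  have "\<exists>n. F \<subseteq> N n"
    using F(1,2)
  proof (induction F rule: finite_induct)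
    case (insert x F)
    then obtain m n where mn: "F \<subseteq> N m" "x \<in> N n" by auto
    have "N m \<subseteq> N (m + n)" "N n \<subseteq> N (m + n)"
      using N_mono[of m n] N_mono[of n m] by (simp_all add: add.commute)
    then have "insert x F \<subseteq> N (m + n)" using mn by blast
    then show ?case ..
  qed simp
  then obtain j where j: "F \<subseteq> N j" ..
  have Nj: "N n \<subseteq> N j" for n
    using Pk.submodule_generated_minimal[OF N j] F(3) by blast
  \<comment> \<open>From here on images and kernels are stationary; \<open>Suc\<close> ensures that \<open>s\<close> is a factor of
    this power.\<close>
  define l where "l = Suc (i + j)"
  define t where "t = s ^^ l"
  have t: "t \<in> End" unfolding t_def by (rule sn)
  have tt: "t (t x) = (s ^^ (l + l)) x" for x unfolding t_def by (simp add: funpow_add)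
  have "(\<forall>x\<in>V. t x = \<zero>\<^bsub>P\<^esub>) \<or> bij_betw t V V"
  proof (rule kernel_image_dichotomy[OF t])
    fix x assume x: "x \<in> V"
    have "I l = I i" "I (l + l) = I i" by (rule i[rule_format], simp add: l_def)+
    then have "t x \<in> I (l + l)" using x unfolding t_def I_def by blast
    then obtain y where "y \<in> V" "t x = (s ^^ (l + l)) y" unfolding I_def by blast
    then show "\<exists>y\<in>V. t x = t (t y)" unfolding tt by blast
    assume "t (t x) = \<zero>\<^bsub>P\<^esub>"
    then have "x \<in> N (l + l)" unfolding tt N_def using x by simp
    then have "x \<in> N j" using Nj by blast
    moreover have "l = j + Suc i" unfolding l_def by simp
    ultimately have "x \<in> N l" using N_mono[of j "Suc i"] by (simp only:) blast
    then show "t x = \<zero>\<^bsub>P\<^esub>" unfolding t_def N_def by simp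
  qed
  then show ?thesis
  proof
    assume "\<forall>x\<in>V. t x = \<zero>\<^bsub>P\<^esub>"
    then show ?thesis unfolding t_def by blast
  next
    assume bij: "bij_betw t V V"
    define l' where "l' = i + j"
    have t1: "t x = (s ^^ l') (s x)" for x unfolding t_def l_def l'_def[symmetric] funpow_Suc_right by simp
    have t2: "t x = s ((s ^^ l') x)" for x unfolding t_def l_def l'_def[symmetric] by simp
    have "bij_betw s V V"
    proof (rule bij_if_trivial_kernel[OF s])
      fix x assume x: "x \<in> V" "s x = \<zero>\<^bsub>P\<^esub>"
      then have "t x = t \<zero>\<^bsub>P\<^esub>" using t1[of x] EndD(4)[OF sn[of l']] EndD(4)[OF t] by simp
      then show "x = \<zero>\<^bsub>P\<^esub>"
        using inj_onD[OF bij_betw_imp_inj_on[OF bij]] x(1) P.submoduleD(2)[OF V_submodule] by blast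
    next
      show "V \<subseteq> s ` V"
      proof
        fix x assume "x \<in> V"
        then obtain y where "y \<in> V" "x = t y" using bij_betw_imp_surj_on[OF bij] by blast
        then show "x \<in> s ` V" using t2[of y] EndD(1)[OF sn[of l'], of y] by simp
      qed
    qed
    then show ?thesis ..
  qed
qed

definition radical_End where "radical_End = {s \<in> End. \<not> bij_betw s V V}"

lemma End_inverse:
  assumes u: "u \<in> End" "bij_betw u V V"
  obtains v where "v \<in> End" "\<And>x. x \<in> V \<Longrightarrow> v (u x) = x" "\<And>x. x \<in> V \<Longrightarrow> u (v x) = x"
proof -
  define v where "v = inv_into V u"
  have uv: "u (v x) = x" and vV: "v x \<in> V" if "x \<in> V" for x
    unfolding v_def using that u(2) bij_betw_inv_into_right[of u V V x]
      bij_betw_apply[OF bij_betw_inv_into[OF u(2)], of x] by blast+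
  have vu: "v (u x) = x" if "x \<in> V" for x
    unfolding v_def using bij_betw_inv_into_left[OF u(2) that] .
  have "v \<in> End"
  proof (rule EndI)
    show "v x \<in> V" if "x \<in> V" for x by (rule vV[OF that])
    show "v (x \<oplus>\<^bsub>P\<^esub> y) = v x \<oplus>\<^bsub>P\<^esub> v y" if "x \<in> V" "y \<in> V" for x y
      using EndD(2)[OF u(1) vV[OF that(1)] vV[OF that(2)]]
        vu[OF P.submoduleD(3)[OF V_submodule vV[OF that(1)] vV[OF that(2)]]] uv that by simp
    show "v (a \<odot>\<^bsub>P\<^esub> x) = a \<odot>\<^bsub>P\<^esub> v x" if "a \<in> carrier R" "x \<in> V" for a x
      using EndD(3)[OF u(1) that(1) vV[OF that(2)]]
        vu[OF P.submoduleD(4)[OF V_submodule that(1) vV[OF that(2)]]] uv that by simp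
  qed
  then show thesis using that uv vu by blast
qed

lemma not_bij_comp:
  assumes s: "s \<in> End" "\<not> bij_betw s V V" and v: "v \<in> End" "u \<in> End"
    "\<And>x. x \<in> V \<Longrightarrow> u (v x) = x"  "\<And>x. x \<in> V \<Longrightarrow> v (u x) = x"
  shows "\<not> bij_betw (\<lambda>x. v (s x)) V V"
proof
  assume b: "bij_betw (\<lambda>x. v (s x)) V V"
  have bu: "bij_betw u V V"
    by (rule bij_betw_byWitness[of V v]) (use v EndD(1)[OF v(1)] EndD(1)[OF v(2)] in auto)
  have "bij_betw (u \<circ> (\<lambda>x. v (s x))) V V" by (rule bij_betw_trans[OF b bu])
  moreover have "(u \<circ> (\<lambda>x. v (s x))) x = s x" if "x \<in> V" for x
    using v(3)[OF EndD(1)[OF s(1) that]] by simp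
  ultimately have "bij_betw s V V" using bij_betw_cong[of V "u \<circ> (\<lambda>x. v (s x))" s V] by blast
  then show False using s(2) by blast
qed

lemma radical_End_add:
  assumes s: "s \<in> radical_End" and t: "t \<in> radical_End"
  shows "(\<lambda>x. s x \<oplus>\<^bsub>P\<^esub> t x) \<in> radical_End"
proof -
  have sE: "s \<in> End" "\<not> bij_betw s V V" and tE: "t \<in> End" "\<not> bij_betw t V V"
    using s t by (auto simp: radical_End_def)
  let ?u = "\<lambda>x. s x \<oplus>\<^bsub>P\<^esub> t x"
  have u: "?u \<in> End"
  proof (rule EndI)
    note sc = VP[OF EndD(1)[OF sE(1)]] and tc = VP[OF EndD(1)[OF tE(1)]]
    show "s x \<oplus>\<^bsub>P\<^esub> t x \<in> V" if "x \<in> V" for x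
      by (rule P.submoduleD(3)[OF V_submodule EndD(1)[OF sE(1) that] EndD(1)[OF tE(1) that]])
    show "s (x \<oplus>\<^bsub>P\<^esub> y) \<oplus>\<^bsub>P\<^esub> t (x \<oplus>\<^bsub>P\<^esub> y) = s x \<oplus>\<^bsub>P\<^esub> t x \<oplus>\<^bsub>P\<^esub> (s y \<oplus>\<^bsub>P\<^esub> t y)"
      if "x \<in> V" "y \<in> V" for x y
      unfolding EndD(2)[OF sE(1) that] EndD(2)[OF tE(1) that]
      using sc[OF that(1)] sc[OF that(2)] tc[OF that(1)] tc[OF that(2)]
      by (simp only: P.group_normalise)
    show "s (a \<odot>\<^bsub>P\<^esub> x) \<oplus>\<^bsub>P\<^esub> t (a \<odot>\<^bsub>P\<^esub> x) = a \<odot>\<^bsub>P\<^esub> (s x \<oplus>\<^bsub>P\<^esub> t x)"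
      if "a \<in> carrier R" "x \<in> V" for a x
      unfolding EndD(3)[OF sE(1) that] EndD(3)[OF tE(1) that]
      by (rule P.smult_r_distr[OF that(1) sc[OF that(2)] tc[OF that(2)], symmetric])
  qed
  have "\<not> bij_betw ?u V V"
  proof
    assume "bij_betw ?u V V"
    then obtain v where v: "v \<in> End" "\<And>x. x \<in> V \<Longrightarrow> v (?u x) = x" "\<And>x. x \<in> V \<Longrightarrow> ?u (v x) = x"
      using End_inverse[OF u] by blast
    have p: "(\<lambda>x. v (s x)) \<in> End" "\<not> bij_betw (\<lambda>x. v (s x)) V V"
      using End_comp[OF sE(1) v(1)] not_bij_comp[OF sE v(1) u v(3,2)] by blast+
    have q: "(\<lambda>x. v (t x)) \<in> End" "\<not> bij_betw (\<lambda>x. v (t x)) V V"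
      using End_comp[OF tE(1) v(1)] not_bij_comp[OF tE v(1) u v(3,2)] by blast+
    obtain m n where "\<forall>x\<in>V. ((\<lambda>x. v (s x)) ^^ m) x = \<zero>\<^bsub>P\<^esub>" "\<forall>x\<in>V. ((\<lambda>x. v (t x)) ^^ n) x = \<zero>\<^bsub>P\<^esub>"
      using fitting_lemma[OF p(1)] fitting_lemma[OF q(1)] p(2) q(2) by blast
    then obtain x where x: "x \<in> V" "v (s x) \<oplus>\<^bsub>P\<^esub> v (t x) \<noteq> x"
      using not_sum_of_nilpotents[OF p(1) _ q(1), of m n] by blast
    then show False
      using v(2)[OF x(1)] EndD(2)[OF v(1) EndD(1)[OF sE(1) x(1)] EndD(1)[OF tE(1) x(1)]] by simp
  qed
  then show ?thesis using u unfolding radical_End_def by blast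
qed

lemma radical_End_center:
  assumes a: "a \<in> ring_center R" and s: "s \<in> radical_End"
  shows "(\<lambda>x. a \<odot>\<^bsub>P\<^esub> s x) \<in> radical_End"
proof -
  have sE: "s \<in> End" "\<not> bij_betw s V V" using s by (auto simp: radical_End_def)
  have aE: "(\<lambda>x. a \<odot>\<^bsub>P\<^esub> s x) \<in> End" by (rule End_comp[OF sE(1) End_center[OF a]])
  have "\<not> bij_betw (\<lambda>x. a \<odot>\<^bsub>P\<^esub> s x) V V"
  proof
    assume b: "bij_betw (\<lambda>x. a \<odot>\<^bsub>P\<^esub> s x) V V"
    have "bij_betw s V V"
    proof (rule bij_if_trivial_kernel[OF sE(1)])
      fix x assume x: "x \<in> V" "s x = \<zero>\<^bsub>P\<^esub>"
      then have "a \<odot>\<^bsub>P\<^esub> s x = a \<odot>\<^bsub>P\<^esub> s \<zero>\<^bsub>P\<^esub>" using EndD(4)[OF sE(1)] by simp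
      then show "x = \<zero>\<^bsub>P\<^esub>"
        using inj_onD[OF bij_betw_imp_inj_on[OF b]] x(1) P.submoduleD(2)[OF V_submodule] by blast
    next
      show "V \<subseteq> s ` V"
      proof
        fix x assume "x \<in> V"
        then obtain y where y: "y \<in> V" "x = a \<odot>\<^bsub>P\<^esub> s y" using bij_betw_imp_surj_on[OF b] by blast
        then have "x = s (a \<odot>\<^bsub>P\<^esub> y)" using EndD(3)[OF sE(1) center_carrier[OF a] y(1)] by simp
        then show "x \<in> s ` V" using center_smult_V[OF a y(1)] by blast
      qed
    qed
    then show False using sE(2) by blast
  qed
  then show ?thesis using aE unfolding radical_End_def by blast
qed

lemma radical_End_noninvertible:
  assumes a: "a \<in> \<mm>"
  shows "(\<lambda>x. a \<odot>\<^bsub>P\<^esub> x) \<in> radical_End"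
proof -
  have E: "(\<lambda>x. a \<odot>\<^bsub>P\<^esub> x) \<in> End" by (rule End_center[OF noninvertible_center[OF a]])
  obtain n where n: "\<forall>x\<in>V. ((\<lambda>x. a \<odot>\<^bsub>P\<^esub> x) ^^ n) x = \<zero>\<^bsub>P\<^esub>"
    using noninvertible_nilpotent[OF a] ..
  obtain x where x: "x \<in> V" "x \<noteq> \<zero>\<^bsub>P\<^esub>" "a \<odot>\<^bsub>P\<^esub> x = \<zero>\<^bsub>P\<^esub>"
    using nilpotent_kernel[OF E, of n] n by blast
  have "\<not> inj_on (\<lambda>x. a \<odot>\<^bsub>P\<^esub> x) V"
    using x inj_onD[of "\<lambda>x. a \<odot>\<^bsub>P\<^esub> x" V x "\<zero>\<^bsub>P\<^esub>"] P.submoduleD(2)[OF V_submodule]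
      P.smult_zero_right[OF center_carrier[OF noninvertible_center[OF a]]] by auto
  then show ?thesis using E unfolding radical_End_def bij_betw_def by blast
qed

text \<open>
  The scalar \<open>e\<close> generates an ideal that is minimal among the principal ideals not contained in
  \<open>\<mm>\<close>, and is normalized so as to act on \<open>V\<close> as the identity. Multiplication by \<open>e\<close> singles out
  the part of \<open>R\<close> on which the scalars outside \<open>\<mm>\<close> are invertible. There the lemmas \<open>hyperplane\<close>
  and \<open>noetherian_in\<close> apply, and nothing that matters for \<open>V\<close> is lost.
\<close>

lemma localizing_scalar:
  "\<exists>e\<in>ring_center R. (\<forall>x\<in>V. e \<odot>\<^bsub>P\<^esub> x = x) \<and>
    (\<forall>a\<in>ring_center R. a \<notin> \<mm> \<longrightarrow> (\<exists>d\<in>ring_center R. d \<otimes> (a \<otimes> e) = e))"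
proof -
  interpret K: artinian_cring_maximal_ideal \<kk> \<mm> by (rule artinian_cring_maximal_ideal)
  interpret reg: left_module \<kk> "regular_module \<kk>" by (rule K.left_module_regular_module)
  let ?m = "\<lambda>e. (\<lambda>b. b \<otimes> e) ` ring_center R"
  have sub: "submodule (?m e) \<kk> (regular_module \<kk>)" if "e \<in> ring_center R" for e
    using reg.submodule_multiples[of e] that by (simp add: regular_module_def)
  obtain G where "\<exists>e\<in>ring_center R. e \<notin> \<mm> \<and> G = ?m e"
    and Gmin: "\<And>G'. \<exists>e\<in>ring_center R. e \<notin> \<mm> \<and> G' = ?m e \<Longrightarrow> G' \<subseteq> G \<Longrightarrow> G' = G"
  proof (rule artinian_in_minimal[OF K.artinian_in_regular_module,
        of "\<lambda>G. \<exists>e\<in>ring_center R. e \<notin> \<mm> \<and> G = ?m e" "?m \<one>"])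
    show "\<exists>e\<in>ring_center R. e \<notin> \<mm> \<and> ?m \<one> = ?m e" using K.one_notin_\<mm> center_one by auto
    show "submodule G \<kk> (regular_module \<kk>) \<and> G \<subseteq> carrier \<kk>"
      if "\<exists>e\<in>ring_center R. e \<notin> \<mm> \<and> G = ?m e" for G
      using that sub reg.submoduleD(1)[of G] by (auto simp: regular_module_def)
  qed blast
  then obtain e1 where e1: "e1 \<in> ring_center R" "e1 \<notin> \<mm>" "G = ?m e1" by blast
  obtain d0 where d0: "d0 \<in> ring_center R" "\<forall>x\<in>V. d0 \<odot>\<^bsub>P\<^esub> (e1 \<odot>\<^bsub>P\<^esub> x) = x"
    using e1(1,2) unfolding noninvertible_scalars_def by blast
  define e where "e = d0 \<otimes> e1"
  have e: "e \<in> ring_center R" unfolding e_def by (rule center_mult[OF d0(1) e1(1)])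
  have "\<exists>d\<in>ring_center R. d \<otimes> (a \<otimes> e) = e" if a: "a \<in> ring_center R" "a \<notin> \<mm>" for a
  proof -
    have ae: "a \<otimes> e1 \<in> ring_center R" by (rule center_mult[OF a(1) e1(1)])
    obtain d where d: "d \<in> ring_center R" "\<forall>x\<in>V. d \<odot>\<^bsub>P\<^esub> (a \<odot>\<^bsub>P\<^esub> x) = x"
      using a unfolding noninvertible_scalars_def by blast
    have "(d0 \<otimes> d) \<odot>\<^bsub>P\<^esub> ((a \<otimes> e1) \<odot>\<^bsub>P\<^esub> x) = x" if x: "x \<in> V" for x
      using center_smult_assoc[OF a(1) e1(1) x]
        center_smult_assoc[OF d0(1) d(1) center_smult_V[OF ae x]] d(2) d0(2) center_smult_V[OF e1(1) x] x
      by simp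
    then have "a \<otimes> e1 \<notin> \<mm>" using center_mult[OF d0(1) d(1)] unfolding noninvertible_scalars_def by blast
    moreover have "?m (a \<otimes> e1) \<subseteq> ?m e1"
    proof
      fix y assume "y \<in> ?m (a \<otimes> e1)"
      then obtain b where b: "b \<in> ring_center R" "y = b \<otimes> (a \<otimes> e1)" by blast
      then have "y = (b \<otimes> a) \<otimes> e1"
        using m_assoc[OF center_carrier[OF b(1)] center_carrier[OF a(1)] center_carrier[OF e1(1)]] by simp
      then show "y \<in> ?m e1" using center_mult[OF b(1) a(1)] by blast
    qed
    ultimately have "?m (a \<otimes> e1) = ?m e1" using Gmin[of "?m (a \<otimes> e1)"] ae e1(3) by blast
    moreover have "e1 \<in> ?m e1" by (rule image_eqI[of _ _ \<one>]) (simp_all add: center_one center_carrier[OF e1(1)])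
    ultimately obtain b where b: "b \<in> ring_center R" "e1 = b \<otimes> (a \<otimes> e1)" by blast
    note c = center_carrier[OF a(1)] center_carrier[OF b(1)] center_carrier[OF e1(1)] center_carrier[OF d0(1)]
    have "b \<otimes> (a \<otimes> e) = (b \<otimes> a) \<otimes> (d0 \<otimes> e1)" unfolding e_def using c by (simp add: m_assoc)
    also have "\<dots> = (d0 \<otimes> e1) \<otimes> (b \<otimes> a)"
      by (rule center_comm[OF center_mult[OF b(1) a(1)] center_carrier[OF e[unfolded e_def]]])
    also have "\<dots> = d0 \<otimes> (e1 \<otimes> (b \<otimes> a))" using c by (simp add: m_assoc)
    also have "e1 \<otimes> (b \<otimes> a) = (b \<otimes> a) \<otimes> e1"
      using center_comm[OF center_mult[OF b(1) a(1)] c(3)] by simp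
    also have "(b \<otimes> a) \<otimes> e1 = e1" using b(2) c by (simp add: m_assoc)
    finally show ?thesis using b(1) unfolding e_def by blast
  qed
  moreover have "e \<odot>\<^bsub>P\<^esub> x = x" if x: "x \<in> V" for x
    unfolding e_def using center_smult_assoc[OF d0(1) e1(1) x] d0(2) x by simp
  ultimately show ?thesis using e by blast
qed

end

section \<open>Tuples and their coefficients\<close>

lemma product_module_UNIV:
  "carrier (product_module UNIV M) = {x. \<forall>i. x i \<in> carrier (M i)}"
  "\<zero>\<^bsub>product_module UNIV M\<^esub> = (\<lambda>i. \<zero>\<^bsub>M i\<^esub>)"
  "x \<oplus>\<^bsub>product_module UNIV M\<^esub> y = (\<lambda>i. x i \<oplus>\<^bsub>M i\<^esub> y i)"
  "a \<odot>\<^bsub>product_module UNIV M\<^esub> x = (\<lambda>i. a \<odot>\<^bsub>M i\<^esub> x i)"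
  by (auto simp: product_module_def)

lemma regular_module_simps:
  "carrier (regular_module R) = carrier R" "\<zero>\<^bsub>regular_module R\<^esub> = \<zero>\<^bsub>R\<^esub>"
  "a \<oplus>\<^bsub>regular_module R\<^esub> b = a \<oplus>\<^bsub>R\<^esub> b" "a \<odot>\<^bsub>regular_module R\<^esub> b = a \<otimes>\<^bsub>R\<^esub> b"
  by (simp_all add: regular_module_def)

lemma product_module_UNIV_coordinate_hom:
  assumes "ring R" "\<And>i. left_module R (M i)"
  shows "left_module_map R (product_module UNIV M) (M i) (\<lambda>x. x i)"
proof -
  have "(\<lambda>x. x i) \<in> left_module_hom R (product_module UNIV M) (M i)"
    by (rule left_module_homI) (auto simp: product_module_UNIV)
  then show ?thesis
    using left_module_product_module[OF assms(1), of UNIV M] assms(2)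
    by (simp add: left_module_mapI)
qed

definition component_vector where
  "component_vector M n x = (\<lambda>j. if j = n then x else \<zero>\<^bsub>M j\<^esub>)"

lemma component_vector_hom:
  assumes M: "\<And>i. left_module R (M i)"
  shows "component_vector M n \<in> left_module_hom R (M n) (product_module UNIV M)"
proof (rule left_module_homI)
  show "component_vector M n x \<in> carrier (product_module UNIV M)" if "x \<in> carrier (M n)" for x
    unfolding product_module_UNIV(1) component_vector_def
    using left_module.zero_in_carrier[OF M] that by simp
  show "component_vector M n (x \<oplus>\<^bsub>M n\<^esub> y)
      = component_vector M n x \<oplus>\<^bsub>product_module UNIV M\<^esub> component_vector M n y" for x y
    unfolding product_module_UNIV(3) component_vector_def
    using left_module.zero_add_zero[OF M] by (intro ext) simp
  show "component_vector M n (a \<odot>\<^bsub>M n\<^esub> x)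
      = a \<odot>\<^bsub>product_module UNIV M\<^esub> component_vector M n x" if "a \<in> carrier R" for a x
    unfolding product_module_UNIV(4) component_vector_def
    using left_module.smult_zero_right[OF M that] by (intro ext) simp
qed

lemma product_module_UNIV_minus:
  assumes "ring R" "\<And>i. left_module R (M i)"
    and x: "x \<in> carrier (product_module UNIV M)" "y \<in> carrier (product_module UNIV M)"
  shows "x \<ominus>\<^bsub>product_module UNIV M\<^esub> y = (\<lambda>i. x i \<ominus>\<^bsub>M i\<^esub> y i)"
proof
  fix i
  interpret i: left_module_map R "product_module UNIV M" "M i" "\<lambda>x. x i"
    by (rule product_module_UNIV_coordinate_hom[OF assms(1,2)])
  show "(x \<ominus>\<^bsub>product_module UNIV M\<^esub> y) i = x i \<ominus>\<^bsub>M i\<^esub> y i" by (rule i.hom_diff[OF x])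
qed

locale localized_submodule = indecomposable_submodule +
  fixes e
  assumes e_center: "e \<in> ring_center R" and e_V: "\<And>x. x \<in> V \<Longrightarrow> e \<odot>\<^bsub>P\<^esub> x = x"
    and e_local: "\<And>a. \<lbrakk>a \<in> ring_center R; a \<notin> \<mm>\<rbrakk> \<Longrightarrow> \<exists>d\<in>ring_center R. d \<otimes> (a \<otimes> e) = e"
begin

abbreviation Coeffs where "Coeffs \<equiv> product_module UNIV (\<lambda>_ :: nat. regular_module R)"
text \<open>
  Two kinds of tuples are kept in one module. The entries at \<open>(False, j)\<close> are coordinates in \<open>V\<close>,
  those at \<open>(True, j)\<close> are coordinates in the target of a homomorphism on \<open>V\<close>. Both are later
  compared modulo one submodule, which plays the role of a common range of linear forms.
\<close>

abbreviation Vecs where "Vecs \<equiv> product_module UNIV (\<lambda>_ :: bool \<times> nat. P)"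

lemma center_ring: "ring \<kk>"
  using artinian_cring.axioms(1)[OF center_artinian_cring] by (simp add: cring_def)

lemma Coeffs_module: "left_module \<kk> Coeffs"
  by (rule left_module_product_module[OF center_ring left_module_center_regular])

lemma Vecs_module: "left_module \<kk> Vecs"
  by (rule left_module_product_module[OF center_ring P_center])

sublocale Coeffs: left_module \<kk> Coeffs by (rule Coeffs_module)
sublocale Vecs: left_module \<kk> Vecs by (rule Vecs_module)

lemmas Vecs_simps = product_module_UNIV[where M = "\<lambda>_ :: bool \<times> nat. P"]
lemma Coeffs_simps:
  "carrier Coeffs = {x. \<forall>i. x i \<in> carrier R}"
  "\<zero>\<^bsub>Coeffs\<^esub> = (\<lambda>i. \<zero>)"
  "x \<oplus>\<^bsub>Coeffs\<^esub> y = (\<lambda>i. x i \<oplus> y i)"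
  "a \<odot>\<^bsub>Coeffs\<^esub> x = (\<lambda>i. a \<otimes> x i)"
  unfolding product_module_UNIV by (simp_all add: regular_module_def)

lemma Vecs_minus: "x \<in> carrier Vecs \<Longrightarrow> y \<in> carrier Vecs \<Longrightarrow> (x \<ominus>\<^bsub>Vecs\<^esub> y) i = x i \<ominus>\<^bsub>P\<^esub> y i"
  using product_module_UNIV_minus[OF center_ring P_center, of x y] by (rule fun_cong)

definition vec :: "bool \<Rightarrow> (nat \<Rightarrow> 'c) \<Rightarrow> bool \<times> nat \<Rightarrow> 'c"
  where "vec b w = (\<lambda>i. if fst i = b then w (snd i) else \<zero>\<^bsub>P\<^esub>)"

text \<open>
  The image of \<open>c \<otimes> x\<close> in the power of \<open>P\<close>, where \<open>c\<close> is a tuple of ring elements.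
\<close>

definition tensor :: "bool \<Rightarrow> (nat \<Rightarrow> 'a) \<Rightarrow> 'c \<Rightarrow> bool \<times> nat \<Rightarrow> 'c" where "tensor b c x = vec b (\<lambda>j. c j \<odot>\<^bsub>P\<^esub> x)"

text \<open>
  The right module \<open>(eR)\<^sup>q\<close>, padded with zeros.
\<close>

definition coeffs :: "nat \<Rightarrow> (nat \<Rightarrow> 'a) set" where
  "coeffs q = {c. \<forall>j. (j < q \<longrightarrow> (\<exists>r\<in>carrier R. c j = e \<otimes> r)) \<and> (j \<ge> q \<longrightarrow> c j = \<zero>)}"

definition vecs :: "nat \<Rightarrow> (bool \<times> nat \<Rightarrow> 'c) set" where
  "vecs q = {v. \<forall>j. v (True, j) = \<zero>\<^bsub>P\<^esub> \<and> (j < q \<longrightarrow> v (False, j) \<in> V) \<and> (j \<ge> q \<longrightarrow> v (False, j) = \<zero>\<^bsub>P\<^esub>)}"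

definition unit_coeff :: "nat \<Rightarrow> nat \<Rightarrow> 'a" where "unit_coeff t = (\<lambda>j. if j = t then e else \<zero>)"

lemma coeffs_carrier: "c \<in> coeffs q \<Longrightarrow> c j \<in> carrier R"
  unfolding coeffs_def using center_carrier[OF e_center] by (cases "j < q") (auto simp: not_less)

lemma coeffs_subset: "coeffs q \<subseteq> carrier Coeffs"
  using coeffs_carrier by (auto simp: Coeffs_simps)

lemma coeffs_submodule: "submodule (coeffs q) \<kk> Coeffs"
proof (rule Coeffs.submoduleI[OF coeffs_subset])
  note ec = center_carrier[OF e_center]
  have "\<zero> = e \<otimes> \<zero>" using ec by simp
  then show "\<zero>\<^bsub>Coeffs\<^esub> \<in> coeffs q" unfolding coeffs_def Coeffs_simps using zero_closed by blast
  show "c \<oplus>\<^bsub>Coeffs\<^esub> d \<in> coeffs q" if c: "c \<in> coeffs q" "d \<in> coeffs q" for c d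
    unfolding coeffs_def Coeffs_simps
  proof (intro CollectI allI conjI impI)
    fix j assume "j < q"
    then obtain r s where rs: "r \<in> carrier R" "c j = e \<otimes> r" "s \<in> carrier R" "d j = e \<otimes> s"
      using c unfolding coeffs_def by blast
    then have "c j \<oplus> d j = e \<otimes> (r \<oplus> s)" using r_distr[OF rs(1,3) ec] by simp
    then show "\<exists>r\<in>carrier R. c j \<oplus> d j = e \<otimes> r" using add.m_closed[OF rs(1,3)] by blast
  next
    fix j assume "q \<le> j"
    then have "c j = \<zero>" "d j = \<zero>" using c unfolding coeffs_def by blast+
    then show "c j \<oplus> d j = \<zero>" by simp
  qed
  show "a \<odot>\<^bsub>Coeffs\<^esub> c \<in> coeffs q" if a: "a \<in> carrier \<kk>" and c: "c \<in> coeffs q" for a c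
    unfolding coeffs_def Coeffs_simps
  proof (intro CollectI allI conjI impI)
    have ac: "a \<in> ring_center R" using a by simp
    fix j assume "j < q"
    then obtain r where rs: "r \<in> carrier R" "c j = e \<otimes> r"
      using c unfolding coeffs_def by blast
    have "a \<otimes> (e \<otimes> r) = e \<otimes> (a \<otimes> r)"
      using m_assoc[OF center_carrier[OF ac] ec rs(1)] m_assoc[OF ec center_carrier[OF ac] rs(1)]
        center_comm[OF ac ec] by simp
    then show "\<exists>r\<in>carrier R. a \<otimes> c j = e \<otimes> r"
      using rs m_closed[OF center_carrier[OF ac] rs(1)] by auto
  next
    fix j assume "q \<le> j"
    then have "c j = \<zero>" using c unfolding coeffs_def by blast
    then show "a \<otimes> c j = \<zero>" using center_carrier[of a] a by simp
  qed
qed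

lemma coeffs_mult_right:
  assumes c: "c \<in> coeffs q" and r: "r \<in> carrier R"
  shows "(\<lambda>j. c j \<otimes> r) \<in> coeffs q"
  unfolding coeffs_def
proof (intro CollectI allI conjI impI)
  fix j assume "j < q"
  then obtain s where s: "s \<in> carrier R" "c j = e \<otimes> s" using c unfolding coeffs_def by blast
  then have "c j \<otimes> r = e \<otimes> (s \<otimes> r)" using m_assoc[OF center_carrier[OF e_center] s(1) r] by simp
  then show "\<exists>s\<in>carrier R. c j \<otimes> r = e \<otimes> s" using m_closed[OF s(1) r] by blast
next
  fix j assume "q \<le> j"
  then have "c j = \<zero>" using c unfolding coeffs_def by blast
  then show "c j \<otimes> r = \<zero>" using r by simp
qed

lemma coeffs_mono: "q \<le> q' \<Longrightarrow> coeffs q \<subseteq> coeffs q'"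
proof
  fix c assume q: "q \<le> q'" and c: "c \<in> coeffs q"
  show "c \<in> coeffs q'" unfolding coeffs_def
  proof (intro CollectI allI conjI impI)
    fix j assume "j < q'"
    show "\<exists>r\<in>carrier R. c j = e \<otimes> r"
    proof (cases "j < q")
      case True then show ?thesis using c unfolding coeffs_def by blast
    next
      case False
      then have "c j = e \<otimes> \<zero>" using c center_carrier[OF e_center] unfolding coeffs_def by (simp add: not_less)
      then show ?thesis using zero_closed by blast
    qed
  next
    fix j assume "q' \<le> j" then show "c j = \<zero>" using c q unfolding coeffs_def by simp
  qed
qed

lemma unit_coeff_in: "t < q \<Longrightarrow> unit_coeff t \<in> coeffs q"
  unfolding coeffs_def unit_coeff_def
proof (intro CollectI allI conjI impI)
  fix j
  have "(if j = t then e else \<zero>) = e \<otimes> (if j = t then \<one> else \<zero>)"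
    using center_carrier[OF e_center] by simp
  moreover have "(if j = t then \<one> else \<zero>) \<in> carrier R" by simp
  ultimately show "\<exists>r\<in>carrier R. (if j = t then e else \<zero>) = e \<otimes> r" by blast
qed auto

lemma coeffs_artinian: "artinian_in \<kk> Coeffs (coeffs q)"
proof (induction q)
  case 0
  have "coeffs 0 \<subseteq> {\<zero>\<^bsub>Coeffs\<^esub>}" unfolding coeffs_def Coeffs_simps by auto
  then show ?case using artinian_in_subset[OF Coeffs.artinian_in_zero] by blast
next
  case (Suc q)
  note ec = center_carrier[OF e_center]
  define \<phi> where "\<phi> r = (\<lambda>j. if j = q then e \<otimes> r else \<zero>)" for r
  have "\<phi> \<in> left_module_hom \<kk> (regular_module R) Coeffs"
  proof (rule left_module_homI)
    show "\<phi> r \<in> carrier Coeffs" if "r \<in> carrier (regular_module R)" for r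
      using that ec by (auto simp: \<phi>_def Coeffs_simps regular_module_simps)
    show "\<phi> (r \<oplus>\<^bsub>regular_module R\<^esub> s) = \<phi> r \<oplus>\<^bsub>Coeffs\<^esub> \<phi> s"
      if "r \<in> carrier (regular_module R)" "s \<in> carrier (regular_module R)" for r s
      using that r_distr[OF _ _ ec] by (auto simp: \<phi>_def Coeffs_simps regular_module_simps)
    show "\<phi> (a \<odot>\<^bsub>regular_module R\<^esub> r) = a \<odot>\<^bsub>Coeffs\<^esub> \<phi> r"
      if "a \<in> carrier \<kk>" "r \<in> carrier (regular_module R)" for a r
    proof -
      have a: "a \<in> ring_center R" and r: "r \<in> carrier R" using that by (simp_all add: regular_module_simps)
      have "e \<otimes> (a \<otimes> r) = a \<otimes> (e \<otimes> r)"
        using m_assoc[OF center_carrier[OF a] ec r] m_assoc[OF ec center_carrier[OF a] r]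
          center_comm[OF a ec] by simp
      then show ?thesis
        using center_carrier[OF a] by (auto simp: \<phi>_def Coeffs_simps regular_module_simps)
    qed
  qed
  then interpret \<phi>: left_module_map \<kk> "regular_module R" Coeffs \<phi>
    using left_module_center_regular Coeffs_module
    by (simp add: left_module_mapI)
  have "coeffs (Suc q) \<subseteq> coeffs q <+>\<^bsub>Coeffs\<^esub> \<phi> ` carrier (regular_module R)"
  proof
    fix c assume c: "c \<in> coeffs (Suc q)"
    then obtain r where r: "r \<in> carrier R" "c q = e \<otimes> r" unfolding coeffs_def by blast
    define d where "d = (\<lambda>j. if j < q then c j else \<zero>)"
    have "d \<in> coeffs q" using c unfolding coeffs_def d_def by auto
    moreover have "c = d \<oplus>\<^bsub>Coeffs\<^esub> \<phi> r"
    proof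
      fix j
      have cj: "c j \<in> carrier R" by (rule coeffs_carrier[OF c])
      consider "j < q" | "j = q" | "j \<ge> Suc q" by linarith
      then show "c j = (d \<oplus>\<^bsub>Coeffs\<^esub> \<phi> r) j"
      proof cases
        case 3
        then have "c j = \<zero>" using c unfolding coeffs_def by blast
        then show ?thesis using 3 by (simp add: Coeffs_simps d_def \<phi>_def)
      qed (use cj r ec in \<open>simp_all add: Coeffs_simps d_def \<phi>_def\<close>)
    qed
    moreover have "\<phi> r \<in> \<phi> ` carrier (regular_module R)" using r(1) by (simp add: regular_module_simps)
    ultimately show "c \<in> coeffs q <+>\<^bsub>Coeffs\<^esub> \<phi> ` carrier (regular_module R)"
      unfolding Coeffs.set_add_iff by blast
  qed
  moreover have "artinian_in \<kk> Coeffs (coeffs q <+>\<^bsub>Coeffs\<^esub> \<phi> ` carrier (regular_module R))"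
    by (rule \<phi>.artinian_in_set_add_image[OF coeffs_submodule Suc])
      (use artinian_in_center_regular in \<open>simp add: regular_module_simps\<close>)
  ultimately show ?case using artinian_in_subset by blast
qed

lemma coeffs_inj:
  assumes a: "a \<in> ring_center R" "a \<notin> \<mm>" and c: "c \<in> coeffs q" and 0: "a \<odot>\<^bsub>Coeffs\<^esub> c = \<zero>\<^bsub>Coeffs\<^esub>"
  shows "c = \<zero>\<^bsub>Coeffs\<^esub>"
proof
  fix j
  note ec = center_carrier[OF e_center] and ac = center_carrier[OF a(1)]
  obtain d where d: "d \<in> ring_center R" "d \<otimes> (a \<otimes> e) = e" using e_local[OF a] by blast
  have ac0: "a \<otimes> c j = \<zero>" using fun_cong[OF 0, of j] by (simp add: Coeffs_simps)
  show "c j = \<zero>\<^bsub>Coeffs\<^esub> j"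
  proof (cases "j < q")
    case True
    then obtain r where r: "r \<in> carrier R" "c j = e \<otimes> r" using c unfolding coeffs_def by blast
    have "c j = (d \<otimes> (a \<otimes> e)) \<otimes> r" using d(2) r(2) by simp
    also have "\<dots> = d \<otimes> (a \<otimes> c j)"
      unfolding r(2) using m_assoc[OF center_carrier[OF d(1)] m_closed[OF ac ec] r(1)] m_assoc[OF ac ec r(1)]
      by simp
    finally show ?thesis using ac0 center_carrier[OF d(1)] by (simp add: Coeffs_simps)
  next
    case False
    then show ?thesis using c unfolding coeffs_def by (simp add: Coeffs_simps)
  qed
qed

text \<open>
  This makes the isolating system finite: the coefficients on which a linear form vanishes are
  generated by finitely many columns.
\<close>

lemma coeffs_noetherian:
  assumes "submodule C \<kk> Coeffs" "C \<subseteq> coeffs q"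
  shows "\<exists>F. finite F \<and> F \<subseteq> C \<and> submodule_generated \<kk> Coeffs F = C"
  by (rule artinian_cring_maximal_ideal.noetherian_in[OF artinian_cring_maximal_ideal Coeffs_module
        coeffs_submodule coeffs_artinian _ assms])
    (use coeffs_inj in simp)

lemma vec_carrier: "(\<And>j. w j \<in> carrier P) \<Longrightarrow> vec b w \<in> carrier Vecs"
  by (simp add: Vecs_simps vec_def)

lemma vec_eq_zero: "vec b (\<lambda>j. \<zero>\<^bsub>P\<^esub>) = \<zero>\<^bsub>Vecs\<^esub>"
  by (simp add: Vecs_simps vec_def)

lemma vec_add: "vec b w \<oplus>\<^bsub>Vecs\<^esub> vec b w' = vec b (\<lambda>j. w j \<oplus>\<^bsub>P\<^esub> w' j)"
  by (rule ext) (simp add: Vecs_simps vec_def)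

lemma vec_smult: "a \<in> carrier R \<Longrightarrow> a \<odot>\<^bsub>Vecs\<^esub> vec b w = vec b (\<lambda>j. a \<odot>\<^bsub>P\<^esub> w j)"
  by (rule ext) (simp add: Vecs_simps vec_def)

lemma tensor_carrier: "c \<in> carrier Coeffs \<Longrightarrow> x \<in> carrier P \<Longrightarrow> tensor b c x \<in> carrier Vecs"
  unfolding tensor_def by (rule vec_carrier) (simp add: Coeffs_simps)

lemma tensor_hom_left:
  assumes x: "x \<in> carrier P"
  shows "(\<lambda>c. tensor b c x) \<in> left_module_hom \<kk> Coeffs Vecs"
proof (rule left_module_homI)
  fix c assume c: "c \<in> carrier Coeffs"
  show "tensor b c x \<in> carrier Vecs" by (rule tensor_carrier[OF c x])
  show "tensor b (c \<oplus>\<^bsub>Coeffs\<^esub> d) x = tensor b c x \<oplus>\<^bsub>Vecs\<^esub> tensor b d x" if "d \<in> carrier Coeffs" for d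
    using that c x P.smult_l_distr unfolding tensor_def vec_add by (simp add: Coeffs_simps)
  show "tensor b (a \<odot>\<^bsub>Coeffs\<^esub> c) x = a \<odot>\<^bsub>Vecs\<^esub> tensor b c x" if "a \<in> carrier \<kk>" for a
    using that c x P.smult_assoc1[OF center_carrier[of a]] vec_smult[OF center_carrier[of a]]
    unfolding tensor_def by (simp add: Coeffs_simps)
qed

lemma tensor_hom_right:
  assumes c: "c \<in> carrier Coeffs"
  shows "tensor b c \<in> left_module_hom \<kk> P Vecs"
proof (rule left_module_homI)
  fix x assume x: "x \<in> carrier P"
  have cj: "c j \<in> carrier R" for j using c by (simp add: Coeffs_simps)
  show "tensor b c x \<in> carrier Vecs" by (rule tensor_carrier[OF c x])
  show "tensor b c (x \<oplus>\<^bsub>P\<^esub> y) = tensor b c x \<oplus>\<^bsub>Vecs\<^esub> tensor b c y" if "y \<in> carrier P" for y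
    using P.smult_r_distr[OF cj x that] unfolding tensor_def vec_add by simp
  show "tensor b c (a \<odot>\<^bsub>P\<^esub> x) = a \<odot>\<^bsub>Vecs\<^esub> tensor b c x" if "a \<in> carrier \<kk>" for a
  proof -
    have a: "a \<in> ring_center R" using that by simp
    have "c j \<odot>\<^bsub>P\<^esub> (a \<odot>\<^bsub>P\<^esub> x) = a \<odot>\<^bsub>P\<^esub> (c j \<odot>\<^bsub>P\<^esub> x)" for j
      using P.smult_assoc1[OF cj[of j] center_carrier[OF a] x] P.smult_assoc1[OF center_carrier[OF a] cj[of j] x]
        center_comm[OF a cj[of j]] by simp
    then show ?thesis unfolding tensor_def vec_smult[OF center_carrier[OF a]] by simp
  qed
qed

lemma tensor_smult:
  assumes "c \<in> carrier Coeffs" "r \<in> carrier R" "x \<in> carrier P"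
  shows "tensor b c (r \<odot>\<^bsub>P\<^esub> x) = tensor b (\<lambda>j. c j \<otimes> r) x"
  using assms P.smult_assoc1 unfolding tensor_def by (simp add: Coeffs_simps)

lemma tensor_unit_coeff:
  assumes "x \<in> carrier P"
  shows "tensor b (unit_coeff t) x = vec b (\<lambda>j. if j = t then e \<odot>\<^bsub>P\<^esub> x else \<zero>\<^bsub>P\<^esub>)"
  unfolding tensor_def unit_coeff_def by (rule arg_cong[of _ _ "vec b"]) (use assms in auto)

lemma vecs_carrier: "vecs q \<subseteq> carrier Vecs"
proof
  fix v assume v: "v \<in> vecs q"
  have "v (b, j) \<in> carrier P" for b j
    using v VP by (cases b; cases "j < q") (auto simp: vecs_def)
  then show "v \<in> carrier Vecs" by (simp add: Vecs_simps)
qed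

lemma vecs_submodule: "submodule (vecs q) \<kk> Vecs"
proof (rule Vecs.submoduleI[OF vecs_carrier])
  show "\<zero>\<^bsub>Vecs\<^esub> \<in> vecs q"
    using P.submoduleD(2)[OF V_submodule] by (simp add: vecs_def Vecs_simps)
  show "v \<oplus>\<^bsub>Vecs\<^esub> w \<in> vecs q" if "v \<in> vecs q" "w \<in> vecs q" for v w
    using that P.submoduleD(3)[OF V_submodule] by (simp add: vecs_def Vecs_simps)
  show "a \<odot>\<^bsub>Vecs\<^esub> v \<in> vecs q" if "a \<in> carrier \<kk>" "v \<in> vecs q" for a v
    using that center_smult_V[of a] center_carrier[of a] by (simp add: vecs_def Vecs_simps)
qed

lemma vec_in_vecs:
  "(\<And>j. j < q \<Longrightarrow> w j \<in> V) \<Longrightarrow> (\<And>j. j \<ge> q \<Longrightarrow> w j = \<zero>\<^bsub>P\<^esub>) \<Longrightarrow> vec False w \<in> vecs q"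
  by (simp add: vecs_def vec_def)

lemma tensor_in_vecs:
  assumes "c \<in> coeffs q" "x \<in> V"
  shows "tensor False c x \<in> vecs q"
  unfolding tensor_def
proof (rule vec_in_vecs)
  show "c j \<odot>\<^bsub>P\<^esub> x \<in> V" for j by (rule P.submoduleD(4)[OF V_submodule coeffs_carrier[OF assms(1)] assms(2)])
  show "c j \<odot>\<^bsub>P\<^esub> x = \<zero>\<^bsub>P\<^esub>" if "q \<le> j" for j
    using assms that VP[OF assms(2)] by (simp add: coeffs_def)
qed

end

section \<open>A linear form that detects every vector\<close>

context localized_submodule
begin

text \<open>
  The padding with zeros lets the length of the tuple grow without changing the tuple.
\<close>

lemma V_generators:
  "\<exists>xs q. (\<forall>j :: nat. xs j \<in> V) \<and> (\<forall>j\<ge>q. xs j = \<zero>\<^bsub>P\<^esub>) \<and>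
    (\<forall>s\<in>End. (\<forall>j. s (xs j) = xs j) \<longrightarrow> (\<forall>x\<in>V. s x = x))"
proof -
  interpret Pk: left_module \<kk> P by (rule P_center)
  obtain F where F: "finite F" "F \<subseteq> V" "submodule_generated \<kk> P F = V"
    using V_noetherian[OF V_center] by blast
  obtain q :: nat and f where f: "F = f ` {i. i < q}"
    using F(1) finite_imp_nat_seg_image_inj_on by blast
  define xs where "xs j = (if j < q then f j else \<zero>\<^bsub>P\<^esub>)" for j
  have "xs j \<in> V" for j
    using F(2) P.submoduleD(2)[OF V_submodule] unfolding f xs_def by auto
  moreover have "\<forall>j\<ge>q. xs j = \<zero>\<^bsub>P\<^esub>" unfolding xs_def by simp
  moreover have "\<forall>x\<in>V. s x = x" if s: "s \<in> End" "\<forall>j. s (xs j) = xs j" for s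
  proof -
    have "submodule {x \<in> V. s x = x} \<kk> P"
    proof (rule Pk.submoduleI)
      show "{x \<in> V. s x = x} \<subseteq> carrier P" using VP by blast
      show "\<zero>\<^bsub>P\<^esub> \<in> {x \<in> V. s x = x}" using EndD(4)[OF s(1)] P.submoduleD(2)[OF V_submodule] by simp
      show "x \<oplus>\<^bsub>P\<^esub> y \<in> {x \<in> V. s x = x}" if "x \<in> {x \<in> V. s x = x}" "y \<in> {x \<in> V. s x = x}" for x y
        using that EndD(2)[OF s(1), of x y] P.submoduleD(3)[OF V_submodule, of x y] by simp
      show "a \<odot>\<^bsub>P\<^esub> x \<in> {x \<in> V. s x = x}" if "a \<in> carrier \<kk>" "x \<in> {x \<in> V. s x = x}" for a x
        using that EndD(3)[OF s(1) center_carrier, of a x] center_smult_V[of a x] by simp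
    qed
    moreover have "F \<subseteq> {x \<in> V. s x = x}"
    proof
      fix x assume x: "x \<in> F"
      then obtain j where "j < q" "x = f j" unfolding f by blast
      then have "s x = x" using s(2)[rule_format, of j] unfolding xs_def by simp
      then show "x \<in> {x \<in> V. s x = x}" using x F(2) by blast
    qed
    ultimately have "V \<subseteq> {x \<in> V. s x = x}"
      using Pk.submodule_generated_minimal[of "{x \<in> V. s x = x}" F] F(3) by simp
    then show ?thesis by blast
  qed
  ultimately show ?thesis by blast
qed

end

locale generated_localized_submodule = localized_submodule +
  fixes xs :: "nat \<Rightarrow> 'c" and q0 :: nat
  assumes xs_V: "xs j \<in> V" and xs_zero: "j \<ge> q0 \<Longrightarrow> xs j = \<zero>\<^bsub>P\<^esub>"
    and xs_generate: "\<lbrakk>s \<in> End; \<And>j. s (xs j) = xs j; x \<in> V\<rbrakk> \<Longrightarrow> s x = x"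
begin

definition tuple where "tuple s = vec False (\<lambda>j. s (xs j))"

abbreviation base_tuple where "base_tuple \<equiv> vec False xs"

lemma tuple_in_vecs:
  assumes "s \<in> End" "q0 \<le> q" shows "tuple s \<in> vecs q"
  unfolding tuple_def
  by (rule vec_in_vecs) (use EndD(1)[OF assms(1) xs_V] EndD(4)[OF assms(1)] xs_zero assms(2) in auto)

lemma base_tuple_in_vecs: "q0 \<le> q \<Longrightarrow> base_tuple \<in> vecs q"
  by (rule vec_in_vecs) (use xs_V xs_zero in auto)

lemma radical_EndD: "s \<in> radical_End \<Longrightarrow> s \<in> End"
  by (simp add: radical_End_def)

lemma radical_tuples_submodule: "submodule (tuple ` radical_End) \<kk> Vecs"
proof (rule Vecs.submoduleI)
  show "tuple ` radical_End \<subseteq> carrier Vecs"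
    using tuple_in_vecs[OF radical_EndD order_refl] vecs_carrier by blast
  have "\<zero> \<in> \<mm>" by (rule noninvertible_if_annihilates[OF center_zero]) (use VP in simp)
  then have "(\<lambda>x. \<zero> \<odot>\<^bsub>P\<^esub> x) \<in> radical_End" by (rule radical_End_noninvertible)
  moreover have "tuple (\<lambda>x. \<zero> \<odot>\<^bsub>P\<^esub> x) = \<zero>\<^bsub>Vecs\<^esub>"
    unfolding tuple_def using VP[OF xs_V] vec_eq_zero by simp
  ultimately show "\<zero>\<^bsub>Vecs\<^esub> \<in> tuple ` radical_End" by (metis imageI)
next
  fix v w assume "v \<in> tuple ` radical_End" "w \<in> tuple ` radical_End"
  then obtain s t where st: "s \<in> radical_End" "t \<in> radical_End" "v = tuple s" "w = tuple t" by blast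
  have "v \<oplus>\<^bsub>Vecs\<^esub> w = tuple (\<lambda>x. s x \<oplus>\<^bsub>P\<^esub> t x)" unfolding st(3,4) tuple_def vec_add ..
  then show "v \<oplus>\<^bsub>Vecs\<^esub> w \<in> tuple ` radical_End" using radical_End_add[OF st(1,2)] by blast
next
  fix a v assume a: "a \<in> carrier \<kk>" and "v \<in> tuple ` radical_End"
  then obtain s where s: "s \<in> radical_End" "v = tuple s" by blast
  have ac: "a \<in> ring_center R" using a by simp
  have "a \<odot>\<^bsub>Vecs\<^esub> v = tuple (\<lambda>x. a \<odot>\<^bsub>P\<^esub> s x)"
    unfolding s(2) tuple_def vec_smult[OF center_carrier[OF ac]] ..
  then show "a \<odot>\<^bsub>Vecs\<^esub> v \<in> tuple ` radical_End" using radical_End_center[OF ac s(1)] by blast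
qed

lemma base_tuple_notin: "base_tuple \<notin> tuple ` radical_End"
proof
  assume "base_tuple \<in> tuple ` radical_End"
  then obtain s where s: "s \<in> radical_End" "base_tuple = tuple s" by blast
  have "s (xs j) = xs j" for j
    using fun_cong[OF s(2), of "(False, j)"] by (simp add: tuple_def vec_def)
  then have id: "s x = x" if "x \<in> V" for x using xs_generate[OF radical_EndD[OF s(1)]] that by blast
  have "bij_betw s V V" using bij_betw_cong[of V s id V] id by simp
  then show False using s(1) unfolding radical_End_def by blast
qed

text \<open>
  The submodule \<open>K\<close> stands for a linear form on \<open>V\<^sup>q\<close> that vanishes on the images of the
  generating tuple under the non-bijective endomorphisms, but not on the tuple itself.
\<close>

definition detector where
  "detector q K \<longleftrightarrow> q0 \<le> q \<and> maximal_avoiding \<kk> Vecs K base_tuple \<and> tuple ` radical_End \<subseteq> K"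

text \<open>
  The right kernel of the pairing of the coefficients with \<open>V\<close> that is given by the form.
\<close>

definition undetected where
  "undetected q K = {z \<in> V. \<forall>c\<in>coeffs q. tensor False c z \<in> K}"

lemma detectorD:
  assumes "detector q K"
  shows "q0 \<le> q" "maximal_avoiding \<kk> Vecs K base_tuple" "tuple ` radical_End \<subseteq> K"
    "submodule K \<kk> Vecs" "base_tuple \<notin> K"
  using assms by (auto simp: detector_def maximal_avoiding_def)

lemma base_tuple_carrier: "base_tuple \<in> carrier Vecs"
  using base_tuple_in_vecs[OF order_refl] vecs_carrier by blast

lemma smult_base_tuple: "a \<in> ring_center R \<Longrightarrow> a \<odot>\<^bsub>Vecs\<^esub> base_tuple = tuple (\<lambda>x. a \<odot>\<^bsub>P\<^esub> x)"
  unfolding tuple_def by (rule vec_smult[OF center_carrier])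

lemma noninvertible_base_tuple:
  "detector q K \<Longrightarrow> a \<in> \<mm> \<Longrightarrow> a \<odot>\<^bsub>Vecs\<^esub> base_tuple \<in> K"
  unfolding smult_base_tuple[OF noninvertible_center]
  using detectorD(3) radical_End_noninvertible by blast

lemma exists_detector: "\<exists>K. detector q0 K"
  using Vecs.maximal_avoiding_exists[OF radical_tuples_submodule base_tuple_carrier base_tuple_notin]
  unfolding detector_def by blast

lemma undetected_submodule:
  assumes "detector q K"
  shows "submodule (undetected q K) \<kk> P"
proof -
  interpret Pk: left_module \<kk> P by (rule P_center)
  note K = detectorD(4)[OF assms]
  have c: "c \<in> carrier Coeffs" if "c \<in> coeffs q" for c using that coeffs_subset by blast
  show ?thesis
  proof (rule Pk.submoduleI)
    show "undetected q K \<subseteq> carrier P" unfolding undetected_def using VP by blast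
    have "tensor False c \<zero>\<^bsub>P\<^esub> = \<zero>\<^bsub>Vecs\<^esub>" if "c \<in> coeffs q" for c
      unfolding tensor_def using coeffs_carrier[OF that] vec_eq_zero by simp
    then show "\<zero>\<^bsub>P\<^esub> \<in> undetected q K"
      unfolding undetected_def using P.submoduleD(2)[OF V_submodule] Vecs.submoduleD(2)[OF K] by simp
    show "x \<oplus>\<^bsub>P\<^esub> y \<in> undetected q K" if "x \<in> undetected q K" "y \<in> undetected q K" for x y
      using that left_module_homD(2)[OF tensor_hom_right[OF c], of _ x y False] VP
        P.submoduleD(3)[OF V_submodule, of x y] Vecs.submoduleD(3)[OF K]
      unfolding undetected_def by simp
    show "a \<odot>\<^bsub>P\<^esub> x \<in> undetected q K" if "a \<in> carrier \<kk>" "x \<in> undetected q K" for a x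
      using that left_module_homD(3)[OF tensor_hom_right[OF c], of _ a x False] VP
        center_smult_V[of a x] Vecs.submoduleD(4)[OF K]
      unfolding undetected_def by simp
  qed
qed

lemma undetected_subset: "undetected q K \<subseteq> V"
  unfolding undetected_def by blast

lemma exists_socle_element:
  assumes N: "submodule N \<kk> P" "N \<subseteq> V" "N \<noteq> {\<zero>\<^bsub>P\<^esub>}"
  shows "\<exists>z\<in>N. z \<noteq> \<zero>\<^bsub>P\<^esub> \<and> (\<forall>a\<in>\<mm>. a \<odot>\<^bsub>P\<^esub> z = \<zero>\<^bsub>P\<^esub>)"
proof -
  interpret K: artinian_cring_maximal_ideal \<kk> \<mm> by (rule artinian_cring_maximal_ideal)
  interpret Pk: left_module \<kk> P by (rule P_center)
  let ?Q = "\<lambda>G. (submodule G \<kk> P \<and> G \<subseteq> N) \<and> G \<noteq> {\<zero>\<^bsub>P\<^esub>}"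
  obtain G where G: "?Q G" and Gmin: "\<And>G'. ?Q G' \<Longrightarrow> G' \<subseteq> G \<Longrightarrow> G' = G"
  proof (rule artinian_in_minimal[OF artinian_in_subset[OF V_artinian N(2)], of ?Q N])
    show "?Q N" using N by blast
    show "submodule G \<kk> P \<and> G \<subseteq> N" if "?Q G" for G using that by blast
  qed blast
  have Gs: "submodule G \<kk> P" "G \<noteq> {\<zero>\<^bsub>P\<^esub>}" "G \<subseteq> N" using G by blast+
  obtain H z where H: "submodule H \<kk> P" "H \<subseteq> G" "z \<in> G" "z \<notin> H"
    and mG: "\<And>a x. a \<in> \<mm> \<Longrightarrow> x \<in> G \<Longrightarrow> a \<odot>\<^bsub>P\<^esub> x \<in> H"
  proof (rule K.hyperplane[OF P_center Gs(1,2)])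
    show "x = \<zero>\<^bsub>P\<^esub>" if "a \<in> carrier \<kk>" "a \<notin> \<mm>" "x \<in> G" "a \<odot>\<^bsub>P\<^esub> x = \<zero>\<^bsub>P\<^esub>" for a x
      using invertible_scalar_inj[of a x] that Gs(3) N(2) by auto
  qed blast
  have H0: "H = {\<zero>\<^bsub>P\<^esub>}"
  proof (rule ccontr)
    assume "H \<noteq> {\<zero>\<^bsub>P\<^esub>}"
    then have "H = G" using Gmin[of H] H(1,2) Gs(3) by blast
    then show False using H(3,4) by blast
  qed
  then have "z \<noteq> \<zero>\<^bsub>P\<^esub>" using H(4) by blast
  moreover have "a \<odot>\<^bsub>P\<^esub> z = \<zero>\<^bsub>P\<^esub>" if "a \<in> \<mm>" for a using mG[OF that H(3)] H0 by blast
  ultimately show ?thesis using H(3) Gs(3) by blast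
qed

text \<open>
  Let \<open>z\<close> be a nonzero undetected vector that is annihilated by \<open>\<mm>\<close>. A new coordinate is added,
  and the form is extended such that \<open>z\<close> in the new coordinate gets the same value as the
  generating tuple: the difference \<open>w\<close> of these two vectors is put into the submodule. This does
  not force the generating tuple into it, since \<open>z\<close> and the value of the tuple have the same
  annihilator \<open>\<mm>\<close>. Now \<open>z\<close> is detected.
\<close>

lemma exists_smaller_undetected:
  assumes detector: "detector q K" and N: "undetected q K \<noteq> {\<zero>\<^bsub>P\<^esub>}"
  shows "\<exists>K'. detector (Suc q) K' \<and> undetected (Suc q) K' \<subset> undetected q K"
proof -
  note K = detectorD[OF detector]
  obtain z where z: "z \<in> undetected q K" "z \<noteq> \<zero>\<^bsub>P\<^esub>" and mz: "\<And>a. a \<in> \<mm> \<Longrightarrow> a \<odot>\<^bsub>P\<^esub> z = \<zero>\<^bsub>P\<^esub>"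
    using exists_socle_element[OF undetected_submodule[OF detector] undetected_subset N] by blast
  have zV: "z \<in> V" using z(1) undetected_subset by blast
  note zP = VP[OF zV]
  define zvec where "zvec = vec False (\<lambda>j. if j = q then z else \<zero>\<^bsub>P\<^esub>)"
  have zc: "zvec \<in> carrier Vecs" unfolding zvec_def by (rule vec_carrier) (use zP in simp)
  \<comment> \<open>Modulo \<open>w\<close> the value of the new form at \<open>z\<close> is that of the generating tuple.\<close>
  define w where "w = base_tuple \<ominus>\<^bsub>Vecs\<^esub> zvec"
  have wc: "w \<in> carrier Vecs" unfolding w_def by (rule Vecs.M.minus_closed[OF base_tuple_carrier zc])
  define L where "L = K \<inter> vecs q"
  have L: "submodule L \<kk> Vecs" unfolding L_def by (rule Vecs.submodule_Int[OF K(4) vecs_submodule])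
  let ?U = "L <+>\<^bsub>Vecs\<^esub> (\<lambda>a. a \<odot>\<^bsub>Vecs\<^esub> w) ` carrier \<kk>"
  note W = Vecs.submodule_multiples[OF wc]
  have U: "submodule ?U \<kk> Vecs" by (rule Vecs.submodule_set_add[OF L W])
  have "base_tuple \<notin> ?U"
  proof
    assume "base_tuple \<in> ?U"
    then obtain l a where la: "l \<in> L" "a \<in> ring_center R" "base_tuple = l \<oplus>\<^bsub>Vecs\<^esub> a \<odot>\<^bsub>Vecs\<^esub> w"
      unfolding Vecs.set_add_iff by auto
    note ac = center_carrier[OF la(2)]
    have "\<zero>\<^bsub>P\<^esub> = \<zero>\<^bsub>P\<^esub> \<oplus>\<^bsub>P\<^esub> a \<odot>\<^bsub>P\<^esub> (\<zero>\<^bsub>P\<^esub> \<ominus>\<^bsub>P\<^esub> z)"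
    proof -
      have "l (False, q) = \<zero>\<^bsub>P\<^esub>" using la(1) unfolding L_def vecs_def by blast
      moreover have "w (False, q) = \<zero>\<^bsub>P\<^esub> \<ominus>\<^bsub>P\<^esub> z"
        unfolding w_def Vecs_minus[OF base_tuple_carrier zc] using xs_zero[OF K(1)]
        by (simp add: zvec_def vec_def)
      moreover have "base_tuple (False, q) = \<zero>\<^bsub>P\<^esub>" using xs_zero[OF K(1)] by (simp add: vec_def)
      ultimately show ?thesis using fun_cong[OF la(3), of "(False, q)"] by (simp add: Vecs_simps)
    qed
    moreover have "a \<odot>\<^bsub>P\<^esub> (\<zero>\<^bsub>P\<^esub> \<ominus>\<^bsub>P\<^esub> z) = \<ominus>\<^bsub>P\<^esub> (a \<odot>\<^bsub>P\<^esub> z)"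
      using P.smult_minus_right[OF ac zP] zP unfolding P.M.minus_eq by simp
    ultimately have "\<ominus>\<^bsub>P\<^esub> (a \<odot>\<^bsub>P\<^esub> z) = \<zero>\<^bsub>P\<^esub>" using ac zP by simp
    then have az: "a \<odot>\<^bsub>P\<^esub> z = \<zero>\<^bsub>P\<^esub>" using ac zP P.M.add.inv_eq_1_iff[of "a \<odot>\<^bsub>P\<^esub> z"] by (simp add: a_inv_def)
    then have am: "a \<in> \<mm>" using invertible_scalar_inj[OF la(2) _ zV] z(2) by blast
    have "a \<odot>\<^bsub>Vecs\<^esub> zvec = \<zero>\<^bsub>Vecs\<^esub>"
      unfolding zvec_def vec_smult[OF ac] vec_eq_zero[of False, symmetric]
      by (rule arg_cong[of _ _ "vec False"]) (use az ac in auto)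
    then have "a \<odot>\<^bsub>Vecs\<^esub> w = a \<odot>\<^bsub>Vecs\<^esub> base_tuple"
      unfolding w_def using Vecs.smult_diff[OF _ base_tuple_carrier zc, of a] la(2)
        Vecs.smult_closed[of a, OF _ base_tuple_carrier] Vecs.minus_zero_right by simp
    then have "base_tuple \<in> K"
      using la(1,3) noninvertible_base_tuple[OF detector am] Vecs.submoduleD(3)[OF K(4)] unfolding L_def
      by auto
    then show False using K(5) by blast
  qed
  then obtain K' where K': "?U \<subseteq> K'" "maximal_avoiding \<kk> Vecs K' base_tuple"
    using Vecs.maximal_avoiding_exists[OF U base_tuple_carrier] by blast
  have K's: "submodule K' \<kk> Vecs" "base_tuple \<notin> K'" using K'(2) by (auto simp: maximal_avoiding_def)
  have LK': "L \<subseteq> K'" using Vecs.subset_set_add_left[OF L W] K'(1) by blast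
  have "\<one>\<^bsub>\<kk>\<^esub> \<odot>\<^bsub>Vecs\<^esub> w \<in> (\<lambda>a. a \<odot>\<^bsub>Vecs\<^esub> w) ` carrier \<kk>" by (rule imageI) (use center_one in simp)
  then have wK': "w \<in> K'"
    using Vecs.subset_set_add_right[OF L W] K'(1) Vecs.smult_one[OF wc] by auto
  have K'K: "K' \<inter> vecs q \<subseteq> K"
    by (rule Vecs.maximal_avoiding_restrict[OF K(2) K's vecs_submodule base_tuple_in_vecs[OF K(1)]])
      (use LK' L_def in blast)
  have "tuple ` radical_End \<subseteq> L"
    unfolding L_def using K(3) tuple_in_vecs[OF radical_EndD K(1)] by blast
  then have "detector (Suc q) K'" unfolding detector_def using K(1) K'(2) LK' by auto
  moreover have "undetected (Suc q) K' \<subseteq> undetected q K"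
  proof
    fix x assume x: "x \<in> undetected (Suc q) K'"
    have xV: "x \<in> V" using x undetected_subset by blast
    have "tensor False c x \<in> K" if c: "c \<in> coeffs q" for c
    proof -
      have "tensor False c x \<in> K'" using x coeffs_mono[of q "Suc q"] c unfolding undetected_def by auto
      then show ?thesis using K'K tensor_in_vecs[OF c xV] by blast
    qed
    then show "x \<in> undetected q K" unfolding undetected_def using xV by blast
  qed
  moreover have "z \<notin> undetected (Suc q) K'"
  proof
    assume "z \<in> undetected (Suc q) K'"
    then have "tensor False (unit_coeff q) z \<in> K'"
      unfolding undetected_def using unit_coeff_in[of q "Suc q"] by blast
    then have "zvec \<in> K'" unfolding zvec_def tensor_unit_coeff[OF zP] e_V[OF zV] .
    then have "w \<oplus>\<^bsub>Vecs\<^esub> zvec \<in> K'" by (rule Vecs.submoduleD(3)[OF K's(1) wK'])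
    then show False unfolding w_def using Vecs.add_minus_cancel[OF base_tuple_carrier zc] K's(2) by simp
  qed
  ultimately show ?thesis using z(1) by blast
qed

lemma exists_separating_detector: "\<exists>q K. detector q K \<and> undetected q K = {\<zero>\<^bsub>P\<^esub>}"
proof -
  let ?Q = "\<lambda>G. \<exists>q K. detector q K \<and> G = undetected q K"
  obtain K0 where K0: "detector q0 K0" using exists_detector by blast
  obtain G where G: "?Q G" and Gmin: "\<And>G'. ?Q G' \<Longrightarrow> G' \<subseteq> G \<Longrightarrow> G' = G"
  proof (rule artinian_in_minimal[OF V_artinian, of ?Q "undetected q0 K0"])
    show "?Q (undetected q0 K0)" using K0 by blast
    show "submodule G \<kk> P \<and> G \<subseteq> V" if "?Q G" for G
      using that undetected_submodule undetected_subset by blast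
  qed blast
  obtain q K where qK: "detector q K" "G = undetected q K" using G by blast
  have "undetected q K = {\<zero>\<^bsub>P\<^esub>}"
  proof (rule ccontr)
    assume "undetected q K \<noteq> {\<zero>\<^bsub>P\<^esub>}"
    then obtain K' where "detector (Suc q) K'" "undetected (Suc q) K' \<subset> undetected q K"
      using exists_smaller_undetected[OF qK(1)] by blast
    then show False using Gmin[of "undetected (Suc q) K'"] qK(2) by blast
  qed
  then show ?thesis using qK(1) by blast
qed

end

section \<open>The isolating system of linear equations\<close>

context generated_localized_submodule
begin

definition combination where
  "combination \<Phi> m = (\<lambda>j :: nat. \<Oplus>\<^bsub>P\<^esub>c\<in>\<Phi>. c j \<odot>\<^bsub>P\<^esub> m c)"

lemma combination_closed:
  assumes "\<Phi> \<subseteq> coeffs q" "m \<in> \<Phi> \<rightarrow> carrier P"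
  shows "(\<lambda>c. c j \<odot>\<^bsub>P\<^esub> m c) \<in> \<Phi> \<rightarrow> carrier P" "combination \<Phi> m j \<in> carrier P"
proof -
  show 1: "(\<lambda>c. c j \<odot>\<^bsub>P\<^esub> m c) \<in> \<Phi> \<rightarrow> carrier P"
  proof
    fix c assume "c \<in> \<Phi>"
    then show "c j \<odot>\<^bsub>P\<^esub> m c \<in> carrier P"
      using P.smult_closed[OF coeffs_carrier[of c q j], of "m c"] assms by blast
  qed
  show "combination \<Phi> m j \<in> carrier P" unfolding combination_def by (rule P.M.finsum_closed[OF 1])
qed

lemma vec_combination:
  assumes "finite \<Phi>" "\<Phi> \<subseteq> coeffs q" "m \<in> \<Phi> \<rightarrow> carrier P"
  shows "vec b (combination \<Phi> m) = (\<Oplus>\<^bsub>Vecs\<^esub>c\<in>\<Phi>. tensor b c (m c))"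
proof
  fix i
  interpret i: left_module_map \<kk> Vecs P "\<lambda>v. v i"
    by (rule product_module_UNIV_coordinate_hom[OF center_ring P_center])
  have "(\<Oplus>\<^bsub>Vecs\<^esub>c\<in>\<Phi>. tensor b c (m c)) i = (\<Oplus>\<^bsub>P\<^esub>c\<in>\<Phi>. tensor b c (m c) i)"
    by (rule i.hom_finsum[OF assms(1)]) (use assms tensor_carrier coeffs_subset in blast)
  also have "\<dots> = vec b (combination \<Phi> m) i"
  proof (cases "fst i = b")
    case True
    then show ?thesis by (simp add: tensor_def vec_def combination_def)
  next
    case False
    then show ?thesis by (simp add: tensor_def vec_def P.M.finsum_zero)
  qed
  finally show "vec b (combination \<Phi> m) i = (\<Oplus>\<^bsub>Vecs\<^esub>c\<in>\<Phi>. tensor b c (m c)) i" ..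
qed

text \<open>
  The left kernel of the pairing. Its generators are the columns of the isolating system.
\<close>

definition annihilating_coeffs where
  "annihilating_coeffs q K = {c \<in> coeffs q. \<forall>x\<in>V. tensor False c x \<in> K}"

lemma annihilating_coeffs_submodule:
  assumes "detector q K" shows "submodule (annihilating_coeffs q K) \<kk> Coeffs"
proof -
  note K = detectorD(4)[OF assms] and D = Coeffs.submoduleD[OF coeffs_submodule[of q]]
  note hom = tensor_hom_left[OF VP, of _ False]
  show ?thesis
  proof (rule Coeffs.submoduleI)
    show "annihilating_coeffs q K \<subseteq> carrier Coeffs"
      unfolding annihilating_coeffs_def using coeffs_subset by blast
    have "tensor False \<zero>\<^bsub>Coeffs\<^esub> x = \<zero>\<^bsub>Vecs\<^esub>" if "x \<in> V" for x
      unfolding tensor_def using VP[OF that] vec_eq_zero[of False] by (simp add: Coeffs_simps)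
    then show "\<zero>\<^bsub>Coeffs\<^esub> \<in> annihilating_coeffs q K"
      unfolding annihilating_coeffs_def using D(2) Vecs.submoduleD(2)[OF K] by simp
    show "c \<oplus>\<^bsub>Coeffs\<^esub> d \<in> annihilating_coeffs q K"
      if "c \<in> annihilating_coeffs q K" "d \<in> annihilating_coeffs q K" for c d
      using that D(3)[of c d] D(7)[of c] D(7)[of d] left_module_homD(2)[OF hom, of _ c d]
        Vecs.submoduleD(3)[OF K] unfolding annihilating_coeffs_def by simp
    show "a \<odot>\<^bsub>Coeffs\<^esub> c \<in> annihilating_coeffs q K"
      if "a \<in> carrier \<kk>" "c \<in> annihilating_coeffs q K" for a c
      using that D(4)[of a c] D(7)[of c] left_module_homD(3)[OF hom, of _ a c]
        Vecs.submoduleD(4)[OF K] unfolding annihilating_coeffs_def by simp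
  qed
qed

text \<open>
  All tuples of the form \<open>\<Sum>c. c \<otimes> m c\<close> with \<open>m\<close> in \<open>V\<close> lie in \<open>K\<close>, and the generating tuple does
  not.
\<close>

lemma no_solution_in_V:
  assumes detector: "detector q K" and \<Phi>: "finite \<Phi>" "\<Phi> \<subseteq> annihilating_coeffs q K"
    and m: "m \<in> \<Phi> \<rightarrow> V"
  shows "\<exists>j. xs j \<noteq> combination \<Phi> m j"
proof (rule ccontr)
  assume "\<not> ?thesis"
  then have "xs = combination \<Phi> m" by auto
  moreover have "\<Phi> \<subseteq> coeffs q" using \<Phi>(2) unfolding annihilating_coeffs_def by blast
  moreover have "m \<in> \<Phi> \<rightarrow> carrier P" using m VP by blast
  ultimately have "base_tuple = (\<Oplus>\<^bsub>Vecs\<^esub>c\<in>\<Phi>. tensor False c (m c))"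
    using vec_combination[OF \<Phi>(1)] by simp
  also have "\<dots> \<in> K"
    by (rule Vecs.submodule_finsum[OF detectorD(4)[OF detector] \<Phi>(1)])
      (use \<Phi>(2) m in \<open>auto simp: annihilating_coeffs_def\<close>)
  finally show False using detectorD(5)[OF detector] by blast
qed

definition solvable_vecs where
  "solvable_vecs \<Phi> = {vec True (combination \<Phi> m) | m. m \<in> \<Phi> \<rightarrow> carrier P}"

lemma solvable_vecs_submodule:
  assumes \<Phi>: "finite \<Phi>" "\<Phi> \<subseteq> coeffs q"
  shows "submodule (solvable_vecs \<Phi>) \<kk> Vecs"
proof (rule Vecs.submoduleI)
  have cR: "c j \<in> carrier R" if "c \<in> \<Phi>" for c j using coeffs_carrier[of c q j] \<Phi>(2) that by blast
  show "solvable_vecs \<Phi> \<subseteq> carrier Vecs"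
  proof
    fix v assume "v \<in> solvable_vecs \<Phi>"
    then obtain m where m: "m \<in> \<Phi> \<rightarrow> carrier P" "v = vec True (combination \<Phi> m)"
      unfolding solvable_vecs_def by blast
    show "v \<in> carrier Vecs"
      unfolding m(2) by (rule vec_carrier[OF combination_closed(2)[OF \<Phi>(2) m(1)]])
  qed
  have "combination \<Phi> (\<lambda>_. \<zero>\<^bsub>P\<^esub>) j = \<zero>\<^bsub>P\<^esub>" for j
  proof -
    have "combination \<Phi> (\<lambda>_. \<zero>\<^bsub>P\<^esub>) j = (\<Oplus>\<^bsub>P\<^esub>c\<in>\<Phi>. \<zero>\<^bsub>P\<^esub>)"
      unfolding combination_def using cR by (intro P.M.finsum_cong) (auto simp: simp_implies_def)
    then show ?thesis by (simp only: P.M.finsum_zero)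
  qed
  then have "combination \<Phi> (\<lambda>_. \<zero>\<^bsub>P\<^esub>) = (\<lambda>j. \<zero>\<^bsub>P\<^esub>)" by (rule ext)
  then have "\<zero>\<^bsub>Vecs\<^esub> = vec True (combination \<Phi> (\<lambda>_. \<zero>\<^bsub>P\<^esub>))"
    unfolding vec_eq_zero[of True, symmetric] by simp
  then show "\<zero>\<^bsub>Vecs\<^esub> \<in> solvable_vecs \<Phi>" unfolding solvable_vecs_def by blast
next
  have cR: "c j \<in> carrier R" if "c \<in> \<Phi>" for c j using coeffs_carrier[of c q j] \<Phi>(2) that by blast
  fix v w assume "v \<in> solvable_vecs \<Phi>" "w \<in> solvable_vecs \<Phi>"
  then obtain m n where mn: "m \<in> \<Phi> \<rightarrow> carrier P" "n \<in> \<Phi> \<rightarrow> carrier P"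
    "v = vec True (combination \<Phi> m)" "w = vec True (combination \<Phi> n)"
    unfolding solvable_vecs_def by blast
  have "combination \<Phi> m j \<oplus>\<^bsub>P\<^esub> combination \<Phi> n j = combination \<Phi> (\<lambda>c. m c \<oplus>\<^bsub>P\<^esub> n c) j" for j
  proof -
    have "combination \<Phi> m j \<oplus>\<^bsub>P\<^esub> combination \<Phi> n j = (\<Oplus>\<^bsub>P\<^esub>c\<in>\<Phi>. c j \<odot>\<^bsub>P\<^esub> m c \<oplus>\<^bsub>P\<^esub> c j \<odot>\<^bsub>P\<^esub> n c)"
      unfolding combination_def
      by (rule P.M.finsum_addf[OF combination_closed(1)[OF \<Phi>(2) mn(1)] combination_closed(1)[OF \<Phi>(2) mn(2)], symmetric])
    also have "\<dots> = combination \<Phi> (\<lambda>c. m c \<oplus>\<^bsub>P\<^esub> n c) j"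
      unfolding combination_def
    proof (rule P.M.finsum_cong'[OF refl])
      show "(\<lambda>c. c j \<odot>\<^bsub>P\<^esub> (m c \<oplus>\<^bsub>P\<^esub> n c)) \<in> \<Phi> \<rightarrow> carrier P"
        by (rule combination_closed(1)[OF \<Phi>(2)]) (use mn(1,2) P.M.a_closed in blast)
      show "c j \<odot>\<^bsub>P\<^esub> m c \<oplus>\<^bsub>P\<^esub> c j \<odot>\<^bsub>P\<^esub> n c = c j \<odot>\<^bsub>P\<^esub> (m c \<oplus>\<^bsub>P\<^esub> n c)" if "c \<in> \<Phi>" for c
        using P.smult_r_distr[OF cR[OF that], of "m c" "n c"] mn(1,2) that by (simp add: Pi_iff)
    qed
    finally show ?thesis .
  qed
  then have "v \<oplus>\<^bsub>Vecs\<^esub> w = vec True (combination \<Phi> (\<lambda>c. m c \<oplus>\<^bsub>P\<^esub> n c))"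
    unfolding mn(3,4) vec_add by simp
  moreover have "(\<lambda>c. m c \<oplus>\<^bsub>P\<^esub> n c) \<in> \<Phi> \<rightarrow> carrier P" using mn(1,2) P.M.a_closed by blast
  ultimately show "v \<oplus>\<^bsub>Vecs\<^esub> w \<in> solvable_vecs \<Phi>" unfolding solvable_vecs_def by blast
next
  have cR: "c j \<in> carrier R" if "c \<in> \<Phi>" for c j using coeffs_carrier[of c q j] \<Phi>(2) that by blast
  fix a v assume ak: "a \<in> carrier \<kk>" and "v \<in> solvable_vecs \<Phi>"
  then obtain m where m: "m \<in> \<Phi> \<rightarrow> carrier P" "v = vec True (combination \<Phi> m)"
    unfolding solvable_vecs_def by blast
  interpret a: left_module_map \<kk> P P "\<lambda>x. a \<odot>\<^bsub>P\<^esub> x"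
    by (rule artinian_cring_maximal_ideal.scaling_hom[OF artinian_cring_maximal_ideal P_center ak])
  have a: "a \<in> ring_center R" using ak by simp
  note aR = center_carrier[OF a]
  have am: "(\<lambda>c. a \<odot>\<^bsub>P\<^esub> m c) \<in> \<Phi> \<rightarrow> carrier P" using m(1) P.smult_closed[OF aR] by blast
  have "a \<odot>\<^bsub>P\<^esub> combination \<Phi> m j = combination \<Phi> (\<lambda>c. a \<odot>\<^bsub>P\<^esub> m c) j" for j
  proof -
    have "a \<odot>\<^bsub>P\<^esub> combination \<Phi> m j = (\<Oplus>\<^bsub>P\<^esub>c\<in>\<Phi>. a \<odot>\<^bsub>P\<^esub> (c j \<odot>\<^bsub>P\<^esub> m c))"
      unfolding combination_def
      by (rule a.hom_finsum[OF \<Phi>(1)]) (use combination_closed(1)[OF \<Phi>(2) m(1)] in blast)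
    also have "\<dots> = combination \<Phi> (\<lambda>c. a \<odot>\<^bsub>P\<^esub> m c) j"
      unfolding combination_def
    proof (rule P.M.finsum_cong'[OF refl combination_closed(1)[OF \<Phi>(2) am]])
      fix c assume c: "c \<in> \<Phi>"
      then have mc: "m c \<in> carrier P" using m(1) by blast
      show "a \<odot>\<^bsub>P\<^esub> (c j \<odot>\<^bsub>P\<^esub> m c) = c j \<odot>\<^bsub>P\<^esub> (a \<odot>\<^bsub>P\<^esub> m c)"
        using P.smult_assoc1[OF aR cR[OF c, of j] mc] P.smult_assoc1[OF cR[OF c, of j] aR mc]
          center_comm[OF a cR[OF c, of j]] by simp
    qed
    finally show ?thesis .
  qed
  then have "a \<odot>\<^bsub>Vecs\<^esub> v = vec True (combination \<Phi> (\<lambda>c. a \<odot>\<^bsub>P\<^esub> m c))"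
    unfolding m(2) vec_smult[OF aR] by simp
  then show "a \<odot>\<^bsub>Vecs\<^esub> v \<in> solvable_vecs \<Phi>" unfolding solvable_vecs_def using am by blast
qed

lemma tensor_in_solvable_vecs:
  assumes detector: "detector q K" and \<Phi>: "finite \<Phi>" "\<Phi> \<subseteq> coeffs q"
    and gen: "submodule_generated \<kk> Coeffs \<Phi> = annihilating_coeffs q K"
    and c: "c \<in> annihilating_coeffs q K" and x: "x \<in> carrier P"
  shows "tensor True c x \<in> solvable_vecs \<Phi>"
proof -
  interpret t: left_module_map \<kk> Coeffs Vecs "\<lambda>c. tensor True c x"
    using tensor_hom_left[OF x] Coeffs_module Vecs_module
    by (simp add: left_module_mapI)
  have sub: "submodule {c \<in> coeffs q. tensor True c x \<in> solvable_vecs \<Phi>} \<kk> Coeffs"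
    by (rule t.submodule_preimage[OF solvable_vecs_submodule[OF \<Phi>] coeffs_submodule])
  have "\<Phi> \<subseteq> {c \<in> coeffs q. tensor True c x \<in> solvable_vecs \<Phi>}"
  proof
    fix c0 assume c0: "c0 \<in> \<Phi>"
    let ?m = "\<lambda>c. if c = c0 then x else \<zero>\<^bsub>P\<^esub>"
    have m: "?m \<in> \<Phi> \<rightarrow> carrier P" using x by auto
    have "combination \<Phi> ?m j = c0 j \<odot>\<^bsub>P\<^esub> x" for j
    proof -
      have "combination \<Phi> ?m j = (\<Oplus>\<^bsub>P\<^esub>c\<in>\<Phi>. if c0 = c then c j \<odot>\<^bsub>P\<^esub> x else \<zero>\<^bsub>P\<^esub>)"
        unfolding combination_def
      proof (rule P.M.finsum_cong'[OF refl])
        show "(\<lambda>c. if c0 = c then c j \<odot>\<^bsub>P\<^esub> x else \<zero>\<^bsub>P\<^esub>) \<in> \<Phi> \<rightarrow> carrier P"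
          using P.smult_closed[OF coeffs_carrier[of c0 q j] x] c0 \<Phi>(2) by auto
        show "c j \<odot>\<^bsub>P\<^esub> ?m c = (if c0 = c then c j \<odot>\<^bsub>P\<^esub> x else \<zero>\<^bsub>P\<^esub>)" if "c \<in> \<Phi>" for c
          using coeffs_carrier[of c q j] \<Phi>(2) that by auto
      qed
      also have "\<dots> = c0 j \<odot>\<^bsub>P\<^esub> x"
        by (rule P.M.finsum_singleton[OF c0 \<Phi>(1)])
          (use P.smult_closed[OF coeffs_carrier[of _ q j] x] \<Phi>(2) in blast)
      finally show ?thesis .
    qed
    then have "combination \<Phi> ?m = (\<lambda>j. c0 j \<odot>\<^bsub>P\<^esub> x)" by (rule ext)
    then have "tensor True c0 x = vec True (combination \<Phi> ?m)" unfolding tensor_def by simp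
    then show "c0 \<in> {c \<in> coeffs q. tensor True c x \<in> solvable_vecs \<Phi>}"
      using m c0 \<Phi>(2) unfolding solvable_vecs_def by blast
  qed
  then show ?thesis
    using Coeffs.submodule_generated_minimal[OF sub] gen c by blast
qed

text \<open>
  Suppose that the tuple \<open>h x\<close> is not in the submodule \<open>S\<close> of right-hand sides for which the
  system is solvable. Then the restriction of \<open>K\<close> to \<open>V\<^sup>q\<close>, together with \<open>S\<close>, can be enlarged to
  a submodule \<open>K'\<close> modulo which the tuples \<open>x\<close> and \<open>h x\<close> coincide, but do not vanish. With
  respect to \<open>K'\<close> every \<open>m\<close> in \<open>P\<close> defines a linear form on the coefficients, and this form
  vanishes on the left kernel. By \<open>linear_form_is_evaluation\<close> it is the evaluation at some \<open>g m\<close>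
  in \<open>V\<close>, which is unique because all vectors of \<open>V\<close> are detected. Modulo \<open>K'\<close> the tuple
  \<open>g (h x)\<close> coincides with \<open>h x\<close> and hence with \<open>x\<close>. So it does not lie in \<open>K\<close>; by the choice of
  \<open>K\<close>, the endomorphism \<open>g h\<close> is bijective.
\<close>

lemma splitting:
  assumes detector: "detector q K" and separating: "undetected q K = {\<zero>\<^bsub>P\<^esub>}"
    and \<Phi>: "finite \<Phi>" "\<Phi> \<subseteq> coeffs q"
    and gen: "submodule_generated \<kk> Coeffs \<Phi> = annihilating_coeffs q K"
    and h: "h \<in> left_module_hom R (P\<lparr>carrier := V\<rparr>) P"
    and unsolvable: "\<And>m. m \<in> \<Phi> \<rightarrow> carrier P \<Longrightarrow> \<exists>j. h (xs j) \<noteq> combination \<Phi> m j"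
  shows "\<exists>g\<in>left_module_hom R P (P\<lparr>carrier := V\<rparr>). \<forall>x\<in>V. g (h x) = x"
proof -
  note K = detectorD[OF detector]
  interpret h: left_module_map R "P\<lparr>carrier := V\<rparr>" P h
    using V_module P.left_module_axioms h by (simp add: left_module_mapI)
  have hP: "h x \<in> carrier P" if "x \<in> V" for x using h.homD(1)[of x] that by simp
  have h_smult: "h (r \<odot>\<^bsub>P\<^esub> x) = r \<odot>\<^bsub>P\<^esub> h x" if "r \<in> carrier R" "x \<in> V" for r x
    using h.homD(3)[of r x] that by simp
  have h_add: "h (x \<oplus>\<^bsub>P\<^esub> y) = h x \<oplus>\<^bsub>P\<^esub> h y" if "x \<in> V" "y \<in> V" for x y
    using h.homD(2)[of x y] that by simp
  have h_zero: "h \<zero>\<^bsub>P\<^esub> = \<zero>\<^bsub>P\<^esub>" using h.hom_zero by simp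
  define hx where "hx = vec True (\<lambda>j. h (xs j))"
  have hxc: "hx \<in> carrier Vecs" unfolding hx_def by (rule vec_carrier[OF hP[OF xs_V]])
  have hx_notin: "hx \<notin> solvable_vecs \<Phi>"
  proof
    assume "hx \<in> solvable_vecs \<Phi>"
    then obtain m where m: "m \<in> \<Phi> \<rightarrow> carrier P" "hx = vec True (combination \<Phi> m)"
      unfolding solvable_vecs_def by blast
    have "h (xs j) = combination \<Phi> m j" for j
      using fun_cong[OF m(2), of "(True, j)"] by (simp add: hx_def vec_def)
    then show False using unsolvable[OF m(1)] by blast
  qed
  define L where "L = K \<inter> vecs q"
  have L: "submodule L \<kk> Vecs" unfolding L_def by (rule Vecs.submodule_Int[OF K(4) vecs_submodule])
  note S = solvable_vecs_submodule[OF \<Phi>]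
  note LS = Vecs.submodule_set_add[OF L S]
  \<comment> \<open>Modulo \<open>w\<close> the generating tuple and its image under \<open>h\<close> coincide.\<close>
  define w where "w = base_tuple \<ominus>\<^bsub>Vecs\<^esub> hx"
  have wc: "w \<in> carrier Vecs" unfolding w_def by (rule Vecs.M.minus_closed[OF base_tuple_carrier hxc])
  note W = Vecs.submodule_multiples[OF wc]
  let ?U = "(L <+>\<^bsub>Vecs\<^esub> solvable_vecs \<Phi>) <+>\<^bsub>Vecs\<^esub> (\<lambda>a. a \<odot>\<^bsub>Vecs\<^esub> w) ` carrier \<kk>"
  have U: "submodule ?U \<kk> Vecs" by (rule Vecs.submodule_set_add[OF LS W])
  have "base_tuple \<notin> ?U"
  proof
    assume "base_tuple \<in> ?U"
    then obtain p a where p: "p \<in> L <+>\<^bsub>Vecs\<^esub> solvable_vecs \<Phi>" and a: "a \<in> ring_center R"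
      and p_eq: "base_tuple = p \<oplus>\<^bsub>Vecs\<^esub> a \<odot>\<^bsub>Vecs\<^esub> w"
      using Vecs.set_add_iff[of base_tuple] by auto
    obtain l s where ls: "l \<in> L" "s \<in> solvable_vecs \<Phi>" and "p = l \<oplus>\<^bsub>Vecs\<^esub> s"
      using p unfolding Vecs.set_add_iff by blast
    then have eq: "base_tuple = (l \<oplus>\<^bsub>Vecs\<^esub> s) \<oplus>\<^bsub>Vecs\<^esub> a \<odot>\<^bsub>Vecs\<^esub> w"
      using p_eq by simp
    note ac = center_carrier[OF a]
    have lF: "l (True, j) = \<zero>\<^bsub>P\<^esub>" and lP: "l (False, j) \<in> carrier P" for j
      using ls(1) vecs_carrier unfolding L_def vecs_def by (blast, auto simp: Vecs_simps)
    have sF: "s (False, j) = \<zero>\<^bsub>P\<^esub>" and sP: "s (True, j) \<in> carrier P" for j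
      using ls(2) combination_closed(2)[OF \<Phi>(2)] unfolding solvable_vecs_def vec_def by auto
    have wF: "w (False, j) = xs j" and wT: "w (True, j) = \<ominus>\<^bsub>P\<^esub> h (xs j)" for j
      unfolding w_def Vecs_minus[OF base_tuple_carrier hxc] using VP[OF xs_V] hP[OF xs_V]
      by (simp_all add: vec_def hx_def P.M.minus_eq)
    have T: "s (True, j) = a \<odot>\<^bsub>P\<^esub> h (xs j)" for j
    proof -
      have "\<zero>\<^bsub>P\<^esub> = s (True, j) \<oplus>\<^bsub>P\<^esub> a \<odot>\<^bsub>P\<^esub> (\<ominus>\<^bsub>P\<^esub> h (xs j))"
        using fun_cong[OF eq, of "(True, j)"] lF sP[of j] wT by (simp add: Vecs_simps vec_def)
      then have "s (True, j) \<ominus>\<^bsub>P\<^esub> a \<odot>\<^bsub>P\<^esub> h (xs j) = \<zero>\<^bsub>P\<^esub>"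
        unfolding P.smult_minus_right[OF ac hP[OF xs_V]] P.M.minus_eq by simp
      then show ?thesis using P.minus_eq_zeroD[OF sP P.smult_closed[OF ac hP[OF xs_V]]] by simp
    qed
    have "a \<in> \<mm>"
    proof (rule ccontr)
      assume "a \<notin> \<mm>"
      then obtain d where d: "d \<in> ring_center R" "\<forall>x\<in>V. d \<odot>\<^bsub>P\<^esub> (a \<odot>\<^bsub>P\<^esub> x) = x"
        using a unfolding noninvertible_scalars_def by blast
      have "(d \<odot>\<^bsub>Vecs\<^esub> s) i = hx i" for i
      proof -
        obtain b j where i: "i = (b, j)" by (cases i)
        have "d \<odot>\<^bsub>P\<^esub> (a \<odot>\<^bsub>P\<^esub> h (xs j)) = h (xs j)"
          using h_smult[OF center_carrier[OF d(1)] center_smult_V[OF a xs_V[of j]]]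
            h_smult[OF ac xs_V[of j]] d(2) xs_V[of j] by simp
        then show ?thesis unfolding i using T[of j] sF[of j] center_carrier[OF d(1)]
          by (cases b) (simp_all add: Vecs_simps hx_def vec_def)
      qed
      then have "d \<odot>\<^bsub>Vecs\<^esub> s = hx" by (rule ext)
      then show False using Vecs.submoduleD(4)[OF S _ ls(2), of d] d(1) hx_notin by simp
    qed
    have "base_tuple i = (l \<oplus>\<^bsub>Vecs\<^esub> a \<odot>\<^bsub>Vecs\<^esub> base_tuple) i" for i
    proof -
      obtain b j where i: "i = (b, j)" by (cases i)
      show ?thesis
        unfolding i using fun_cong[OF eq, of "(False, j)"] lF[of j] lP[of j] sF[of j] wF[of j] ac
        by (cases b) (simp_all add: Vecs_simps vec_def)
    qed
    then have "base_tuple = l \<oplus>\<^bsub>Vecs\<^esub> a \<odot>\<^bsub>Vecs\<^esub> base_tuple" by (rule ext)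
    moreover have "l \<oplus>\<^bsub>Vecs\<^esub> a \<odot>\<^bsub>Vecs\<^esub> base_tuple \<in> K"
      using Vecs.submoduleD(3)[OF K(4)] ls(1) noninvertible_base_tuple[OF detector \<open>a \<in> \<mm>\<close>]
      unfolding L_def by blast
    ultimately show False using K(5) by simp
  qed
  then obtain K' where K': "?U \<subseteq> K'" "maximal_avoiding \<kk> Vecs K' base_tuple"
    using Vecs.maximal_avoiding_exists[OF U base_tuple_carrier] by blast
  have K's: "submodule K' \<kk> Vecs" "base_tuple \<notin> K'" using K'(2) by (auto simp: maximal_avoiding_def)
  have LSK': "L <+>\<^bsub>Vecs\<^esub> solvable_vecs \<Phi> \<subseteq> K'" using Vecs.subset_set_add_left[OF LS W] K'(1) by blast
  have LK': "L \<subseteq> K'" using Vecs.subset_set_add_left[OF L S] LSK' by blast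
  have SK': "solvable_vecs \<Phi> \<subseteq> K'" using Vecs.subset_set_add_right[OF L S] LSK' by blast
  have "\<one>\<^bsub>\<kk>\<^esub> \<odot>\<^bsub>Vecs\<^esub> w \<in> (\<lambda>a. a \<odot>\<^bsub>Vecs\<^esub> w) ` carrier \<kk>" by (rule imageI) (use center_one in simp)
  then have wK': "w \<in> K'"
    using Vecs.subset_set_add_right[OF LS W] K'(1) Vecs.smult_one[OF wc] by auto
  have K'K: "K' \<inter> vecs q \<subseteq> K"
    by (rule Vecs.maximal_avoiding_restrict[OF K(2) K's vecs_submodule base_tuple_in_vecs[OF K(1)]])
      (use LK' L_def in blast)
  have cc: "c \<in> carrier Coeffs" if "c \<in> coeffs q" for c using that coeffs_subset by blast
  have tc: "tensor b c x \<in> carrier Vecs" if "c \<in> coeffs q" "x \<in> carrier P" for b c x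
    by (rule tensor_carrier[OF cc[OF that(1)] that(2)])

  \<comment> \<open>The graph of the map \<open>g\<close>.\<close>
  define G where "G m x \<longleftrightarrow> x \<in> V \<and> (\<forall>c\<in>coeffs q. tensor True c m \<ominus>\<^bsub>Vecs\<^esub> tensor False c x \<in> K')" for m x
  have G_exists: "\<exists>x. G m x" if m: "m \<in> carrier P" for m
  proof -
    have "\<exists>x\<in>V. \<forall>c\<in>carrier (Coeffs\<lparr>carrier := coeffs q\<rparr>).
        tensor True c m \<ominus>\<^bsub>Vecs\<^esub> tensor False c x \<in> K'"
    proof (rule artinian_cring_maximal_ideal.linear_form_is_evaluation[OF artinian_cring_maximal_ideal
          Coeffs.left_module_submodule[OF coeffs_submodule] P_center Vecs_module V_center V_artinian
          _ K'(2)])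
      show "x = \<zero>\<^bsub>P\<^esub>" if "a \<in> carrier \<kk>" "a \<notin> \<mm>" "x \<in> V" "a \<odot>\<^bsub>P\<^esub> x = \<zero>\<^bsub>P\<^esub>" for a x
        using invertible_scalar_inj[of a x] that by simp
      show "a \<odot>\<^bsub>Vecs\<^esub> base_tuple \<in> K'" if a: "a \<in> \<mm>" for a
      proof -
        have "tuple (\<lambda>x. a \<odot>\<^bsub>P\<^esub> x) \<in> L"
          unfolding L_def using K(3) radical_End_noninvertible[OF a]
            tuple_in_vecs[OF radical_EndD[OF radical_End_noninvertible[OF a]] K(1)] by blast
        then show ?thesis unfolding smult_base_tuple[OF noninvertible_center[OF a]] using LK' by blast
      qed
      show "(\<lambda>c. tensor False c x) \<in> left_module_hom \<kk> (Coeffs\<lparr>carrier := coeffs q\<rparr>) Vecs"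
        if x: "x \<in> V" for x
        using left_module_homD[OF tensor_hom_left[OF VP[OF x], of False]] cc
        by (intro left_module_homI) simp_all
      show "(\<lambda>c. tensor True c m) \<in> left_module_hom \<kk> (Coeffs\<lparr>carrier := coeffs q\<rparr>) Vecs"
        using left_module_homD[OF tensor_hom_left[OF m, of True]] cc
        by (intro left_module_homI) simp_all
      show "tensor False c \<in> left_module_hom \<kk> (P\<lparr>carrier := V\<rparr>) Vecs"
        if "c \<in> carrier (Coeffs\<lparr>carrier := coeffs q\<rparr>)" for c
      proof -
        have c: "c \<in> carrier Coeffs" using that cc by simp
        show ?thesis
          using left_module_homD[OF tensor_hom_right[OF c, of False]] VP
          by (intro left_module_homI) simp_all
      qed
      show "tensor True c m \<in> K'"
        if c: "c \<in> carrier (Coeffs\<lparr>carrier := coeffs q\<rparr>)"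
          and cV: "\<And>x. x \<in> V \<Longrightarrow> tensor False c x \<in> K'" for c
      proof -
        have cq: "c \<in> coeffs q" using c by simp
        have "tensor False c x \<in> K" if "x \<in> V" for x
          using cV[OF that] tensor_in_vecs[OF cq that] K'K by blast
        then have "c \<in> annihilating_coeffs q K" unfolding annihilating_coeffs_def using cq by blast
        then show ?thesis using tensor_in_solvable_vecs[OF detector \<Phi> gen _ m] SK' by blast
      qed
    qed
    then show ?thesis unfolding G_def by auto
  qed
  have G_unique: "x = y" if m: "m \<in> carrier P" and x: "G m x" and y: "G m y" for m x y
  proof -
    have xV: "x \<in> V" and yV: "y \<in> V" using x y unfolding G_def by blast+
    have d: "x \<ominus>\<^bsub>P\<^esub> y \<in> V" by (rule P.submoduleD(6)[OF V_submodule xV yV])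
    have "tensor False c (x \<ominus>\<^bsub>P\<^esub> y) \<in> K" if c: "c \<in> coeffs q" for c
    proof -
      interpret t: left_module_map \<kk> P Vecs "tensor False c"
        using tensor_hom_right[OF cc[OF c]] P_center Vecs_module
        by (simp add: left_module_mapI)
      note cs = tc[OF c VP[OF xV], of False] tc[OF c m, of True] tc[OF c VP[OF yV], of False]
      have 1: "tensor False c x \<ominus>\<^bsub>Vecs\<^esub> tensor True c m \<in> K'"
        using x c Vecs.submodule_minus_commute[OF K's(1) cs(2,1)] unfolding G_def by blast
      have 2: "tensor True c m \<ominus>\<^bsub>Vecs\<^esub> tensor False c y \<in> K'" using y c unfolding G_def by blast
      have "tensor False c (x \<ominus>\<^bsub>P\<^esub> y) \<in> K'"
        unfolding t.hom_diff[OF VP[OF xV] VP[OF yV]]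
        by (rule Vecs.submodule_minus_trans[OF K's(1) cs 1 2])
      then show ?thesis using tensor_in_vecs[OF c d] K'K by blast
    qed
    then have "x \<ominus>\<^bsub>P\<^esub> y \<in> undetected q K" unfolding undetected_def using d by blast
    then have "x \<ominus>\<^bsub>P\<^esub> y = \<zero>\<^bsub>P\<^esub>" unfolding separating by blast
    then show ?thesis by (rule P.minus_eq_zeroD[OF VP[OF xV] VP[OF yV]])
  qed
  define g where "g m = (SOME x. G m x)" for m
  have gG: "G m (g m)" if "m \<in> carrier P" for m
    unfolding g_def using someI_ex[OF G_exists[OF that]] .
  have g_eq: "g m = x" if "m \<in> carrier P" "G m x" for m x
    by (rule G_unique[OF that(1) gG[OF that(1)] that(2)])
  have gV: "g m \<in> V" if "m \<in> carrier P" for m using gG[OF that] unfolding G_def by blast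
  have g: "g \<in> left_module_hom R P (P\<lparr>carrier := V\<rparr>)"
  proof (rule left_module_homI)
    show "g m \<in> carrier (P\<lparr>carrier := V\<rparr>)" if "m \<in> carrier P" for m using gV[OF that] by simp
  next
    fix m n assume m: "m \<in> carrier P" and n: "n \<in> carrier P"
    have "G (m \<oplus>\<^bsub>P\<^esub> n) (g m \<oplus>\<^bsub>P\<^esub> g n)"
      unfolding G_def
    proof (intro conjI ballI)
      show "g m \<oplus>\<^bsub>P\<^esub> g n \<in> V" by (rule P.submoduleD(3)[OF V_submodule gV[OF m] gV[OF n]])
      fix c assume c: "c \<in> coeffs q"
      have T: "tensor True c (m \<oplus>\<^bsub>P\<^esub> n) = tensor True c m \<oplus>\<^bsub>Vecs\<^esub> tensor True c n"
        by (rule left_module_homD(2)[OF tensor_hom_right[OF cc[OF c]] m n])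
      have F: "tensor False c (g m \<oplus>\<^bsub>P\<^esub> g n) = tensor False c (g m) \<oplus>\<^bsub>Vecs\<^esub> tensor False c (g n)"
        by (rule left_module_homD(2)[OF tensor_hom_right[OF cc[OF c]] VP[OF gV[OF m]] VP[OF gV[OF n]]])
      show "tensor True c (m \<oplus>\<^bsub>P\<^esub> n) \<ominus>\<^bsub>Vecs\<^esub> tensor False c (g m \<oplus>\<^bsub>P\<^esub> g n) \<in> K'"
        unfolding T F
        by (rule Vecs.submodule_minus_add[OF K's(1) tc[OF c m] tc[OF c VP[OF gV[OF m]]] tc[OF c n]
              tc[OF c VP[OF gV[OF n]]]])
          (use gG[OF m] gG[OF n] c in \<open>simp_all add: G_def\<close>)
    qed
    then show "g (m \<oplus>\<^bsub>P\<^esub> n) = g m \<oplus>\<^bsub>P\<lparr>carrier := V\<rparr>\<^esub> g n"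
      using g_eq[OF P.M.a_closed[OF m n]] by simp
  next
    fix r m assume r: "r \<in> carrier R" and m: "m \<in> carrier P"
    have "G (r \<odot>\<^bsub>P\<^esub> m) (r \<odot>\<^bsub>P\<^esub> g m)"
      unfolding G_def
    proof (intro conjI ballI)
      show "r \<odot>\<^bsub>P\<^esub> g m \<in> V" by (rule P.submoduleD(4)[OF V_submodule r gV[OF m]])
      fix c assume c: "c \<in> coeffs q"
      show "tensor True c (r \<odot>\<^bsub>P\<^esub> m) \<ominus>\<^bsub>Vecs\<^esub> tensor False c (r \<odot>\<^bsub>P\<^esub> g m) \<in> K'"
        unfolding tensor_smult[OF cc[OF c] r m] tensor_smult[OF cc[OF c] r VP[OF gV[OF m]]]
        using gG[OF m] coeffs_mult_right[OF c r] unfolding G_def by blast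
    qed
    then show "g (r \<odot>\<^bsub>P\<^esub> m) = r \<odot>\<^bsub>P\<lparr>carrier := V\<rparr>\<^esub> g m"
      using g_eq[OF P.smult_closed[OF r m]] by simp
  qed
  define u where "u = (\<lambda>x. g (h x))"
  have u: "u \<in> End" unfolding u_def by (rule left_module_hom_comp[OF h g])
  have "u \<notin> radical_End"
  proof
    assume "u \<in> radical_End"
    then have "tuple u \<in> L" unfolding L_def using K(3) tuple_in_vecs[OF u K(1)] by blast
    then have uK': "tuple u \<in> K'" using LK' by blast
    \<comment> \<open>The congruence is derived coordinate by coordinate, from tuples truncated at \<open>t\<close>.\<close>
    define hxt where "hxt t = vec True (\<lambda>j. if j < t then h (xs j) else \<zero>\<^bsub>P\<^esub>)" for t
    define uxt where "uxt t = vec False (\<lambda>j. if j < t then u (xs j) else \<zero>\<^bsub>P\<^esub>)" for t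
    have c1: "hxt t \<in> carrier Vecs" for t unfolding hxt_def by (rule vec_carrier) (use hP[OF xs_V] in simp)
    have c2: "uxt t \<in> carrier Vecs" for t
      unfolding uxt_def by (rule vec_carrier) (use VP[OF EndD(1)[OF u xs_V]] in simp)
    have "hxt t \<ominus>\<^bsub>Vecs\<^esub> uxt t \<in> K'" if "t \<le> q" for t
      using that
    proof (induction t)
      case 0
      have "hxt 0 = \<zero>\<^bsub>Vecs\<^esub>" "uxt 0 = \<zero>\<^bsub>Vecs\<^esub>" unfolding hxt_def uxt_def using vec_eq_zero by simp_all
      then show ?case using Vecs.submoduleD(2)[OF K's(1)] Vecs.minus_zero_right[OF Vecs.M.zero_closed] by simp
    next
      case (Suc t)
      note hxP = hP[OF xs_V[of t]]
      have tq: "unit_coeff t \<in> coeffs q" using Suc.prems by (intro unit_coeff_in) simp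
      have ux: "u (xs t) \<in> V" by (rule EndD(1)[OF u xs_V])
      have e_hx: "e \<odot>\<^bsub>P\<^esub> h (xs t) = h (xs t)"
        using h_smult[OF center_carrier[OF e_center] xs_V[of t]] e_V[OF xs_V[of t]] by simp
      have H: "hxt (Suc t) = hxt t \<oplus>\<^bsub>Vecs\<^esub> tensor True (unit_coeff t) (h (xs t))"
        unfolding hxt_def tensor_unit_coeff[OF hxP] vec_add e_hx
        by (rule arg_cong[of _ _ "vec True"]) (use hP[OF xs_V] in \<open>auto simp: less_Suc_eq\<close>)
      have UX: "uxt (Suc t) = uxt t \<oplus>\<^bsub>Vecs\<^esub> tensor False (unit_coeff t) (u (xs t))"
        unfolding uxt_def tensor_unit_coeff[OF VP[OF ux]] vec_add e_V[OF ux]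
        by (rule arg_cong[of _ _ "vec False"]) (use VP[OF EndD(1)[OF u xs_V]] in \<open>auto simp: less_Suc_eq\<close>)
      have "tensor True (unit_coeff t) (h (xs t)) \<ominus>\<^bsub>Vecs\<^esub> tensor False (unit_coeff t) (u (xs t)) \<in> K'"
        using gG[OF hxP] tq unfolding G_def u_def by blast
      then show ?case
        unfolding H UX using Suc
        by (intro Vecs.submodule_minus_add[OF K's(1) c1 c2 tc[OF tq hxP] tc[OF tq VP[OF ux]]]) simp_all
    qed
    then have "hxt q \<ominus>\<^bsub>Vecs\<^esub> uxt q \<in> K'" by simp
    moreover have "hxt q = hx"
      unfolding hxt_def hx_def using xs_zero K(1) h_zero by (intro arg_cong[of _ _ "vec True"]) auto
    moreover have "uxt q = tuple u"
      unfolding uxt_def tuple_def using xs_zero K(1) EndD(4)[OF u]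
      by (intro arg_cong[of _ _ "vec False"]) auto
    ultimately have "hx \<ominus>\<^bsub>Vecs\<^esub> tuple u \<in> K'" by simp
    then have "hx \<in> K'"
      using Vecs.submodule_minus_iff[OF K's(1) hxc] c2[of q] \<open>uxt q = tuple u\<close> uK' by simp
    then have "w \<oplus>\<^bsub>Vecs\<^esub> hx \<in> K'" by (rule Vecs.submoduleD(3)[OF K's(1) wK'])
    then show False
      unfolding w_def using Vecs.add_minus_cancel[OF base_tuple_carrier hxc] K's(2) by simp
  qed
  then have "bij_betw u V V" using u unfolding radical_End_def by blast
  then have "\<exists>v\<in>End. \<forall>x\<in>V. v (u x) = x" by (elim End_inverse[OF u]) blast
  then obtain v where v: "v \<in> End" "\<forall>x\<in>V. v (u x) = x" ..
  have "(\<lambda>x. v (g x)) \<in> left_module_hom R P (P\<lparr>carrier := V\<rparr>)" by (rule left_module_hom_comp[OF g v(1)])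
  then show ?thesis using v(2) unfolding u_def by (intro bexI[of _ "\<lambda>x. v (g x)"])
qed

lemma isolating_system_for_generators:
  "\<exists>\<Phi>. finite \<Phi> \<and> (\<forall>c\<in>\<Phi>. \<forall>j. c j \<in> carrier R) \<and>
    \<not> (\<exists>m \<in> \<Phi> \<rightarrow> V. \<forall>j. xs j = (\<Oplus>\<^bsub>P\<^esub>c\<in>\<Phi>. c j \<odot>\<^bsub>P\<^esub> m c)) \<and>
    (\<forall>h \<in> left_module_hom R (P\<lparr>carrier := V\<rparr>) P.
      (\<exists>m \<in> \<Phi> \<rightarrow> carrier P. \<forall>j. h (xs j) = (\<Oplus>\<^bsub>P\<^esub>c\<in>\<Phi>. c j \<odot>\<^bsub>P\<^esub> m c)) \<or>
      (\<exists>g \<in> left_module_hom R P (P\<lparr>carrier := V\<rparr>). \<forall>x\<in>V. g (h x) = x))"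
proof -
  obtain q K where detector: "detector q K" and separating: "undetected q K = {\<zero>\<^bsub>P\<^esub>}"
    using exists_separating_detector by blast
  have C: "annihilating_coeffs q K \<subseteq> coeffs q" unfolding annihilating_coeffs_def by blast
  obtain \<Phi> where \<Phi>: "finite \<Phi>" "\<Phi> \<subseteq> annihilating_coeffs q K"
    "submodule_generated \<kk> Coeffs \<Phi> = annihilating_coeffs q K"
    using coeffs_noetherian[OF annihilating_coeffs_submodule[OF detector] C] by blast
  have \<Phi>q: "\<Phi> \<subseteq> coeffs q" using \<Phi>(2) unfolding annihilating_coeffs_def by blast
  have 1: "\<forall>c\<in>\<Phi>. \<forall>j. c j \<in> carrier R" using \<Phi>q coeffs_carrier by blast
  have 2: "\<not> (\<exists>m \<in> \<Phi> \<rightarrow> V. \<forall>j. xs j = combination \<Phi> m j)"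
    using no_solution_in_V[OF detector \<Phi>(1,2)] by blast
  have 3: "(\<exists>m \<in> \<Phi> \<rightarrow> carrier P. \<forall>j. h (xs j) = combination \<Phi> m j) \<or>
      (\<exists>g \<in> left_module_hom R P (P\<lparr>carrier := V\<rparr>). \<forall>x\<in>V. g (h x) = x)"
    if h: "h \<in> left_module_hom R (P\<lparr>carrier := V\<rparr>) P" for h
    using splitting[OF detector separating \<Phi>(1) \<Phi>q \<Phi>(3) h] by blast
  show ?thesis
    by (intro exI[of _ \<Phi>] conjI ballI \<Phi>(1) 1 2[unfolded combination_def] 3[unfolded combination_def])
      (use 1 in blast)+
qed

end

context indecomposable_submodule
begin

text \<open>
  A left almost split map starting at \<open>V\<close>, as far as maps into \<open>P\<close> are concerned, in the language
  of linear equations. This language suits products: solutions in the factors combine to a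
  solution in the product.
\<close>

theorem isolating_system:
  "\<exists>(xs :: nat \<Rightarrow> 'm) \<Phi>. (\<forall>j. xs j \<in> V) \<and> finite \<Phi> \<and> (\<forall>c\<in>\<Phi>. \<forall>j. c j \<in> carrier R) \<and>
    \<not> (\<exists>m \<in> \<Phi> \<rightarrow> V. \<forall>j. xs j = (\<Oplus>\<^bsub>P\<^esub>c\<in>\<Phi>. c j \<odot>\<^bsub>P\<^esub> m c)) \<and>
    (\<forall>h \<in> left_module_hom R (P\<lparr>carrier := V\<rparr>) P.
      (\<exists>m \<in> \<Phi> \<rightarrow> carrier P. \<forall>j. h (xs j) = (\<Oplus>\<^bsub>P\<^esub>c\<in>\<Phi>. c j \<odot>\<^bsub>P\<^esub> m c)) \<or>
      (\<exists>g \<in> left_module_hom R P (P\<lparr>carrier := V\<rparr>). \<forall>x\<in>V. g (h x) = x))"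
proof -
  obtain e where e: "e \<in> ring_center R" "\<forall>x\<in>V. e \<odot>\<^bsub>P\<^esub> x = x"
    "\<forall>a\<in>ring_center R. a \<notin> \<mm> \<longrightarrow> (\<exists>d\<in>ring_center R. d \<otimes> (a \<otimes> e) = e)"
    using localizing_scalar by blast
  interpret localized_submodule R P V e
    by unfold_locales (use e in auto)
  obtain xs q where xs: "\<forall>j :: nat. xs j \<in> V" "\<forall>j\<ge>q. xs j = \<zero>\<^bsub>P\<^esub>"
    "\<forall>s\<in>End. (\<forall>j. s (xs j) = xs j) \<longrightarrow> (\<forall>x\<in>V. s x = x)"
    using V_generators by blast
  interpret generated_localized_submodule R P V e xs q
    by unfold_locales (use xs in auto)
  show ?thesis using isolating_system_for_generators xs(1) by blast
qed

end

section \<open>Direct sums, direct products and summands\<close>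

lemma (in left_module) direct_sum_projections:
  assumes ds: "is_direct_sum_of_submodules R M I N"
  obtains \<pi> where
    "\<And>i. i \<in> I \<Longrightarrow> \<pi> i \<in> left_module_hom R M (M\<lparr>carrier := N i\<rparr>)"
    "\<And>i x. i \<in> I \<Longrightarrow> x \<in> N i \<Longrightarrow> \<pi> i x = x"
    "\<And>i j x. i \<in> I \<Longrightarrow> j \<in> I \<Longrightarrow> i \<noteq> j \<Longrightarrow> x \<in> N i \<Longrightarrow> \<pi> j x = \<zero>\<^bsub>M\<^esub>"
    "\<And>x. x \<in> carrier M \<Longrightarrow> finite {i \<in> I. \<pi> i x \<noteq> \<zero>\<^bsub>M\<^esub>}"
    "\<And>x. x \<in> carrier M \<Longrightarrow> (\<And>i. i \<in> I \<Longrightarrow> \<pi> i x = \<zero>\<^bsub>M\<^esub>) \<Longrightarrow> x = \<zero>\<^bsub>M\<^esub>"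
proof -
  define D where "D x f \<longleftrightarrow> f \<in> (\<Pi>\<^sub>E i \<in> I. N i) \<and> finite {i \<in> I. f i \<noteq> \<zero>\<^bsub>M\<^esub>} \<and>
      x = (\<Oplus>\<^bsub>M\<^esub> i \<in> {i \<in> I. f i \<noteq> \<zero>\<^bsub>M\<^esub>}. f i)" for x f
  have N: "submodule (N i) R M" if "i \<in> I" for i
    using ds that unfolding is_direct_sum_of_submodules_def by blast
  have ex1: "\<exists>!f. D x f" if "x \<in> carrier M" for x
    using ds that unfolding is_direct_sum_of_submodules_def D_def by blast
  define dec where "dec x = (THE f. D x f)" for x
  have dec: "D x (dec x)" if "x \<in> carrier M" for x unfolding dec_def by (rule theI'[OF ex1[OF that]])
  have dec_eq: "dec x = f" if "x \<in> carrier M" "D x f" for x f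
    using ex1[OF that(1)] dec[OF that(1)] that(2) by blast
  have fN: "f i \<in> N i" if "D x f" "i \<in> I" for x f i using that unfolding D_def by blast
  have fM: "f i \<in> carrier M" if "D x f" "i \<in> I" for x f i by (rule submoduleD(7)[OF N[OF that(2)] fN[OF that]])
  have D_sum: "x = (\<Oplus>\<^bsub>M\<^esub>i\<in>T. f i)"
    if f: "D x f" and T: "finite T" "T \<subseteq> I" "{i \<in> I. f i \<noteq> \<zero>\<^bsub>M\<^esub>} \<subseteq> T" for x f T
  proof -
    have fT: "f \<in> T \<rightarrow> carrier M" using fM[OF f] T(2) by blast
    have "x = (\<Oplus>\<^bsub>M\<^esub> i \<in> {i \<in> I. f i \<noteq> \<zero>\<^bsub>M\<^esub>}. f i)" using f unfolding D_def by blast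
    also have "\<dots> = (\<Oplus>\<^bsub>M\<^esub>i\<in>T. f i)"
      by (rule finsum_extend_support[OF T(1,3) fT]) (use T(2) in blast)
    finally show ?thesis .
  qed
  have D_intro: "D x f" if f: "f \<in> (\<Pi>\<^sub>E i \<in> I. N i)" and T: "finite T" "T \<subseteq> I" "{i \<in> I. f i \<noteq> \<zero>\<^bsub>M\<^esub>} \<subseteq> T"
    and x: "x = (\<Oplus>\<^bsub>M\<^esub>i\<in>T. f i)" for x f T
  proof -
    have fT: "f \<in> T \<rightarrow> carrier M" using f T(2) submoduleD(7)[OF N] by blast
    have "(\<Oplus>\<^bsub>M\<^esub> i \<in> {i \<in> I. f i \<noteq> \<zero>\<^bsub>M\<^esub>}. f i) = (\<Oplus>\<^bsub>M\<^esub>i\<in>T. f i)"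
      by (rule finsum_extend_support[OF T(1,3) fT]) (use T(2) in blast)
    then show ?thesis unfolding D_def using f finite_subset[OF T(3,1)] x by simp
  qed
  have D_fin: "finite {i \<in> I. f i \<noteq> \<zero>\<^bsub>M\<^esub>}" if "D x f" for x f using that unfolding D_def by blast
  define \<pi> where "\<pi> i x = dec x i" for i x
  have D_single: "D x (\<lambda>j\<in>I. if j = i then x else \<zero>\<^bsub>M\<^esub>)" if i: "i \<in> I" and x: "x \<in> N i" for i x
  proof (rule D_intro[of _ "{i}"])
    have xM: "x \<in> carrier M" by (rule submoduleD(7)[OF N[OF i] x])
    show "(\<lambda>j\<in>I. if j = i then x else \<zero>\<^bsub>M\<^esub>) \<in> (\<Pi>\<^sub>E i \<in> I. N i)" using submoduleD(2)[OF N] x by auto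
    have "(\<Oplus>\<^bsub>M\<^esub>j\<in>insert i {}. (\<lambda>j\<in>I. if j = i then x else \<zero>\<^bsub>M\<^esub>) j)
        = (\<lambda>j\<in>I. if j = i then x else \<zero>\<^bsub>M\<^esub>) i \<oplus>\<^bsub>M\<^esub> (\<Oplus>\<^bsub>M\<^esub>j\<in>{}. (\<lambda>j\<in>I. if j = i then x else \<zero>\<^bsub>M\<^esub>) j)"
      by (rule M.finsum_insert) (use xM i in auto)
    then show "x = (\<Oplus>\<^bsub>M\<^esub>j\<in>{i}. (\<lambda>j\<in>I. if j = i then x else \<zero>\<^bsub>M\<^esub>) j)"
      unfolding M.finsum_empty using i M.r_zero[OF xM] by simp
  qed (use i in auto)
  have D_add: "D (x \<oplus>\<^bsub>M\<^esub> y) (\<lambda>i\<in>I. f i \<oplus>\<^bsub>M\<^esub> g i)" if f: "D x f" and g: "D y g" for x y f g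
  proof (rule D_intro[of _ "{i \<in> I. f i \<noteq> \<zero>\<^bsub>M\<^esub>} \<union> {i \<in> I. g i \<noteq> \<zero>\<^bsub>M\<^esub>}"])
    let ?T = "{i \<in> I. f i \<noteq> \<zero>\<^bsub>M\<^esub>} \<union> {i \<in> I. g i \<noteq> \<zero>\<^bsub>M\<^esub>}"
    show T: "finite ?T" using D_fin[OF f] D_fin[OF g] by simp
    show "(\<lambda>i\<in>I. f i \<oplus>\<^bsub>M\<^esub> g i) \<in> (\<Pi>\<^sub>E i \<in> I. N i)"
      using submoduleD(3)[OF N fN[OF f] fN[OF g]] by auto
    have fT: "f \<in> ?T \<rightarrow> carrier M" and gT: "g \<in> ?T \<rightarrow> carrier M" using fM[OF f] fM[OF g] by blast+
    have "x \<oplus>\<^bsub>M\<^esub> y = (\<Oplus>\<^bsub>M\<^esub>i\<in>?T. f i) \<oplus>\<^bsub>M\<^esub> (\<Oplus>\<^bsub>M\<^esub>i\<in>?T. g i)"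
      using D_sum[OF f T] D_sum[OF g T] by (simp only: Un_upper1 Un_upper2 Un_subset_iff Collect_subset simp_thms)
    also have "\<dots> = (\<Oplus>\<^bsub>M\<^esub>i\<in>?T. f i \<oplus>\<^bsub>M\<^esub> g i)" by (rule M.finsum_addf[OF fT gT, symmetric])
    also have "\<dots> = (\<Oplus>\<^bsub>M\<^esub>i\<in>?T. (\<lambda>i\<in>I. f i \<oplus>\<^bsub>M\<^esub> g i) i)"
      by (rule M.finsum_cong'[OF refl]) (use fM[OF f] fM[OF g] M.a_closed in auto)
    finally show "x \<oplus>\<^bsub>M\<^esub> y = (\<Oplus>\<^bsub>M\<^esub>i\<in>?T. (\<lambda>i\<in>I. f i \<oplus>\<^bsub>M\<^esub> g i) i)" .
    show "{i \<in> I. (\<lambda>i\<in>I. f i \<oplus>\<^bsub>M\<^esub> g i) i \<noteq> \<zero>\<^bsub>M\<^esub>} \<subseteq> ?T" by auto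
  qed blast
  have D_smult: "D (a \<odot>\<^bsub>M\<^esub> x) (\<lambda>i\<in>I. a \<odot>\<^bsub>M\<^esub> f i)" if f: "D x f" and a: "a \<in> carrier R" for x f a
  proof (rule D_intro[of _ "{i \<in> I. f i \<noteq> \<zero>\<^bsub>M\<^esub>}"])
    let ?T = "{i \<in> I. f i \<noteq> \<zero>\<^bsub>M\<^esub>}"
    show T: "finite ?T" by (rule D_fin[OF f])
    show "(\<lambda>i\<in>I. a \<odot>\<^bsub>M\<^esub> f i) \<in> (\<Pi>\<^sub>E i \<in> I. N i)"
      using submoduleD(4)[OF N a fN[OF f]] by auto
    have fT: "f \<in> ?T \<rightarrow> carrier M" using fM[OF f] by blast
    have "a \<odot>\<^bsub>M\<^esub> x = a \<odot>\<^bsub>M\<^esub> (\<Oplus>\<^bsub>M\<^esub>i\<in>?T. f i)" using f unfolding D_def by simp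
    also have "\<dots> = (\<Oplus>\<^bsub>M\<^esub>i\<in>?T. a \<odot>\<^bsub>M\<^esub> f i)" by (rule finsum_smult_distrib[OF T fT a])
    also have "\<dots> = (\<Oplus>\<^bsub>M\<^esub>i\<in>?T. (\<lambda>i\<in>I. a \<odot>\<^bsub>M\<^esub> f i) i)"
      by (rule M.finsum_cong'[OF refl]) (use fM[OF f] smult_closed[OF a] in auto)
    finally show "a \<odot>\<^bsub>M\<^esub> x = (\<Oplus>\<^bsub>M\<^esub>i\<in>?T. (\<lambda>i\<in>I. a \<odot>\<^bsub>M\<^esub> f i) i)" .
    show "{i \<in> I. (\<lambda>i\<in>I. a \<odot>\<^bsub>M\<^esub> f i) i \<noteq> \<zero>\<^bsub>M\<^esub>} \<subseteq> ?T" using smult_zero_right[OF a] by auto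
  qed blast
  show thesis
  proof (rule that[of \<pi>])
    show "\<pi> i \<in> left_module_hom R M (M\<lparr>carrier := N i\<rparr>)" if i: "i \<in> I" for i
    proof (rule left_module_homI)
      fix x assume x: "x \<in> carrier M"
      show "\<pi> i x \<in> carrier (M\<lparr>carrier := N i\<rparr>)" using fN[OF dec[OF x] i] unfolding \<pi>_def by simp
      show "\<pi> i (x \<oplus>\<^bsub>M\<^esub> y) = \<pi> i x \<oplus>\<^bsub>M\<lparr>carrier := N i\<rparr>\<^esub> \<pi> i y" if y: "y \<in> carrier M" for y
        using dec_eq[OF M.a_closed[OF x y] D_add[OF dec[OF x] dec[OF y]]] i unfolding \<pi>_def by simp
      show "\<pi> i (a \<odot>\<^bsub>M\<^esub> x) = a \<odot>\<^bsub>M\<lparr>carrier := N i\<rparr>\<^esub> \<pi> i x" if a: "a \<in> carrier R" for a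
        using dec_eq[OF smult_closed[OF a x] D_smult[OF dec[OF x] a]] i unfolding \<pi>_def by simp
    qed
    show "\<pi> i x = x" if "i \<in> I" "x \<in> N i" for i x
      using dec_eq[OF submoduleD(7)[OF N[OF that(1)] that(2)] D_single[OF that]] that unfolding \<pi>_def by simp
    show "\<pi> j x = \<zero>\<^bsub>M\<^esub>" if "i \<in> I" "j \<in> I" "i \<noteq> j" "x \<in> N i" for i j x
      using dec_eq[OF submoduleD(7)[OF N[OF that(1)] that(4)] D_single[OF that(1,4)]] that unfolding \<pi>_def by simp
    show "finite {i \<in> I. \<pi> i x \<noteq> \<zero>\<^bsub>M\<^esub>}" if "x \<in> carrier M" for x
      using D_fin[OF dec[OF that]] unfolding \<pi>_def .
    show "x = \<zero>\<^bsub>M\<^esub>" if x: "x \<in> carrier M" and 0: "\<And>i. i \<in> I \<Longrightarrow> \<pi> i x = \<zero>\<^bsub>M\<^esub>" for x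
    proof -
      have "{i \<in> I. dec x i \<noteq> \<zero>\<^bsub>M\<^esub>} \<subseteq> {}" using 0 unfolding \<pi>_def by blast
      then have "x = (\<Oplus>\<^bsub>M\<^esub>i\<in>{}. dec x i)" using D_sum[OF dec[OF x], of "{}"] by blast
      then show ?thesis unfolding M.finsum_empty .
    qed
  qed
qed

text \<open>
  For each \<open>j\<close> and each \<open>b\<close> there is a finite block of coordinates, starting at \<open>b\<close>, onto which
  \<open>Q j\<close> does not project surjectively: otherwise the elements of \<open>Q j\<close> whose first coordinates
  from \<open>b\<close> on vanish would form a strictly descending sequence. Consecutive blocks for
  \<open>j = 0, 1, 2, \<dots>\<close> are filled with elements that are missed.
\<close>

lemma product_not_union_of_artinian:
  assumes "ring R" and M: "\<And>n :: nat. left_module R (M n)" and nonzero: "\<And>n. carrier (M n) \<noteq> {\<zero>\<^bsub>M n\<^esub>}"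
    and Q: "\<And>j :: nat. submodule (Q j) R (product_module UNIV M)"
      "\<And>j. artinian_in R (product_module UNIV M) (Q j)"
  shows "\<exists>x\<in>carrier (product_module UNIV M). \<forall>j. x \<notin> Q j"
proof -
  let ?P = "product_module UNIV M"
  interpret P: left_module R ?P by (rule left_module_product_module[OF assms(1) M])
  have block: "\<exists>c>b. \<exists>y\<in>carrier ?P. \<forall>x\<in>Q j. \<exists>n. b \<le> n \<and> n < c \<and> x n \<noteq> y n" for b j
  proof (rule ccontr)
    assume neg: "\<not> ?thesis"
    define K where "K m = {x \<in> Q j. \<forall>n. b \<le> n \<and> n < b + m \<longrightarrow> x n = \<zero>\<^bsub>M n\<^esub>}" for m
    have "\<exists>m. \<forall>l\<ge>m. K l = K m"
    proof (rule artinian_in_chain[OF Q(2)[of j]])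
      show "submodule (K m) R ?P" for m
      proof (rule P.submoduleI)
        show "K m \<subseteq> carrier ?P" unfolding K_def using P.submoduleD(1)[OF Q(1)] by blast
        show "\<zero>\<^bsub>?P\<^esub> \<in> K m" unfolding K_def using P.submoduleD(2)[OF Q(1)] by (simp add: product_module_UNIV(2))
        show "x \<oplus>\<^bsub>?P\<^esub> y \<in> K m" if "x \<in> K m" "y \<in> K m" for x y
          using that P.submoduleD(3)[OF Q(1)] left_module.zero_add_zero[OF M] unfolding K_def by (simp add: product_module_UNIV(3))
        show "a \<odot>\<^bsub>?P\<^esub> x \<in> K m" if "a \<in> carrier R" "x \<in> K m" for a x
          using that P.submoduleD(4)[OF Q(1)] left_module.smult_zero_right[OF M that(1)]
          unfolding K_def by (simp add: product_module_UNIV(4))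
      qed
      show "K m \<subseteq> Q j" for m unfolding K_def by blast
      show "K (Suc m) \<subseteq> K m" for m unfolding K_def by auto
    qed
    then obtain m where m: "\<forall>l\<ge>m. K l = K m" ..
    have eq: "K (Suc m) = K m" by (rule m[rule_format]) simp
    note z = left_module.zero_in_carrier[OF M]
    obtain t where t: "t \<in> carrier (M (b + m))" "t \<noteq> \<zero>\<^bsub>M (b + m)\<^esub>" using nonzero[of "b + m"] z[of "b + m"] by blast
    define y where "y n = (if n = b + m then t else \<zero>\<^bsub>M n\<^esub>)" for n
    have y: "y \<in> carrier ?P" using t(1) z unfolding y_def by (simp add: product_module_UNIV(1))
    have "b < b + Suc m" by simp
    then have "\<not> (\<forall>x\<in>Q j. \<exists>n. b \<le> n \<and> n < b + Suc m \<and> x n \<noteq> y n)" using neg y by blast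
    then obtain x where x: "x \<in> Q j" "\<forall>n. b \<le> n \<and> n < b + Suc m \<longrightarrow> x n = y n" by blast
    have "x \<in> K m" unfolding K_def using x unfolding y_def by auto
    then have "x \<in> K (Suc m)" using eq by simp
    then have "x (b + m) = \<zero>\<^bsub>M (b + m)\<^esub>" unfolding K_def by simp
    then show False using x(2)[rule_format, of "b + m"] t(2) unfolding y_def by simp
  qed
  define c where "c j b = (SOME c. b < c \<and> (\<exists>y\<in>carrier ?P. \<forall>x\<in>Q j. \<exists>n. b \<le> n \<and> n < c \<and> x n \<noteq> y n))" for j b
  have c: "b < c j b" "\<exists>y\<in>carrier ?P. \<forall>x\<in>Q j. \<exists>n. b \<le> n \<and> n < c j b \<and> x n \<noteq> y n" for j b
    using someI_ex[OF block[of b j]] unfolding c_def by blast+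
  define \<beta> where "\<beta> = rec_nat 0 c"
  have \<beta>: "\<beta> (Suc j) = c j (\<beta> j)" for j unfolding \<beta>_def by simp
  have "\<exists>y. y \<in> carrier ?P \<and> (\<forall>x\<in>Q j. \<exists>n. \<beta> j \<le> n \<and> n < \<beta> (Suc j) \<and> x n \<noteq> y n)" for j
    using c(2)[of j "\<beta> j"] unfolding \<beta> Bex_def[of "carrier ?P"] .
  then have "\<forall>j. \<exists>y. y \<in> carrier ?P \<and> (\<forall>x\<in>Q j. \<exists>n. \<beta> j \<le> n \<and> n < \<beta> (Suc j) \<and> x n \<noteq> y n)" ..
  then obtain y where y: "\<forall>j. y j \<in> carrier ?P \<and> (\<forall>x\<in>Q j. \<exists>n. \<beta> j \<le> n \<and> n < \<beta> (Suc j) \<and> x n \<noteq> y j n)"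
    by (rule choice[THEN exE])
  have mono: "strict_mono \<beta>" unfolding strict_mono_Suc_iff \<beta> using c(1) by blast
  define z where "z n = y (LEAST j. n < \<beta> (Suc j)) n" for n
  have z_eq: "z n = y j n" if "\<beta> j \<le> n" "n < \<beta> (Suc j)" for j n
  proof -
    have "(LEAST j. n < \<beta> (Suc j)) = j"
    proof (rule Least_equality)
      fix i assume "n < \<beta> (Suc i)"
      then have "\<beta> j < \<beta> (Suc i)" using that(1) by simp
      then show "j \<le> i" using mono by (simp add: strict_mono_less)
    qed (rule that(2))
    then show ?thesis unfolding z_def by simp
  qed
  have "z \<in> carrier ?P" using y unfolding z_def by (simp add: product_module_UNIV(1))
  moreover have "z \<notin> Q j" for j
  proof
    assume "z \<in> Q j"
    then obtain n where "\<beta> j \<le> n" "n < \<beta> (Suc j)" "z n \<noteq> y j n" using y by blast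
    then show False using z_eq by blast
  qed
  ultimately show ?thesis by blast
qed

context artin_algebra
begin

text \<open>
  A minimal nonzero direct summand is indecomposable.
\<close>

lemma indecomposable_summand_exists:
  assumes P: "left_module R P" and N: "submodule N R P" "N \<noteq> {\<zero>\<^bsub>P\<^esub>}" "artinian_in \<kk> P N"
  shows "\<exists>V p. indecomposable_submodule R P V \<and> V \<subseteq> N \<and>
    p \<in> left_module_hom R (P\<lparr>carrier := N\<rparr>) (P\<lparr>carrier := V\<rparr>) \<and> (\<forall>x\<in>V. p x = x)"
proof -
  interpret P: left_module R P by fact
  let ?Q = "\<lambda>V. (submodule V R P \<and> V \<subseteq> N \<and> V \<noteq> {\<zero>\<^bsub>P\<^esub>}) \<and>
    (\<exists>p\<in>left_module_hom R (P\<lparr>carrier := N\<rparr>) (P\<lparr>carrier := V\<rparr>). \<forall>x\<in>V. p x = x)"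
  have QN: "?Q N"
  proof (intro conjI bexI[of _ "\<lambda>x. x"])
    show "(\<lambda>x. x) \<in> left_module_hom R (P\<lparr>carrier := N\<rparr>) (P\<lparr>carrier := N\<rparr>)"
      by (rule left_module_homI) auto
  qed (use N in auto)
  obtain V where V: "?Q V" and Vmin: "\<And>V'. ?Q V' \<Longrightarrow> V' \<subseteq> V \<Longrightarrow> V' = V"
  proof (rule artinian_in_minimal[OF N(3), of ?Q N])
    show "?Q N" by (rule QN)
    show "submodule V \<kk> P \<and> V \<subseteq> N" if "?Q V" for V using that submodule_center[OF P] by blast
  qed blast
  have Vs: "submodule V R P" "V \<subseteq> N" "V \<noteq> {\<zero>\<^bsub>P\<^esub>}" using V by blast+
  obtain p where p: "p \<in> left_module_hom R (P\<lparr>carrier := N\<rparr>) (P\<lparr>carrier := V\<rparr>)" "\<forall>x\<in>V. p x = x"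
    using V by blast
  have "A = {\<zero>\<^bsub>P\<^esub>} \<or> B = {\<zero>\<^bsub>P\<^esub>}"
    if A: "submodule A R P" and B: "submodule B R P" and AV: "A \<subseteq> V" and BV: "B \<subseteq> V"
      and int: "A \<inter> B = {\<zero>\<^bsub>P\<^esub>}" and sum: "V \<subseteq> A <+>\<^bsub>P\<^esub> B" for A B
  proof (rule disjCI)
    assume B0: "B \<noteq> {\<zero>\<^bsub>P\<^esub>}"
    show "A = {\<zero>\<^bsub>P\<^esub>}"
    proof (rule ccontr)
      assume A0: "A \<noteq> {\<zero>\<^bsub>P\<^esub>}"
      \<comment> \<open>The graph of the projection of \<open>V\<close> onto \<open>A\<close> along \<open>B\<close>.\<close>
      define G where "G x a \<longleftrightarrow> a \<in> A \<and> x \<ominus>\<^bsub>P\<^esub> a \<in> B" for x a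
      note AP = P.submoduleD(7)[OF A] and BP = P.submoduleD(7)[OF B] and VP = P.submoduleD(7)[OF Vs(1)]
      have G_ex: "\<exists>a. G x a" if x: "x \<in> V" for x
      proof -
        obtain a b where ab: "a \<in> A" "b \<in> B" "x = a \<oplus>\<^bsub>P\<^esub> b" using sum x P.set_add_iff[of x A B] by blast
        have "x \<ominus>\<^bsub>P\<^esub> a = b"
          using P.minus_add_cancel[OF BP[OF ab(2)] AP[OF ab(1)]] P.M.a_comm[OF AP[OF ab(1)] BP[OF ab(2)]] ab(3)
          by simp
        then show ?thesis unfolding G_def using ab by blast
      qed
      have G_unique: "a = a'" if x: "x \<in> V" and a: "G x a" and a': "G x a'" for x a a'
      proof -
        have aA: "a \<in> A" "a' \<in> A" using a a' unfolding G_def by blast+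
        have b: "x \<ominus>\<^bsub>P\<^esub> a \<in> B" "x \<ominus>\<^bsub>P\<^esub> a' \<in> B" using a a' unfolding G_def by blast+
        have "a \<ominus>\<^bsub>P\<^esub> x \<in> B" by (rule P.submodule_minus_commute[OF B VP[OF x] AP[OF aA(1)] b(1)])
        then have "a \<ominus>\<^bsub>P\<^esub> a' \<in> B"
          by (rule P.submodule_minus_trans[OF B AP[OF aA(1)] VP[OF x] AP[OF aA(2)] _ b(2)])
        then have "a \<ominus>\<^bsub>P\<^esub> a' = \<zero>\<^bsub>P\<^esub>" using P.submoduleD(6)[OF A aA] int by blast
        then show ?thesis by (rule P.minus_eq_zeroD[OF AP[OF aA(1)] AP[OF aA(2)]])
      qed
      define r where "r x = (SOME a. G x a)" for x
      have rG: "G x (r x)" if "x \<in> V" for x unfolding r_def by (rule someI_ex[OF G_ex[OF that]])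
      have r_eq: "r x = a" if "x \<in> V" "G x a" for x a by (rule G_unique[OF that(1) rG[OF that(1)] that(2)])
      have rA: "r x \<in> A" if "x \<in> V" for x using rG[OF that] unfolding G_def by blast
      have r: "r \<in> left_module_hom R (P\<lparr>carrier := V\<rparr>) (P\<lparr>carrier := A\<rparr>)"
      proof (rule left_module_homI)
        show "r x \<in> carrier (P\<lparr>carrier := A\<rparr>)" if "x \<in> carrier (P\<lparr>carrier := V\<rparr>)" for x using rA that by simp
      next
        fix x y assume "x \<in> carrier (P\<lparr>carrier := V\<rparr>)" "y \<in> carrier (P\<lparr>carrier := V\<rparr>)"
        then have x: "x \<in> V" and y: "y \<in> V" by simp_all
        have "G (x \<oplus>\<^bsub>P\<^esub> y) (r x \<oplus>\<^bsub>P\<^esub> r y)"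
          unfolding G_def
          using P.submoduleD(3)[OF A rA[OF x] rA[OF y]]
            P.submodule_minus_add[OF B VP[OF x] AP[OF rA[OF x]] VP[OF y] AP[OF rA[OF y]]] rG[OF x] rG[OF y]
          unfolding G_def by blast
        then show "r (x \<oplus>\<^bsub>P\<lparr>carrier := V\<rparr>\<^esub> y) = r x \<oplus>\<^bsub>P\<lparr>carrier := A\<rparr>\<^esub> r y"
          using r_eq[OF P.submoduleD(3)[OF Vs(1) x y]] by simp
      next
        fix a x assume a: "a \<in> carrier R" and "x \<in> carrier (P\<lparr>carrier := V\<rparr>)"
        then have x: "x \<in> V" by simp
        have "G (a \<odot>\<^bsub>P\<^esub> x) (a \<odot>\<^bsub>P\<^esub> r x)"
          unfolding G_def
          using P.submoduleD(4)[OF A a rA[OF x]]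
            P.submodule_minus_smult[OF B a VP[OF x] AP[OF rA[OF x]]] rG[OF x]
          unfolding G_def by blast
        then show "r (a \<odot>\<^bsub>P\<lparr>carrier := V\<rparr>\<^esub> x) = a \<odot>\<^bsub>P\<lparr>carrier := A\<rparr>\<^esub> r x"
          using r_eq[OF P.submoduleD(4)[OF Vs(1) a x]] by simp
      qed
      have r_id: "r x = x" if "x \<in> A" for x
        by (rule r_eq) (use that AV P.minus_self[OF AP[OF that]] P.submoduleD(2)[OF B] in \<open>auto simp: G_def\<close>)
      have rp: "(\<lambda>x. r (p x)) \<in> left_module_hom R (P\<lparr>carrier := N\<rparr>) (P\<lparr>carrier := A\<rparr>)"
        by (rule left_module_hom_comp[OF p(1) r])
      have "\<forall>x\<in>A. r (p x) = x" using p(2) r_id AV by auto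
      then have "\<exists>p\<in>left_module_hom R (P\<lparr>carrier := N\<rparr>) (P\<lparr>carrier := A\<rparr>). \<forall>x\<in>A. p x = x"
        using rp by (intro bexI[of _ "\<lambda>x. r (p x)"])
      then have "A = V" using Vmin[of A] A A0 AV Vs(2) by blast
      then show False using int BV B0 by blast
    qed
  qed
  then have "indecomposable_submodule R P V"
    unfolding indecomposable_submodule_def indecomposable_submodule_axioms_def
    using artin_algebra_axioms P Vs artinian_in_subset[OF N(3) Vs(2)] by blast
  then show ?thesis using p Vs(2) by blast
qed

end

text \<open>
  The image of \<open>h\<close> is a nonzero direct summand of \<open>M\<close>, with the kernel of \<open>g\<close> as a complement.
\<close>

lemma left_module_isomorphic_if_split:
  assumes M: "left_module R V" "left_module R M" and V: "carrier V \<noteq> {\<zero>\<^bsub>V\<^esub>}"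
    and ind: "indecomposable_module R M"
    and h: "h \<in> left_module_hom R V M" and g: "g \<in> left_module_hom R M V" and gh: "\<And>x. x \<in> carrier V \<Longrightarrow> g (h x) = x"
  shows "left_module_isomorphic R V M"
proof -
  interpret h: left_module_map R V M h using M h by (simp add: left_module_mapI)
  interpret g: left_module_map R M V g using M g by (simp add: left_module_mapI)
  let ?A = "h ` carrier V" and ?B = "{x \<in> carrier M. g x \<in> {\<zero>\<^bsub>V\<^esub>}}"
  have A: "submodule ?A R M" by (rule h.submodule_image[OF h.M.submodule_carrier])
  have B: "submodule ?B R M" by (rule g.submodule_preimage[OF h.M.submodule_zero h.N.submodule_carrier])
  have "?A \<inter> ?B \<subseteq> {\<zero>\<^bsub>M\<^esub>}" using gh h.hom_zero by auto
  then have int: "?A \<inter> ?B = {\<zero>\<^bsub>M\<^esub>}" using h.N.submoduleD(2)[OF A] h.N.submoduleD(2)[OF B] by blast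
  have dec: "x \<ominus>\<^bsub>M\<^esub> h (g x) \<in> ?B" "x = h (g x) \<oplus>\<^bsub>M\<^esub> (x \<ominus>\<^bsub>M\<^esub> h (g x))" if x: "x \<in> carrier M" for x
  proof -
    have gx: "g x \<in> carrier V" by (rule g.homD(1)[OF x])
    have hgx: "h (g x) \<in> carrier M" by (rule h.homD(1)[OF gx])
    have "g (x \<ominus>\<^bsub>M\<^esub> h (g x)) = \<zero>\<^bsub>V\<^esub>"
      unfolding g.hom_diff[OF x hgx] gh[OF gx] by (rule h.M.minus_self[OF gx])
    then show "x \<ominus>\<^bsub>M\<^esub> h (g x) \<in> ?B" using h.N.M.minus_closed[OF x hgx] by simp
    show "x = h (g x) \<oplus>\<^bsub>M\<^esub> (x \<ominus>\<^bsub>M\<^esub> h (g x))"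
      using h.N.add_minus_cancel[OF x hgx] h.N.M.a_comm[OF hgx h.N.M.minus_closed[OF x hgx]] by simp
  qed
  have "carrier M \<subseteq> ?A <+>\<^bsub>M\<^esub> ?B"
  proof
    fix x assume x: "x \<in> carrier M"
    show "x \<in> ?A <+>\<^bsub>M\<^esub> ?B"
      unfolding h.N.set_add_iff
      by (rule bexI[of _ "h (g x)"], rule bexI[of _ "x \<ominus>\<^bsub>M\<^esub> h (g x)"])
        (use dec[OF x] g.homD(1)[OF x] in auto)
  qed
  then have "?A <+>\<^bsub>M\<^esub> ?B = carrier M" using h.N.submoduleD(1)[OF h.N.submodule_set_add[OF A B]] by blast
  then have "?A = {\<zero>\<^bsub>M\<^esub>} \<or> ?B = {\<zero>\<^bsub>M\<^esub>}" using ind A B int unfolding indecomposable_module_def by blast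
  moreover have "?A \<noteq> {\<zero>\<^bsub>M\<^esub>}"
  proof
    assume A0: "?A = {\<zero>\<^bsub>M\<^esub>}"
    have "x = \<zero>\<^bsub>V\<^esub>" if "x \<in> carrier V" for x
    proof -
      have "h x = \<zero>\<^bsub>M\<^esub>" using A0 that by blast
      then show ?thesis using gh[OF that] g.hom_zero by simp
    qed
    then show False using V h.M.M.zero_closed by blast
  qed
  ultimately have B0: "?B = {\<zero>\<^bsub>M\<^esub>}" by blast
  have "h (g x) = x" if x: "x \<in> carrier M" for x
  proof -
    have "x \<ominus>\<^bsub>M\<^esub> h (g x) = \<zero>\<^bsub>M\<^esub>" using dec(1)[OF x] B0 by blast
    then show ?thesis using h.N.minus_eq_zeroD[OF x h.homD(1)[OF g.homD(1)[OF x]]] by simp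
  qed
  then have "bij_betw h (carrier V) (carrier M)"
    using gh h.homD(1) g.homD(1) by (intro bij_betw_byWitness[of _ g]) auto
  then show ?thesis unfolding left_module_isomorphic_def using h by blast
qed

lemma left_module_isomorphic_cancel:
  assumes M: "left_module R V" "left_module R M" "left_module R N"
    and 1: "left_module_isomorphic R V M" and 2: "left_module_isomorphic R V N"
  shows "left_module_isomorphic R M N"
proof -
  interpret V: left_module R V by fact
  interpret M: left_module R M by fact
  obtain f where f: "f \<in> left_module_hom R V M" "bij_betw f (carrier V) (carrier M)"
    using 1 unfolding left_module_isomorphic_def by blast
  obtain h where h: "h \<in> left_module_hom R V N" "bij_betw h (carrier V) (carrier N)"
    using 2 unfolding left_module_isomorphic_def by blast
  define g where "g = inv_into (carrier V) f"
  have g_bij: "bij_betw g (carrier M) (carrier V)" unfolding g_def by (rule bij_betw_inv_into[OF f(2)])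
  have fg: "f (g y) = y" if "y \<in> carrier M" for y
    unfolding g_def using bij_betw_inv_into_right[OF f(2) that] .
  have gf: "g (f x) = x" if "x \<in> carrier V" for x
    unfolding g_def using bij_betw_inv_into_left[OF f(2) that] .
  have gV: "g y \<in> carrier V" if "y \<in> carrier M" for y using bij_betw_apply[OF g_bij that] .
  have "g \<in> left_module_hom R M V"
  proof (rule left_module_homI[OF gV])
    show "g (x \<oplus>\<^bsub>M\<^esub> y) = g x \<oplus>\<^bsub>V\<^esub> g y" if "x \<in> carrier M" "y \<in> carrier M" for x y
      using left_module_homD(2)[OF f(1) gV[OF that(1)] gV[OF that(2)]] fg that
        gf[OF V.M.a_closed[OF gV[OF that(1)] gV[OF that(2)]]] by simp
    show "g (a \<odot>\<^bsub>M\<^esub> x) = a \<odot>\<^bsub>V\<^esub> g x" if "a \<in> carrier R" "x \<in> carrier M" for a x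
      using left_module_homD(3)[OF f(1) that(1) gV[OF that(2)]] fg that
        gf[OF V.smult_closed[OF that(1) gV[OF that(2)]]] by simp
  qed
  then have "(\<lambda>x. h (g x)) \<in> left_module_hom R M N" using left_module_hom_comp[OF _ h(1)] by blast
  moreover have "bij_betw (\<lambda>x. h (g x)) (carrier M) (carrier N)"
    using bij_betw_trans[OF g_bij h(2)] unfolding comp_def .
  ultimately show ?thesis unfolding left_module_isomorphic_def by (intro bexI[of _ "\<lambda>x. h (g x)"])
qed

section \<open>Products of pairwise non-isomorphic indecomposable modules\<close>

context artin_algebra
begin

text \<open>
  The set in question is the sum of the \<open>N i\<close> with \<open>i\<close> in both \<open>I\<close> and \<open>F\<close>.
\<close>

lemma artinian_in_finite_support:
  assumes P: "left_module R P" and N: "\<And>i. i \<in> I \<Longrightarrow> submodule (N i) R P" "\<And>i. i \<in> I \<Longrightarrow> artinian_in \<kk> P (N i)"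
    and \<pi>: "\<And>i. i \<in> I \<Longrightarrow> \<pi> i \<in> left_module_hom R P (P\<lparr>carrier := N i\<rparr>)"
    "\<And>i x. i \<in> I \<Longrightarrow> x \<in> N i \<Longrightarrow> \<pi> i x = x"
    "\<And>i j x. i \<in> I \<Longrightarrow> j \<in> I \<Longrightarrow> i \<noteq> j \<Longrightarrow> x \<in> N i \<Longrightarrow> \<pi> j x = \<zero>\<^bsub>P\<^esub>"
    "\<And>x. x \<in> carrier P \<Longrightarrow> (\<And>i. i \<in> I \<Longrightarrow> \<pi> i x = \<zero>\<^bsub>P\<^esub>) \<Longrightarrow> x = \<zero>\<^bsub>P\<^esub>"
    and F: "finite F"
  shows "submodule {x \<in> carrier P. \<forall>i\<in>I - F. \<pi> i x = \<zero>\<^bsub>P\<^esub>} \<kk> P \<and>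
    artinian_in \<kk> P {x \<in> carrier P. \<forall>i\<in>I - F. \<pi> i x = \<zero>\<^bsub>P\<^esub>}"
proof -
  interpret P: left_module R P by fact
  interpret Pk: left_module \<kk> P by (rule left_module_center[OF P])
  let ?U = "\<lambda>F. {x \<in> carrier P. \<forall>i\<in>I - F. \<pi> i x = \<zero>\<^bsub>P\<^esub>}"
  have pair: "left_module_map R P P (\<pi> i)" if i: "i \<in> I" for i
  proof -
    have "\<pi> i \<in> left_module_hom R P P"
      using left_module_homD[OF \<pi>(1)[OF i]] P.submoduleD(7)[OF N(1)[OF i]]
      by (intro left_module_homI) auto
    then show ?thesis using P by (simp add: left_module_mapI)
  qed
  have \<pi>N: "\<pi> i x \<in> N i" if "i \<in> I" "x \<in> carrier P" for i x
    using left_module_homD(1)[OF \<pi>(1)[OF that(1)] that(2)] by simp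
  have NP: "x \<in> carrier P" if "i \<in> I" "x \<in> N i" for i x using P.submoduleD(7)[OF N(1)[OF that(1)] that(2)] .
  have U: "submodule (?U F) R P" for F
  proof (rule P.submoduleI)
    show "\<zero>\<^bsub>P\<^esub> \<in> ?U F" using left_module_map.hom_zero[OF pair] by simp
    show "x \<oplus>\<^bsub>P\<^esub> y \<in> ?U F" if "x \<in> ?U F" "y \<in> ?U F" for x y
      using that left_module_map.homD(2)[OF pair] by simp
    show "a \<odot>\<^bsub>P\<^esub> x \<in> ?U F" if "a \<in> carrier R" "x \<in> ?U F" for a x
      using that left_module_map.homD(3)[OF pair] by simp
  qed blast
  have "artinian_in \<kk> P (?U F)"
    using F
  proof (induction F rule: finite_induct)
    case empty
    have "?U {} \<subseteq> {\<zero>\<^bsub>P\<^esub>}" using \<pi>(4) by blast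
    then show ?case by (rule artinian_in_subset[OF Pk.artinian_in_zero])
  next
    case (insert i F)
    show ?case
    proof (cases "i \<in> I")
      case False
      then have "I - insert i F = I - F" by blast
      then show ?thesis using insert.IH by simp
    next
      case i: True
      note Nk = submodule_center[OF P N(1)[OF i]]
      have "(\<lambda>x. x) \<in> left_module_hom \<kk> (P\<lparr>carrier := N i\<rparr>) P"
        by (rule left_module_homI) (use NP[OF i] in auto)
      then interpret inc: left_module_map \<kk> "P\<lparr>carrier := N i\<rparr>" P "\<lambda>x. x"
        using Pk.left_module_submodule[OF Nk] Pk.left_module_axioms
        by (simp add: left_module_mapI)
      have art: "artinian_in \<kk> (P\<lparr>carrier := N i\<rparr>) (carrier (P\<lparr>carrier := N i\<rparr>))"
        using N(2)[OF i] unfolding artinian_in_def Pk.submodule_of_submodule[OF Nk] by simp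
      have "artinian_in \<kk> P (?U F <+>\<^bsub>P\<^esub> (\<lambda>x. x) ` carrier (P\<lparr>carrier := N i\<rparr>))"
        by (rule inc.artinian_in_set_add_image[OF submodule_center[OF P U] insert.IH art])
      moreover have "?U (insert i F) \<subseteq> ?U F <+>\<^bsub>P\<^esub> (\<lambda>x. x) ` carrier (P\<lparr>carrier := N i\<rparr>)"
      proof
        fix x assume x: "x \<in> ?U (insert i F)"
        then have xP: "x \<in> carrier P" by simp
        have xi: "\<pi> i x \<in> N i" by (rule \<pi>N[OF i xP])
        have "\<pi> j (x \<ominus>\<^bsub>P\<^esub> \<pi> i x) = \<zero>\<^bsub>P\<^esub>" if j: "j \<in> I - F" for j
        proof -
          have jI: "j \<in> I" using j by blast
          have d: "\<pi> j (x \<ominus>\<^bsub>P\<^esub> \<pi> i x) = \<pi> j x \<ominus>\<^bsub>P\<^esub> \<pi> j (\<pi> i x)"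
            by (rule left_module_map.hom_diff[OF pair[OF jI] xP NP[OF i xi]])
          have "\<pi> j x = \<pi> j (\<pi> i x)"
          proof (cases "j = i")
            case True
            then show ?thesis using \<pi>(2)[OF i xi] by simp
          next
            case False
            then have "\<pi> j (\<pi> i x) = \<zero>\<^bsub>P\<^esub>" using \<pi>(3)[OF i jI _ xi] by blast
            moreover have "\<pi> j x = \<zero>\<^bsub>P\<^esub>" using x j False by blast
            ultimately show ?thesis by simp
          qed
          then show ?thesis using d P.minus_self NP[OF jI \<pi>N[OF jI xP]] by simp
        qed
        then have "x \<ominus>\<^bsub>P\<^esub> \<pi> i x \<in> ?U F" using P.M.minus_closed[OF xP NP[OF i xi]] by blast
        moreover have "x = (x \<ominus>\<^bsub>P\<^esub> \<pi> i x) \<oplus>\<^bsub>P\<^esub> \<pi> i x"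
          using P.add_minus_cancel[OF xP NP[OF i xi]] by simp
        moreover have "\<pi> i x \<in> (\<lambda>x. x) ` carrier (P\<lparr>carrier := N i\<rparr>)" using xi by simp
        ultimately show "x \<in> ?U F <+>\<^bsub>P\<^esub> (\<lambda>x. x) ` carrier (P\<lparr>carrier := N i\<rparr>)"
          unfolding P.set_add_iff by blast
      qed
      ultimately show ?thesis by (rule artinian_in_subset)
    qed
  qed
  then show ?thesis using submodule_center[OF P U] by blast
qed

lemma finite_support_of_finitely_generated:
  assumes L: "left_module R L" and P: "left_module R P" and fg: "finitely_generated_module R L"
    and \<iota>: "\<iota> \<in> left_module_hom R L P"
    and \<pi>: "\<And>i. i \<in> I \<Longrightarrow> \<pi> i \<in> left_module_hom R P P"
    and fin: "\<And>x. x \<in> carrier P \<Longrightarrow> finite {i \<in> I. \<pi> i x \<noteq> \<zero>\<^bsub>P\<^esub>}"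
  shows "finite {i \<in> I. \<exists>x\<in>carrier L. \<pi> i (\<iota> x) \<noteq> \<zero>\<^bsub>P\<^esub>}"
proof -
  interpret L: left_module R L by fact
  interpret P: left_module R P by fact
  obtain A where A: "finite A" "A \<subseteq> carrier L" "submodule_generated R L A = carrier L"
    using fg unfolding finitely_generated_module_def by blast
  let ?F = "\<Union>a\<in>A. {i \<in> I. \<pi> i (\<iota> a) \<noteq> \<zero>\<^bsub>P\<^esub>}"
  have "finite ?F" using A(1,2) fin left_module_homD(1)[OF \<iota>] by blast
  moreover have "{i \<in> I. \<exists>x\<in>carrier L. \<pi> i (\<iota> x) \<noteq> \<zero>\<^bsub>P\<^esub>} \<subseteq> ?F"
  proof (rule subsetI, rule ccontr)
    fix i assume i: "i \<in> {i \<in> I. \<exists>x\<in>carrier L. \<pi> i (\<iota> x) \<noteq> \<zero>\<^bsub>P\<^esub>}" and notin: "i \<notin> ?F"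
    then have iI: "i \<in> I" by blast
    interpret c: left_module_map R L P "\<lambda>x. \<pi> i (\<iota> x)"
      using L P left_module_hom_comp[OF \<iota> \<pi>[OF iI]]
      by (simp add: left_module_mapI)
    have "carrier L \<subseteq> {x \<in> carrier L. \<pi> i (\<iota> x) \<in> {\<zero>\<^bsub>P\<^esub>}}"
      using L.submodule_generated_minimal[OF c.submodule_preimage[OF P.submodule_zero L.submodule_carrier], of A]
        A(2,3) notin iI by blast
    then show False using i by blast
  qed
  ultimately show ?thesis by (rule rev_finite_subset)
qed

text \<open>
  The equations of the isolating system are solved in each \<open>M n\<close> that is not isomorphic to \<open>V\<close>,
  and at the exceptional index \<open>n\<close>, if there is one, the right-hand side is replaced by zero. The
  tuple in \<open>P\<close> whose equations are solved in this way differs from \<open>x\<close> only in one component, and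
  \<open>g\<close> vanishes on this component.
\<close>

lemma no_summand_vanishing_on_components:
  fixes M :: "nat \<Rightarrow> ('a, 'm, 'd) module_scheme" and V :: "(nat \<Rightarrow> 'm) set"
  assumes M: "\<And>n. left_module R (M n)" "\<And>n. indecomposable_module R (M n)"
    and non_iso: "\<And>m n. m \<noteq> n \<Longrightarrow> \<not> left_module_isomorphic R (M m) (M n)"
    and V: "indecomposable_submodule R (product_module UNIV M) V"
    and g: "g \<in> left_module_hom R (product_module UNIV M) ((product_module UNIV M)\<lparr>carrier := V\<rparr>)"
    and g_V: "\<And>x. x \<in> V \<Longrightarrow> g x = x"
    and g_M: "\<And>n x. x \<in> carrier (M n) \<Longrightarrow>
      g (component_vector M n x) = \<zero>\<^bsub>product_module UNIV M\<^esub>"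
  shows False
proof -
  let ?P = "product_module UNIV M"
  interpret V: indecomposable_submodule R ?P V by (rule V)
  have Mn: "left_module_map R ?P (M n) (\<lambda>x. x n)" for n
    by (rule product_module_UNIV_coordinate_hom[OF ring_axioms M(1)])
  note M0 = left_module.zero_in_carrier[OF M(1)]
  let ?\<iota> = "component_vector M"
  have coord: "v n \<in> carrier (M n)" if "v \<in> carrier ?P" for v n using that by (simp add: product_module_UNIV(1))
  note \<iota> = component_vector_hom[of R M, OF M(1)]
  note VP = V.VP
  interpret g: left_module_map R ?P ?P g
  proof -
    have "g \<in> left_module_hom R ?P ?P"
      using left_module_homD[OF g] VP by (intro left_module_homI) auto
    then show "left_module_map R ?P ?P g"
      using V.P.left_module_axioms by (simp add: left_module_mapI)
  qed
  have gV: "g x \<in> V" if "x \<in> carrier ?P" for x using left_module_homD(1)[OF g that] by simp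
  obtain xs \<Phi> where xs: "\<forall>j :: nat. xs j \<in> V" and \<Phi>: "finite \<Phi>" "\<forall>c\<in>\<Phi>. \<forall>j. c j \<in> carrier R"
    and unsolvable: "\<not> (\<exists>m \<in> \<Phi> \<rightarrow> V. \<forall>j. xs j = (\<Oplus>\<^bsub>?P\<^esub>c\<in>\<Phi>. c j \<odot>\<^bsub>?P\<^esub> m c))"
    and isolating: "\<forall>h \<in> left_module_hom R (?P\<lparr>carrier := V\<rparr>) ?P.
      (\<exists>m \<in> \<Phi> \<rightarrow> carrier ?P. \<forall>j. h (xs j) = (\<Oplus>\<^bsub>?P\<^esub>c\<in>\<Phi>. c j \<odot>\<^bsub>?P\<^esub> m c)) \<or>
      (\<exists>g \<in> left_module_hom R ?P (?P\<lparr>carrier := V\<rparr>). \<forall>x\<in>V. g (h x) = x)"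
    using V.isolating_system by blast
  have xsP: "xs j \<in> carrier ?P" for j using VP xs by blast
  \<comment> \<open>The set of exceptional indices has at most one element.\<close>
  define S where "S = {n. left_module_isomorphic R (?P\<lparr>carrier := V\<rparr>) (M n)}"
  have S: "m = n" if "m \<in> S" "n \<in> S" for m n
    using left_module_isomorphic_cancel[OF V.V_module M(1) M(1), of m n] that non_iso unfolding S_def by blast
  have solution: "\<exists>m \<in> \<Phi> \<rightarrow> carrier ?P. \<forall>j. xs j n = (\<Oplus>\<^bsub>M n\<^esub>c\<in>\<Phi>. c j \<odot>\<^bsub>M n\<^esub> m c n)" if n: "n \<notin> S" for n
  proof -
    interpret n: left_module_map R ?P "M n" "\<lambda>x. x n" by (rule Mn)
    have cV: "(\<lambda>x. x n) \<in> left_module_hom R (?P\<lparr>carrier := V\<rparr>) (M n)"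
      using n.homD VP by (intro left_module_homI) auto
    have h: "(\<lambda>x. ?\<iota> n (x n)) \<in> left_module_hom R (?P\<lparr>carrier := V\<rparr>) ?P"
      by (rule left_module_hom_comp[OF cV \<iota>])
    have "\<not> (\<exists>g' \<in> left_module_hom R ?P (?P\<lparr>carrier := V\<rparr>). \<forall>x\<in>V. g' (?\<iota> n (x n)) = x)"
    proof
      assume "\<exists>g' \<in> left_module_hom R ?P (?P\<lparr>carrier := V\<rparr>). \<forall>x\<in>V. g' (?\<iota> n (x n)) = x"
      then obtain g' where g': "g' \<in> left_module_hom R ?P (?P\<lparr>carrier := V\<rparr>)" "\<forall>x\<in>V. g' (?\<iota> n (x n)) = x" ..
      have "left_module_isomorphic R (?P\<lparr>carrier := V\<rparr>) (M n)"
        by (rule left_module_isomorphic_if_split[OF V.V_module M(1) _ M(2) cV left_module_hom_comp[OF \<iota> g'(1)]])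
          (use g'(2) V.V_nonzero in auto)
      then show False using n unfolding S_def by blast
    qed
    then obtain m where m: "m \<in> \<Phi> \<rightarrow> carrier ?P"
      "\<forall>j. ?\<iota> n (xs j n) = (\<Oplus>\<^bsub>?P\<^esub>c\<in>\<Phi>. c j \<odot>\<^bsub>?P\<^esub> m c)"
      using bspec[OF isolating h] by blast
    have "xs j n = (\<Oplus>\<^bsub>M n\<^esub>c\<in>\<Phi>. c j \<odot>\<^bsub>M n\<^esub> m c n)" for j
    proof -
      have cl: "c j \<odot>\<^bsub>?P\<^esub> m c \<in> carrier ?P" if "c \<in> \<Phi>" for c
        using V.P.smult_closed[of "c j" "m c"] \<Phi>(2) m(1) that by blast
      have "xs j n = ?\<iota> n (xs j n) n" by (simp add: component_vector_def)
      also have "\<dots> = (\<Oplus>\<^bsub>?P\<^esub>c\<in>\<Phi>. c j \<odot>\<^bsub>?P\<^esub> m c) n" using m(2) by simp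
      also have "\<dots> = (\<Oplus>\<^bsub>M n\<^esub>c\<in>\<Phi>. (c j \<odot>\<^bsub>?P\<^esub> m c) n)" by (rule n.hom_finsum[OF \<Phi>(1) cl])
      finally show ?thesis unfolding product_module_UNIV(4) .
    qed
    then show ?thesis using m(1) by blast
  qed
  have "\<exists>m. n \<notin> S \<longrightarrow> m \<in> \<Phi> \<rightarrow> carrier ?P \<and> (\<forall>j. xs j n = (\<Oplus>\<^bsub>M n\<^esub>c\<in>\<Phi>. c j \<odot>\<^bsub>M n\<^esub> m c n))" for n
    using solution[of n] by blast
  then have "\<forall>n. \<exists>m. n \<notin> S \<longrightarrow>
      m \<in> \<Phi> \<rightarrow> carrier ?P \<and> (\<forall>j. xs j n = (\<Oplus>\<^bsub>M n\<^esub>c\<in>\<Phi>. c j \<odot>\<^bsub>M n\<^esub> m c n))" ..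
  then obtain m where "\<forall>n. n \<notin> S \<longrightarrow>
      m n \<in> \<Phi> \<rightarrow> carrier ?P \<and> (\<forall>j. xs j n = (\<Oplus>\<^bsub>M n\<^esub>c\<in>\<Phi>. c j \<odot>\<^bsub>M n\<^esub> m n c n))"
    by (rule choice[THEN exE])
  then have m: "m n \<in> \<Phi> \<rightarrow> carrier ?P" "xs j n = (\<Oplus>\<^bsub>M n\<^esub>c\<in>\<Phi>. c j \<odot>\<^bsub>M n\<^esub> m n c n)"
    if "n \<notin> S" for n j using that by simp_all
  define \<mu> where "\<mu> c = (\<lambda>n. if n \<in> S then \<zero>\<^bsub>M n\<^esub> else m n c n)" for c
  have \<mu>P: "\<mu> c \<in> carrier ?P" if c: "c \<in> \<Phi>" for c
  proof -
    have "\<mu> c n \<in> carrier (M n)" for n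
    proof (cases "n \<in> S")
      case True
      then show ?thesis unfolding \<mu>_def using M0 by simp
    next
      case False
      then show ?thesis unfolding \<mu>_def using coord[OF funcset_mem[OF m(1)[OF False] c], of n] by simp
    qed
    then show ?thesis unfolding product_module_UNIV(1) by blast
  qed
  have cl: "c j \<odot>\<^bsub>?P\<^esub> \<mu> c \<in> carrier ?P" if "c \<in> \<Phi>" for c j
    using V.P.smult_closed[of "c j" "\<mu> c"] \<Phi>(2) \<mu>P that by blast
  define y where "y j = (\<Oplus>\<^bsub>?P\<^esub>c\<in>\<Phi>. c j \<odot>\<^bsub>?P\<^esub> \<mu> c)" for j
  have yP: "y j \<in> carrier ?P" for j unfolding y_def by (rule V.P.M.finsum_closed) (use cl in blast)
  have y_n: "y j n = (if n \<in> S then \<zero>\<^bsub>M n\<^esub> else xs j n)" for j n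
  proof -
    interpret n: left_module_map R ?P "M n" "\<lambda>x. x n" by (rule Mn)
    have "y j n = (\<Oplus>\<^bsub>M n\<^esub>c\<in>\<Phi>. (c j \<odot>\<^bsub>?P\<^esub> \<mu> c) n)" unfolding y_def by (rule n.hom_finsum[OF \<Phi>(1) cl])
    also have "\<dots> = (\<Oplus>\<^bsub>M n\<^esub>c\<in>\<Phi>. c j \<odot>\<^bsub>M n\<^esub> \<mu> c n)" unfolding product_module_UNIV(4) ..
    also have "\<dots> = (if n \<in> S then \<zero>\<^bsub>M n\<^esub> else xs j n)"
    proof (cases "n \<in> S")
      case True
      have "(\<Oplus>\<^bsub>M n\<^esub>c\<in>\<Phi>. c j \<odot>\<^bsub>M n\<^esub> \<mu> c n) = (\<Oplus>\<^bsub>M n\<^esub>c\<in>\<Phi>. \<zero>\<^bsub>M n\<^esub>)"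
        by (rule n.N.M.finsum_cong'[OF refl]) (use True M0 \<Phi>(2) in \<open>auto simp: \<mu>_def\<close>)
      then show ?thesis using True by (simp only: n.N.M.finsum_zero if_True)
    next
      case False
      then show ?thesis using m(2)[OF False, of j] unfolding \<mu>_def by simp
    qed
    finally show ?thesis .
  qed
  have "g (y j) = xs j" for j
  proof (cases "S = {}")
    case True
    then have "y j = xs j" using y_n by (intro ext) simp
    then show ?thesis using g_V xs by simp
  next
    case False
    then obtain n0 where "n0 \<in> S" by blast
    then have S_eq: "S = {n0}" using S by blast
    have c: "?\<iota> n0 (xs j n0) \<in> carrier ?P" by (rule left_module_homD(1)[OF \<iota> coord[OF xsP]])
    have "xs j = y j \<oplus>\<^bsub>?P\<^esub> ?\<iota> n0 (xs j n0)"
    proof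
      fix n
      interpret n: left_module_map R ?P "M n" "\<lambda>x. x n" by (rule Mn)
      show "xs j n = (y j \<oplus>\<^bsub>?P\<^esub> ?\<iota> n0 (xs j n0)) n"
        unfolding product_module_UNIV(3) y_n S_eq component_vector_def
        using n.N.M.l_zero[OF coord[OF xsP[of j], of n]] n.N.M.r_zero[OF coord[OF xsP[of j], of n]]
        by (cases "n = n0") simp_all
    qed
    then have "g (xs j) = g (y j \<oplus>\<^bsub>?P\<^esub> ?\<iota> n0 (xs j n0))" by (rule arg_cong)
    also have "\<dots> = g (y j) \<oplus>\<^bsub>?P\<^esub> g (?\<iota> n0 (xs j n0))" by (rule g.homD(2)[OF yP c])
    finally have "g (xs j) = g (y j)"
      unfolding g_M[OF coord[OF xsP]] using V.P.M.r_zero[OF g.homD(1)[OF yP]] by simp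
    then show ?thesis using g_V xs by simp
  qed
  moreover have "g (y j) = (\<Oplus>\<^bsub>?P\<^esub>c\<in>\<Phi>. c j \<odot>\<^bsub>?P\<^esub> g (\<mu> c))" for j
  proof -
    have "g (y j) = (\<Oplus>\<^bsub>?P\<^esub>c\<in>\<Phi>. g (c j \<odot>\<^bsub>?P\<^esub> \<mu> c))" unfolding y_def by (rule g.hom_finsum[OF \<Phi>(1) cl])
    also have "\<dots> = (\<Oplus>\<^bsub>?P\<^esub>c\<in>\<Phi>. c j \<odot>\<^bsub>?P\<^esub> g (\<mu> c))"
      by (rule V.P.M.finsum_cong'[OF refl])
        (use g.homD(1,3) \<mu>P \<Phi>(2) V.P.smult_closed in \<open>simp_all add: Pi_iff\<close>)
    finally show ?thesis .
  qed
  ultimately have "\<forall>j. xs j = (\<Oplus>\<^bsub>?P\<^esub>c\<in>\<Phi>. c j \<odot>\<^bsub>?P\<^esub> g (\<mu> c))" by simp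
  moreover have "(\<lambda>c. g (\<mu> c)) \<in> \<Phi> \<rightarrow> V" using gV \<mu>P by blast
  ultimately have "\<exists>m \<in> \<Phi> \<rightarrow> V. \<forall>j. xs j = (\<Oplus>\<^bsub>?P\<^esub>c\<in>\<Phi>. c j \<odot>\<^bsub>?P\<^esub> m c)"
    by (intro bexI[of _ "\<lambda>c. g (\<mu> c)"])
  then show False using unsolvable by contradiction
qed

end

theorem proposition2:
  fixes R :: "('r, 'c) ring_scheme"
    and M :: "nat \<Rightarrow> ('r, 'm, 'd) module_scheme"
  assumes "artin_algebra R"
    and "\<And>n. left_module R (M n)"
    and "\<And>n. finitely_generated_module R (M n)"
    and "\<And>n. indecomposable_module R (M n)"
    and "\<And>m n. m \<noteq> n \<Longrightarrow> \<not> left_module_isomorphic R (M m) (M n)"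
  shows "\<not> (\<exists>(I :: 'i set) N.
    is_direct_sum_of_submodules R (product_module UNIV M) I N \<and>
    (\<forall>i \<in> I. finitely_generated_module R ((product_module UNIV M)\<lparr>carrier := N i\<rparr>)))"
proof
  let ?P = "product_module UNIV M"
  interpret artin_algebra R by (rule assms(1))
  interpret P: left_module R ?P by (rule left_module_product_module[OF ring_axioms assms(2)])
  assume "\<exists>(I :: 'i set) N. is_direct_sum_of_submodules R ?P I N \<and>
    (\<forall>i \<in> I. finitely_generated_module R (?P\<lparr>carrier := N i\<rparr>))"
  then obtain I :: "'i set" and N where ds: "is_direct_sum_of_submodules R ?P I N"
    and fg: "\<And>i. i \<in> I \<Longrightarrow> finitely_generated_module R (?P\<lparr>carrier := N i\<rparr>)" by blast
  have N: "submodule (N i) R ?P" if "i \<in> I" for i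
    using ds that unfolding is_direct_sum_of_submodules_def by blast
  have N_art: "artinian_in \<kk> ?P (N i)" if "i \<in> I" for i
    by (rule artinian_in_finitely_generated_submodule[OF P.left_module_axioms N[OF that] fg[OF that]])
  obtain \<pi> where \<pi>:
    "\<And>i. i \<in> I \<Longrightarrow> \<pi> i \<in> left_module_hom R ?P (?P\<lparr>carrier := N i\<rparr>)"
    "\<And>i x. i \<in> I \<Longrightarrow> x \<in> N i \<Longrightarrow> \<pi> i x = x"
    "\<And>i j x. i \<in> I \<Longrightarrow> j \<in> I \<Longrightarrow> i \<noteq> j \<Longrightarrow> x \<in> N i \<Longrightarrow> \<pi> j x = \<zero>\<^bsub>?P\<^esub>"
    "\<And>x. x \<in> carrier ?P \<Longrightarrow> finite {i \<in> I. \<pi> i x \<noteq> \<zero>\<^bsub>?P\<^esub>}"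
    "\<And>x. x \<in> carrier ?P \<Longrightarrow> (\<And>i. i \<in> I \<Longrightarrow> \<pi> i x = \<zero>\<^bsub>?P\<^esub>) \<Longrightarrow> x = \<zero>\<^bsub>?P\<^esub>"
    by (rule P.direct_sum_projections[OF ds]) blast
  have \<pi>P: "\<pi> i \<in> left_module_hom R ?P ?P" if "i \<in> I" for i
    using left_module_homD[OF \<pi>(1)[OF that]] P.submoduleD(7)[OF N[OF that]]
    by (intro left_module_homI) auto
  let ?\<iota> = "component_vector M"
  note \<iota> = component_vector_hom[of R M, OF assms(2)]
  \<comment> \<open>The indices of the summands that are met by \<open>M n\<close>.\<close>
  define F where "F n = {i \<in> I. \<exists>x\<in>carrier (M n). \<pi> i (?\<iota> n x) \<noteq> \<zero>\<^bsub>?P\<^esub>}" for n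
  have F: "finite (F n)" for n
    unfolding F_def
    by (rule finite_support_of_finitely_generated[OF assms(2) P.left_module_axioms assms(3) \<iota> \<pi>P \<pi>(4)])
  define Q where "Q j = {x \<in> carrier ?P. \<forall>i\<in>I - (\<Union>n\<le>j. F n). \<pi> i x = \<zero>\<^bsub>?P\<^esub>}" for j :: nat
  have finU: "finite (\<Union>n\<le>j. F n)" for j :: nat using F by simp
  have Q: "submodule (Q j) \<kk> ?P \<and> artinian_in \<kk> ?P (Q j)" for j
    unfolding Q_def
    by (rule artinian_in_finite_support[OF P.left_module_axioms N N_art \<pi>(1-3,5) finU])
  have nonzero: "carrier (M n) \<noteq> {\<zero>\<^bsub>M n\<^esub>}" for n
    using assms(4)[of n] unfolding indecomposable_module_def by blast
  have "ring \<kk>" using artinian_cring.axioms(1)[OF center_artinian_cring] by (simp add: cring_def)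
  then obtain x where x: "x \<in> carrier ?P" "\<And>j. x \<notin> Q j"
    using product_not_union_of_artinian[of \<kk> M Q] left_module_center[OF assms(2)] nonzero Q by blast
  have "\<exists>i\<in>I. i \<notin> (\<Union>n. F n) \<and> N i \<noteq> {\<zero>\<^bsub>?P\<^esub>}"
  proof (rule ccontr)
    assume neg: "\<not> ?thesis"
    let ?s = "{i \<in> I. \<pi> i x \<noteq> \<zero>\<^bsub>?P\<^esub>}"
    have "i \<in> (\<Union>n. F n)" if i: "i \<in> ?s" for i
      using neg i left_module_homD(1)[OF \<pi>(1) x(1), of i] by auto
    then have "\<forall>i\<in>?s. \<exists>n. i \<in> F n" by blast
    then obtain \<nu> where \<nu>: "\<forall>i\<in>?s. i \<in> F (\<nu> i)" by (rule bchoice[THEN exE])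
    have "finite (\<nu> ` ?s)" using \<pi>(4)[OF x(1)] by simp
    then obtain j where j: "\<forall>n\<in>\<nu> ` ?s. n \<le> j" using finite_nat_set_iff_bounded_le by blast
    have "\<pi> i x = \<zero>\<^bsub>?P\<^esub>" if i: "i \<in> I - (\<Union>n\<le>j. F n)" for i
    proof (rule ccontr)
      assume "\<pi> i x \<noteq> \<zero>\<^bsub>?P\<^esub>"
      then have "i \<in> ?s" using i by blast
      then have "i \<in> F (\<nu> i)" "\<nu> i \<le> j" using \<nu> j by blast+
      then show False using i by blast
    qed
    then have "x \<in> Q j" unfolding Q_def using x(1) by blast
    then show False using x(2) by blast
  qed
  then obtain i where i: "i \<in> I" "i \<notin> (\<Union>n. F n)" "N i \<noteq> {\<zero>\<^bsub>?P\<^esub>}" by blast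
  obtain V p where V: "indecomposable_submodule R ?P V" "V \<subseteq> N i"
    and p: "p \<in> left_module_hom R (?P\<lparr>carrier := N i\<rparr>) (?P\<lparr>carrier := V\<rparr>)" "\<forall>x\<in>V. p x = x"
    using indecomposable_summand_exists[OF P.left_module_axioms N[OF i(1)] i(3) N_art[OF i(1)]] by blast
  have p0: "p \<zero>\<^bsub>?P\<^esub> = \<zero>\<^bsub>?P\<^esub>"
    using p(2) P.submoduleD(2)[OF indecomposable_submodule.V_submodule[OF V(1)]] by blast
  show False
  proof (rule no_summand_vanishing_on_components[OF assms(2,4,5) V(1) left_module_hom_comp[OF \<pi>(1)[OF i(1)] p(1)]])
    show "p (\<pi> i x) = x" if "x \<in> V" for x using \<pi>(2)[OF i(1)] V(2) p(2) that by auto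
    show "p (\<pi> i (?\<iota> n x)) = \<zero>\<^bsub>?P\<^esub>" if x: "x \<in> carrier (M n)" for n x
    proof -
      have "\<pi> i (?\<iota> n x) = \<zero>\<^bsub>?P\<^esub>" using i(1,2) x unfolding F_def by blast
      then show ?thesis using p0 by simp
    qed
  qed
qed

end
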